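(* Let $\delta$ be such that $0<\delta<1/42$, and let $\Delta(x)$ be the error term for the number of non-isomorphic abelian groups defined in the context. Then either $$\int_T^{2T}\Delta^4(x)\,dx=\Omega\left(T^{5/3+\delta}\right)\qquad\text{or}\qquad\Delta(x)=\Omega_\pm\left(x^{1/6-\delta}\right).$$
   Context: Let $a_n$ be the number of non-isomorphic abelian groups of order $n$, and $$\Delta(x)=\sum_{n\le x}^*a_n-\sum_{k=1}^6\Big(\prod_{j\ge1,\,j\ne k}\zeta(j/k)\Big)x^{1/k},$$ where $\sum^*_{n\le x}a_n=\sum_{n\le x}a_n$ if $x\notin\mathbb N$ and $\sum_{n\le x}a_n-\frac12a_x$ if $x\in\mathbb N$. For positive $g$: $f=\Omega(g)$ means $\limsup_{x\to\infty}|f(x)|/g(x)>0$; $f=\Omega_\pm(g)$ means $\limsup_{x\to\infty}f(x)/g(x)>0$ and $\liminf_{x\to\infty}f(x)/g(x)<0$. *)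

theory Defs
  imports "HOL-Complex_Analysis.Complex_Analysis" "HOL-Algebra.Group"
begin

(* Every finite group is isomorphic to one whose carrier is a set of natural numbers. *)
definition abelian_groups_of_order :: "nat \<Rightarrow> nat monoid set" where
  "abelian_groups_of_order n = {G. comm_group G \<and> card (carrier G) = n}"

definition num_abelian_groups :: "nat \<Rightarrow> nat" where
  "num_abelian_groups n =
     card (abelian_groups_of_order n //
       {(G, H). G \<in> abelian_groups_of_order n \<and> H \<in> abelian_groups_of_order n \<and> G \<cong> H})"

(* The normalisation at the pole only serves to make the description unique. *)
definition riemann_zeta :: "complex \<Rightarrow> complex" where
  "riemann_zeta = (THE f. f holomorphic_on (- {1}) \<and>
     (\<forall>s. Re s > 1 \<longrightarrow> (\<lambda>n. 1 / of_nat (Suc n) powr s) sums f s) \<and> f 1 = 0)"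

(* The product over j \<ge> 1 with j \<noteq> k, indexed by j - 1. The zeta function is real-valued at
   real arguments, so taking real parts loses nothing. *)
definition main_coeff :: "nat \<Rightarrow> real" where
  "main_coeff k =
     (\<Prod>i. if Suc i = k then 1 else Re (riemann_zeta (of_nat (Suc i) / of_nat k)))"

definition starred_sum :: "(nat \<Rightarrow> real) \<Rightarrow> real \<Rightarrow> real" where
  "starred_sum f x =
     (\<Sum>n | 1 \<le> n \<and> real n \<le> x. f n) - (if x \<in> \<nat> then f (nat \<lfloor>x\<rfloor>) / 2 else 0)"

definition Delta :: "real \<Rightarrow> real" where
  "Delta x = starred_sum (\<lambda>n. real (num_abelian_groups n)) x -
     (\<Sum>k=1..6. main_coeff k * x powr (1 / real k))"

(* These are the analytic number theorist's Omega-symbols (the negation of little-o and its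
   signed variant), for positive g; the Omega of HOL-Library.Landau_Symbols is the stronger
   lower bound f \<ge> c g for all large arguments. *)
definition is_Omega :: "(real \<Rightarrow> real) \<Rightarrow> (real \<Rightarrow> real) \<Rightarrow> bool" where
  "is_Omega f g \<longleftrightarrow> Limsup at_top (\<lambda>x. ereal (\<bar>f x\<bar> / g x)) > 0"

definition is_Omega_pm :: "(real \<Rightarrow> real) \<Rightarrow> (real \<Rightarrow> real) \<Rightarrow> bool" where
  "is_Omega_pm f g \<longleftrightarrow>
     Limsup at_top (\<lambda>x. ereal (f x / g x)) > 0 \<and> Liminf at_top (\<lambda>x. ereal (f x / g x)) < 0"

end

theory Submission
  imports Defs
    "HOL-Algebra.Multiplicative_Group"
    "HOL-Algebra.Elementary_Groups"
begin

text \<open>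
  Write \<open>F(s) = \<zeta>(s) \<zeta>(2s) \<zeta>(3s) \<cdots>\<close> for the Dirichlet series of the numbers of abelian groups
  (\<open>num_abelian_groups_sums\<close>). For \<open>Re s > 1\<close> the Mellin integral of \<open>Delta(x) x powr (-s - 1)\<close>
  over \<open>x \<ge> 1\<close> is \<open>F(s)/s\<close> minus its principal parts at \<open>1, 1/2, \<dots>, 1/6\<close> (\<open>Delta_mellin\<close>), and
  this difference continues to a holomorphic function \<open>G\<close> on \<open>Re s > 1/7\<close>
  (\<open>abelian_zeta_subtract_poles\<close>). If both alternatives fail, then the fourth moment of
  \<open>Delta\<close> over \<open>[T, 2T]\<close> is at most \<open>T powr (5/3 + \<delta>)\<close> for all large \<open>T\<close>, and one of \<open>Delta\<close>,
  \<open>-Delta\<close> is at most \<open>x powr (1/6 - \<delta>)\<close> for all large \<open>x\<close>. Both bounds together make the mean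
  square of \<open>G\<close> on a vertical line finite, while the functional equation makes it infinite.

  For the finiteness, Landau's theorem (\<open>landau_mellin\<close>) turns the one-sided bound into absolute
  convergence of the Mellin integral on \<open>Re s > 1/6 - \<delta>\<close>, where it must equal \<open>G\<close>; the condition
  \<open>\<delta> < 1/42\<close> says that this half-plane lies in the domain of \<open>G\<close>. Interpolating between this first
  moment and the fourth moment shows that \<open>Delta(x)\<^sup>2 x powr (-2\<sigma> - 1)\<close> is integrable for
  \<open>\<sigma> = 1/6 - \<delta>/12\<close> (\<open>mean_square_finite\<close>), and one half of Plancherel's theorem
  (\<open>mellin_mean_square_le\<close>) bounds the integral of \<open>|G(\<sigma> + it)|\<^sup>2\<close> over \<open>[0, T]\<close> independently of \<open>T\<close>.

  For the growth, \<open>\<sigma>\<close>, \<open>2\<sigma>\<close> and \<open>3\<sigma>\<close> lie to the left of \<open>1/2\<close>, so that by the functional equation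
  the factors \<open>\<zeta>(s)\<close>, \<open>\<zeta>(2s)\<close>, \<open>\<zeta>(3s)\<close> exceed their reflected values by
  \<open>t powr (1/2 - \<sigma>)\<close>, \<open>t powr (1/2 - 2\<sigma>)\<close> and \<open>t powr (1/2 - 3\<sigma>)\<close>, up to constants; the exponents
  add up to \<open>1/2 + \<delta>/2\<close>. What remains is a function that tends to \<open>1\<close> to the right and grows
  polynomially, and Cauchy's theorem with a kernel that is small on horizontal segments bounds the
  mean of its modulus on \<open>[T, 2T]\<close> from below by a positive constant (\<open>mean_value_lower_bound\<close>).
  The integral of \<open>|G(\<sigma> + it)|\<^sup>2\<close> over \<open>[T, 2T]\<close> is therefore at least a constant times \<open>T powr \<delta>\<close>
  (\<open>continued_mellin_mean_square_unbounded\<close>), the contribution of the subtracted poles being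
  bounded.

  The argument rests on three foundations. The structure theorem for finite abelian groups identifies
  \<open>num_abelian_groups n\<close> with the number of divisor chains of product \<open>n\<close>, whose Dirichlet series is
  the product of the \<open>\<zeta>(ks)\<close>. The zeta function is continued by its expansion from the
  trapezoidal rule, and its functional equation results from evaluating one Mellin integral in two
  ways. The Gamma factor in it is estimated through the logarithmic convexity of
  the factors of its infinite product.
\<close>

section \<open>Splitting off a cyclic subgroup of maximal order\<close>

lemma finite_obtain_max:
  fixes f :: "'a \<Rightarrow> nat"
  assumes "finite S" "S \<noteq> {}"
  obtains a where "a \<in> S" "\<And>x. x \<in> S \<Longrightarrow> f x \<le> f a"
proof -
  have "Max (f ` S) \<in> f ` S" using assms by (intro Max_in) auto
  then obtain a where "a \<in> S" "f a = Max (f ` S)" by auto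
  thus ?thesis using that[of a] assms by simp
qed

lemma (in comm_group) ord_mult_coprime:
  assumes x: "x \<in> carrier G" and y: "y \<in> carrier G" and co: "coprime (ord x) (ord y)"
  shows "ord (x \<otimes> y) = ord x * ord y"
proof (rule dvd_antisym)
  show "ord (x \<otimes> y) dvd ord x * ord y"
    using abelian_ord_mul_divides[OF x y] .
  define n where "n = ord (x \<otimes> y)"
  have n: "(x \<otimes> y) [^] (n * k) = \<one>" for k
    using x y by (simp add: pow_eq_id n_def)
  have "x [^] (n * ord y) = \<one>"
  proof -
    have "y [^] (n * ord y) = \<one>" using y by (simp add: pow_eq_id)
    thus ?thesis using n[of "ord y"] x y by (simp add: nat_pow_distrib)
  qed
  hence 1: "ord x dvd n"
    using x co by (simp add: pow_eq_id coprime_dvd_mult_left_iff)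
  have "y [^] (n * ord x) = \<one>"
  proof -
    have "x [^] (n * ord x) = \<one>" using x by (simp add: pow_eq_id)
    thus ?thesis using n[of "ord x"] x y by (simp add: nat_pow_distrib)
  qed
  hence 2: "ord y dvd n"
    using y co by (simp add: pow_eq_id coprime_dvd_mult_left_iff coprime_commute)
  show "ord x * ord y dvd ord (x \<otimes> y)"
    using divides_mult[OF 1 2 co] by (simp add: n_def)
qed

lemma (in group) subgroup_nat_pow_closed:
  "subgroup H G \<Longrightarrow> h \<in> H \<Longrightarrow> h [^] (k::nat) \<in> H"
  using subgroup_int_pow_closed[of H h "int k"] by (simp add: int_pow_int)

lemma (in group) ord_pos_finite: "finite (carrier G) \<Longrightarrow> x \<in> carrier G \<Longrightarrow> ord x > 0"
  using ord_ge_1[of x] by auto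

text \<open>
  If the order of \<open>b\<close> did not divide the order of an element \<open>a\<close> of maximal order, some prime would
  occur to a higher power in \<open>ord b\<close>. Exchanging the corresponding primary part of \<open>a\<close> for that of \<open>b\<close>
  would give an element of larger order.
\<close>
lemma (in comm_group) exists_ord_eq_exponent:
  assumes fin: "finite (carrier G)"
  obtains a where "a \<in> carrier G" "\<And>x. x \<in> carrier G \<Longrightarrow> ord x dvd ord a"
proof -
  obtain a where a: "a \<in> carrier G" and max: "\<And>x. x \<in> carrier G \<Longrightarrow> ord x \<le> ord a"
    using finite_obtain_max[of "carrier G" ord] fin one_closed by blast
  have "ord b dvd ord a" if b: "b \<in> carrier G" for b
  proof (rule ccontr)
    assume ndvd: "\<not> ord b dvd ord a"
    have pos: "ord a > 0" "ord b > 0" using ord_pos_finite fin a b by auto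
    obtain p where p: "prime p" "multiplicity p (ord a) < multiplicity p (ord b)"
      using ndvd pos multiplicity_le_imp_dvd[of "ord b" "ord a"]
      by (metis not_le_imp_less neq0_conv)
    define i where "i = multiplicity p (ord a)"
    define j where "j = multiplicity p (ord b)"
    define d where "d = ord a div p ^ i"
    have ipow: "p ^ i dvd ord a" by (simp add: i_def multiplicity_dvd)
    have jpow: "p ^ j dvd ord b" by (simp add: j_def multiplicity_dvd)
    have p0: "p > 0" using p prime_gt_0_nat by blast
    have "\<not> p dvd d"
      unfolding d_def i_def using pos p
      by (metis multiplicity_decompose not_prime_unit less_irrefl)
    hence "coprime p d" using p by (simp add: prime_imp_coprime)
    hence co: "coprime d (p ^ j)" by (simp add: coprime_commute)
    have o1: "ord (a [^] (p ^ i)) = d"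
      unfolding d_def by (rule ord_pow[OF a ipow]) (use p0 in auto)
    obtain e where e: "ord b = p ^ j * e" using jpow by auto
    have e0: "e \<noteq> 0" using e pos by auto
    have "e dvd ord b" using e by auto
    hence o2: "ord (b [^] e) = p ^ j"
      using ord_pow[OF b, of e] e0 e by simp
    have "ord (a [^] (p ^ i) \<otimes> b [^] e) = d * p ^ j"
      using ord_mult_coprime[of "a [^] (p ^ i)" "b [^] e"] a b o1 o2 co by simp
    hence "d * p ^ j \<le> ord a"
      using max[of "a [^] (p ^ i) \<otimes> b [^] e"] a b by simp
    moreover have "ord a = d * p ^ i" using ipow by (simp add: d_def)
    moreover have "p ^ i < p ^ j" using p prime_gt_1_nat by (simp add: i_def j_def)
    moreover have "d > 0" using \<open>ord a = d * p ^ i\<close> pos by (cases d) auto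
    ultimately show False by simp
  qed
  thus ?thesis using a that by blast
qed

text \<open>
  A subgroup \<open>H\<close> that is maximal among those meeting \<open>A = generate G {a}\<close> trivially is a complement.
  Let \<open>x\<close> lie outside \<open>A <#> H\<close> and have order \<open>r\<close> modulo it. Since the order of \<open>a\<close> is the
  exponent, the component of \<open>x [^] r\<close> in \<open>A\<close> is an \<open>r\<close>-th power; dividing it out moves \<open>x [^] r\<close> into
  \<open>H\<close>, and then \<open>x\<close> can be adjoined to \<open>H\<close> without creating an intersection with \<open>A\<close>.
\<close>
lemma (in comm_group) exists_complement_of_max_ord:
  assumes fin: "finite (carrier G)" and a: "a \<in> carrier G"
    and max: "\<And>x. x \<in> carrier G \<Longrightarrow> ord x dvd ord a"
  obtains H where "subgroup H G" "generate G {a} \<inter> H = {\<one>}" "generate G {a} <#> H = carrier G"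
proof -
  define A where "A = generate G {a}"
  have sA: "subgroup A G" unfolding A_def using a by (simp add: generate_is_subgroup)
  have Aelt: "x \<in> A \<longleftrightarrow> (\<exists>i::int. x = a [^] i)" for x
    unfolding A_def using generate_pow[OF a] by auto
  define Hs where "Hs = {H. subgroup H G \<and> A \<inter> H = {\<one>}}"
  have "finite Hs"
    by (rule finite_subset[of _ "Pow (carrier G)"]) (use fin in \<open>auto simp: Hs_def dest: subgroup.subset\<close>)
  moreover have "{\<one>} \<in> Hs"
    using sA subgroup.one_closed[OF sA] by (auto simp: Hs_def triv_subgroup)
  ultimately obtain H where H: "H \<in> Hs" and Hmax: "\<And>K. K \<in> Hs \<Longrightarrow> card K \<le> card H"
    using finite_obtain_max[of Hs card] by blast
  have sH: "subgroup H G" and HA: "A \<inter> H = {\<one>}" using H by (auto simp: Hs_def)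
  have sAH: "subgroup (A <#> H) G" by (rule mult_subgroups[OF sA sH])
  have AsubAH: "A \<subseteq> A <#> H" "H \<subseteq> A <#> H"
    using subgroup.one_closed[OF sA] subgroup.one_closed[OF sH] subgroup.mem_carrier[OF sA]
      subgroup.mem_carrier[OF sH]
    unfolding set_mult_def by (force, force)
  have "carrier G \<subseteq> A <#> H"
  proof (rule ccontr)
    assume "\<not> carrier G \<subseteq> A <#> H"
    then obtain x where x: "x \<in> carrier G" "x \<notin> A <#> H" by auto
    \<comment> \<open>\<open>r\<close> is the order of \<open>x\<close> modulo \<open>A <#> H\<close>\<close>
    define r where "r = (LEAST r::nat. r > 0 \<and> x [^] r \<in> A <#> H)"
    have "\<exists>r::nat. r > 0 \<and> x [^] r \<in> A <#> H"
      using x ord_pos_finite[OF fin] subgroup.one_closed[OF sAH] by (intro exI[of _ "ord x"]) auto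
    hence r: "r > 0" "x [^] r \<in> A <#> H" and rmin: "\<And>k. k > 0 \<Longrightarrow> x [^] k \<in> A <#> H \<Longrightarrow> r \<le> k"
      unfolding r_def by (metis (mono_tags, lifting) LeastI_ex, metis (mono_tags, lifting) LeastI_ex,
          metis (mono_tags, lifting) Least_le)
    have rdvd: "r dvd k" if "x [^] k \<in> A <#> H" for k
    proof (rule ccontr)
      assume "\<not> r dvd k"
      hence k: "k mod r > 0" by (simp add: mod_greater_zero_iff_not_dvd)
      have "x [^] k = x [^] (k mod r) \<otimes> (x [^] r) [^] (k div r)"
        using x by (simp add: nat_pow_pow nat_pow_mult)
      hence "x [^] (k mod r) = x [^] k \<otimes> inv ((x [^] r) [^] (k div r))"
        using x by (simp add: m_assoc)
      moreover have "(x [^] r) [^] (k div r) \<in> A <#> H"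
        using r sAH by (simp add: subgroup_nat_pow_closed)
      ultimately have "x [^] (k mod r) \<in> A <#> H"
        using that sAH by (simp add: subgroup.m_closed subgroup.m_inv_closed)
      from rmin[OF k this] mod_less_divisor[OF r(1), of k] show False
        by simp
    qed
    have rd: "r dvd ord a"
    proof (rule rdvd)
      have "x [^] ord a = \<one>" using max[OF x(1)] x by (simp add: pow_eq_id)
      thus "x [^] ord a \<in> A <#> H" using subgroup.one_closed[OF sAH] by simp
    qed
    from r(2) obtain i :: int and h where h: "h \<in> H" "x [^] r = a [^] i \<otimes> h"
      unfolding set_mult_def using Aelt by auto
    have hc: "h \<in> carrier G" using h subgroup.mem_carrier[OF sH] by auto
    define q where "q = ord a div r"
    have q: "ord a = r * q" using rd by (simp add: q_def)
    have q0: "q > 0" using q ord_pos_finite[OF fin a] by (cases q) auto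
    have "int r dvd i"
    proof -
      have "(a [^] i) [^] q \<otimes> h [^] q = \<one>"
      proof -
        have "(x [^] r) [^] q = \<one>"
          using x q max[OF x(1)] by (simp add: nat_pow_pow pow_eq_id)
        thus ?thesis using h(2) a hc by (simp add: nat_pow_distrib)
      qed
      hence "(a [^] i) [^] q = inv (h [^] q)"
        using a hc by (simp add: inv_equality[symmetric])
      moreover have "inv (h [^] q) \<in> H"
        using h sH by (simp add: subgroup.m_inv_closed subgroup_nat_pow_closed)
      moreover have aq: "(a [^] i) [^] q = a [^] (i * int q)"
        using a by (simp add: int_pow_pow flip: int_pow_int)
      hence "(a [^] i) [^] q \<in> A" using Aelt by auto
      ultimately have "(a [^] i) [^] q \<in> A \<inter> H" by simp
      hence "(a [^] i) [^] q = \<one>" using HA by simp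
      hence "int (ord a) dvd i * int q"
        using aq a by (simp add: int_pow_eq_id)
      thus ?thesis using q q0 by (simp add: mult.commute)
    qed
    then obtain l where l: "i = int r * l" by blast
    define y where "y = x \<otimes> inv (a [^] l)"
    have yc: "y \<in> carrier G" using x a by (simp add: y_def)
    have xy: "x = y \<otimes> a [^] l" using x a by (simp add: y_def m_assoc)
    have yr: "y [^] r = h"
    proof -
      have "y [^] r \<otimes> a [^] i = x [^] r"
        using yc a xy l by (simp add: int_pow_distrib int_pow_pow mult.commute flip: int_pow_int)
      also have "\<dots> = h \<otimes> a [^] i" using h a hc by (simp add: m_comm)
      finally show ?thesis using yc a hc by simp
    qed
    have yAH: "r dvd k" if "y [^] k \<in> A <#> H" for k
    proof (rule rdvd)
      have "x [^] k = y [^] k \<otimes> a [^] (l * int k)"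
        using yc a xy by (simp add: int_pow_distrib int_pow_pow flip: int_pow_int)
      moreover have "a [^] (l * int k) \<in> A <#> H" using Aelt AsubAH by auto
      ultimately show "x [^] k \<in> A <#> H" using that sAH by (simp add: subgroup.m_closed)
    qed
    define K where "K = H <#> generate G {y}"
    have sY: "subgroup (generate G {y}) G" using yc by (simp add: generate_is_subgroup)
    have sK: "subgroup K G" unfolding K_def by (rule mult_subgroups[OF sH sY])
    have Kelt: "\<exists>h'\<in>H. \<exists>k::nat. z = h' \<otimes> y [^] k" if "z \<in> K" for z
    proof -
      from that obtain h' w where "h' \<in> H" "w \<in> generate G {y}" "z = h' \<otimes> w"
        unfolding K_def set_mult_def by auto
      moreover from this obtain k :: nat where "w = y [^] k"
        using generate_pow_on_finite_carrier[OF fin yc] by auto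
      ultimately show ?thesis by auto
    qed
    have "A \<inter> K \<subseteq> {\<one>}"
    proof
      fix z assume z: "z \<in> A \<inter> K"
      then obtain h' and k :: nat where hk: "h' \<in> H" "z = h' \<otimes> y [^] k" using Kelt[of z] by blast
      have hc': "h' \<in> carrier G" using hk subgroup.mem_carrier[OF sH] by auto
      have "y [^] k = inv h' \<otimes> z" using hk hc' yc by (simp add: m_assoc[symmetric])
      moreover have "inv h' \<in> A <#> H" "z \<in> A <#> H"
        using z AsubAH hk sH by (auto simp: subgroup.m_inv_closed)
      ultimately have "y [^] k \<in> A <#> H" using sAH by (simp add: subgroup.m_closed)
      from yAH[OF this] obtain m where "k = r * m" by blast
      hence "y [^] k = h [^] m" using yr yc by (simp flip: nat_pow_pow)
      hence "z \<in> H" using hk h sH by (simp add: subgroup.m_closed subgroup_nat_pow_closed)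
      thus "z \<in> {\<one>}" using z HA by blast
    qed
    hence "K \<in> Hs" using sK subgroup.one_closed[OF sK] subgroup.one_closed[OF sA] by (auto simp: Hs_def)
    moreover have "H \<subset> K"
    proof -
      have "H \<subseteq> K" unfolding K_def set_mult_def
        using subgroup.one_closed[OF sY] subgroup.mem_carrier[OF sH] by force
      moreover have "y \<in> K" unfolding K_def set_mult_def
        using subgroup.one_closed[OF sH] yc generate.incl[of y "{y}" G] by force
      moreover have "y \<notin> H"
      proof
        assume "y \<in> H"
        hence "y \<in> A <#> H" "a [^] l \<in> A <#> H" using AsubAH Aelt by auto
        hence "x \<in> A <#> H" using xy sAH by (simp add: subgroup.m_closed)
        thus False using x by simp
      qed
      ultimately show ?thesis by blast
    qed
    moreover have "finite K" using sK fin by (meson finite_subset subgroup.subset)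
    ultimately show False using Hmax psubset_card_mono by (metis leD)
  qed
  moreover have "A <#> H \<subseteq> carrier G" using sAH subgroup.subset by blast
  ultimately show ?thesis using that[OF sH] HA by (simp add: A_def)
qed

section \<open>Invariant factors of finite abelian groups\<close>

text \<open>
  These numbers are isomorphism invariants, and for products of cyclic groups along a divisor chain
  they determine the chain.
\<close>
definition torsion_count :: "('a, 'b) monoid_scheme \<Rightarrow> nat \<Rightarrow> nat" where
  "torsion_count G m = card {x \<in> carrier G. x [^]\<^bsub>G\<^esub> m = \<one>\<^bsub>G\<^esub>}"

lemma torsion_count_iso:
  assumes G: "group G" and H: "group H" and "G \<cong> H"
  shows "torsion_count G m = torsion_count H m"
proof -
  from assms obtain f where f: "f \<in> iso G H" by (auto simp: is_iso_def)
  interpret group_hom G H f using G H f by (simp add: group_hom_def group_hom_axioms_def iso_imp_homomorphism)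
  have bij: "bij_betw f (carrier G) (carrier H)" using f by (simp add: iso_def)
  have eq: "x [^]\<^bsub>G\<^esub> m = \<one>\<^bsub>G\<^esub> \<longleftrightarrow> f x [^]\<^bsub>H\<^esub> m = \<one>\<^bsub>H\<^esub>" if "x \<in> carrier G" for x
  proof -
    have "f x [^]\<^bsub>H\<^esub> m = f (x [^]\<^bsub>G\<^esub> m)" using that by (simp add: hom_nat_pow)
    moreover have "f (x [^]\<^bsub>G\<^esub> m) = f \<one>\<^bsub>G\<^esub> \<longleftrightarrow> x [^]\<^bsub>G\<^esub> m = \<one>\<^bsub>G\<^esub>"
      using bij that by (auto simp: bij_betw_def inj_on_def)
    ultimately show ?thesis by simp
  qed
  have "bij_betw f {x \<in> carrier G. x [^]\<^bsub>G\<^esub> m = \<one>\<^bsub>G\<^esub>} {y \<in> carrier H. y [^]\<^bsub>H\<^esub> m = \<one>\<^bsub>H\<^esub>}"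
  proof (rule bij_betw_subset[OF bij])
    show "f ` {x \<in> carrier G. x [^]\<^bsub>G\<^esub> m = \<one>\<^bsub>G\<^esub>} = {y \<in> carrier H. y [^]\<^bsub>H\<^esub> m = \<one>\<^bsub>H\<^esub>}"
    proof (intro equalityI subsetI)
      fix y assume y: "y \<in> {y \<in> carrier H. y [^]\<^bsub>H\<^esub> m = \<one>\<^bsub>H\<^esub>}"
      then obtain x where "x \<in> carrier G" "y = f x" using bij by (auto simp: bij_betw_def)
      thus "y \<in> f ` {x \<in> carrier G. x [^]\<^bsub>G\<^esub> m = \<one>\<^bsub>G\<^esub>}" using y eq by auto
    qed (use bij eq in \<open>auto simp: bij_betw_def\<close>)
  qed auto
  thus ?thesis unfolding torsion_count_def by (rule bij_betw_same_card)
qed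

lemma DirProd_nat_pow: "(x, y) [^]\<^bsub>G \<times>\<times> H\<^esub> (m::nat) = (x [^]\<^bsub>G\<^esub> m, y [^]\<^bsub>H\<^esub> m)"
  by (induction m) auto

lemma torsion_count_DirProd: "torsion_count (G \<times>\<times> H) m = torsion_count G m * torsion_count H m"
proof -
  have "{x \<in> carrier (G \<times>\<times> H). x [^]\<^bsub>G \<times>\<times> H\<^esub> m = \<one>\<^bsub>G \<times>\<times> H\<^esub>} =
        {x \<in> carrier G. x [^]\<^bsub>G\<^esub> m = \<one>\<^bsub>G\<^esub>} \<times> {x \<in> carrier H. x [^]\<^bsub>H\<^esub> m = \<one>\<^bsub>H\<^esub>}"
    by (auto simp: DirProd_nat_pow)
  thus ?thesis by (simp add: torsion_count_def card_cartesian_product)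
qed

lemma torsion_count_integer_mod_group:
  assumes "d > 0"
  shows "torsion_count (integer_mod_group d) m = gcd m d"
proof -
  define g where "g = gcd m d"
  have "g dvd d" "g dvd m" by (simp_all add: g_def)
  then obtain e k where e: "d = g * e" and k: "m = g * k" by (auto elim!: dvdE)
  have g0: "g > 0" and e0: "e > 0" using assms e by simp_all
  have "gcd (g * k) (g * e) = g" unfolding k[symmetric] e[symmetric] by (simp add: g_def)
  hence "g * gcd k e = g * 1" by (simp flip: gcd_mult_distrib_nat)
  hence co: "coprime k e" using g0 by (simp add: coprime_iff_gcd_eq_1)
  have "(int m * x) mod int d = 0 \<longleftrightarrow> int e dvd x" for x
  proof -
    have "int d dvd int m * x \<longleftrightarrow> int g * int e dvd int g * (int k * x)"
      by (simp add: e k mult_ac)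
    also have "\<dots> \<longleftrightarrow> int e dvd int k * x" using g0 by simp
    also have "\<dots> \<longleftrightarrow> int e dvd x"
      using co by (simp add: coprime_dvd_mult_right_iff coprime_commute)
    finally show ?thesis by (simp add: dvd_eq_mod_eq_0)
  qed
  hence "{x \<in> carrier (integer_mod_group d). x [^]\<^bsub>integer_mod_group d\<^esub> m = \<one>\<^bsub>integer_mod_group d\<^esub>}
      = {x \<in> {0..<int d}. int e dvd x}"
    using assms by (auto simp: carrier_integer_mod_group)
  also have "\<dots> = (\<lambda>j. int e * int j) ` {0..<g}"
  proof safe
    fix x assume x: "x \<in> {0..<int d}" "int e dvd x"
    then obtain j where j: "x = int e * j" by blast
    have "0 \<le> j" using x e0 j by (auto simp: zero_le_mult_iff)
    moreover have "j < int g" using x e0 j e by (simp add: mult.commute)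
    ultimately show "x \<in> (\<lambda>j. int e * int j) ` {0..<g}"
      by (intro image_eqI[of _ _ "nat j"]) (auto simp: j)
  qed (use e e0 in \<open>auto simp: mult.commute simp flip: of_nat_mult\<close>)
  also have "card \<dots> = g"
    using e0 by (subst card_image) (auto simp: inj_on_def)
  finally show ?thesis by (simp add: torsion_count_def g_def)
qed

text \<open>
  Lists instead of nested pairs give the products of any number of factors one common type.
\<close>
fun cyclic_product :: "nat list \<Rightarrow> int list monoid" where
  "cyclic_product [] = singleton_group []"
| "cyclic_product (d # ds) =
     \<lparr>carrier = (\<lambda>(x, xs). x # xs) ` (carrier (integer_mod_group d) \<times> carrier (cyclic_product ds)),
      mult = (\<lambda>u v. (hd u \<otimes>\<^bsub>integer_mod_group d\<^esub> hd v) # (tl u \<otimes>\<^bsub>cyclic_product ds\<^esub> tl v)),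
      one = \<one>\<^bsub>integer_mod_group d\<^esub> # \<one>\<^bsub>cyclic_product ds\<^esub>\<rparr>"

lemma comm_group_cyclic_product: "comm_group (cyclic_product ds)"
proof (induction ds)
  case Nil
  show ?case by (auto simp: singleton_group_def intro!: comm_groupI)
next
  case (Cons d ds)
  interpret A: comm_group "cyclic_product ds" by fact
  interpret B: comm_group "integer_mod_group d" by simp
  show ?case
  proof (rule comm_groupI)
    fix u assume "u \<in> carrier (cyclic_product (d # ds))"
    then obtain x xs where "u = x # xs" "x \<in> carrier (integer_mod_group d)" "xs \<in> carrier (cyclic_product ds)"
      by auto
    thus "\<exists>v\<in>carrier (cyclic_product (d # ds)). v \<otimes>\<^bsub>cyclic_product (d # ds)\<^esub> u = \<one>\<^bsub>cyclic_product (d # ds)\<^esub>"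
      using B.l_inv[of x] B.inv_closed[of x] A.l_inv[of xs] A.inv_closed[of xs]
      by (intro bexI[of _ "inv\<^bsub>integer_mod_group d\<^esub> x # inv\<^bsub>cyclic_product ds\<^esub> xs"])
         (force simp del: inv_integer_mod_group mult_integer_mod_group one_integer_mod_group)+
  qed (auto simp del: mult_integer_mod_group one_integer_mod_group simp: A.m_ac B.m_ac)
qed

lemma cyclic_product_Cons_iso:
  "integer_mod_group d \<times>\<times> cyclic_product ds \<cong> cyclic_product (d # ds)"
proof (rule is_isoI)
  show "(\<lambda>(x, xs). x # xs) \<in> iso (integer_mod_group d \<times>\<times> cyclic_product ds) (cyclic_product (d # ds))"
    by (auto simp: iso_def hom_def bij_betw_def inj_on_def simp del: mult_integer_mod_group)
qed

lemma group_cyclic_product: "group (cyclic_product ds)"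
  using comm_group_cyclic_product comm_group.axioms(2) by blast

lemma torsion_count_cyclic_product:
  assumes "\<forall>d\<in>set ds. d > 0"
  shows "torsion_count (cyclic_product ds) m = prod_list (map (gcd m) ds)"
  using assms
proof (induction ds)
  case Nil
  have "{x. x = [] \<and> x [^]\<^bsub>singleton_group []\<^esub> m = ([]::int list)} = {[]}"
    by (induction m) (auto simp: singleton_group_def)
  thus ?case by (simp add: torsion_count_def singleton_group_def)
next
  case (Cons d ds)
  have "torsion_count (cyclic_product (d # ds)) m = torsion_count (integer_mod_group d \<times>\<times> cyclic_product ds) m"
    by (rule torsion_count_iso[OF _ _ cyclic_product_Cons_iso, symmetric])
       (auto intro: DirProd_group group_cyclic_product simp del: cyclic_product.simps)
  thus ?case using Cons by (simp add: torsion_count_DirProd torsion_count_integer_mod_group)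
qed

lemma torsion_count_0: "torsion_count G 0 = card (carrier G)"
  by (simp add: torsion_count_def)

lemma card_cyclic_product:
  "\<forall>d\<in>set ds. d > 0 \<Longrightarrow> card (carrier (cyclic_product ds)) = prod_list ds"
  using torsion_count_cyclic_product[of ds 0] map_idI[of ds "gcd 0"] unfolding torsion_count_0 by simp

text \<open>
  Every factor \<open>gcd m d\<close> is at most \<open>d\<close>, so equal products force equality in every factor.
\<close>
lemma prod_list_gcd_eq_imp_dvd:
  fixes ds :: "nat list"
  assumes "\<forall>d\<in>set ds. d > 0" "prod_list (map (gcd m) ds) = prod_list ds" "d \<in> set ds"
  shows "d dvd m"
  using assms
proof (induction ds)
  case (Cons e ds)
  have le: "prod_list (map (gcd m) xs) \<le> prod_list xs" if "\<forall>d\<in>set xs. d > 0" for xs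
    using that
  proof (induction xs)
    case (Cons x xs)
    have "gcd m x * prod_list (map (gcd m) xs) \<le> x * prod_list xs"
      by (rule mult_le_mono) (use Cons in \<open>simp_all add: gcd_le2_nat\<close>)
    thus ?case by simp
  qed simp
  have "0 \<notin> set ds" using Cons.prems(1) by auto
  hence "prod_list ds \<noteq> 0" by (simp add: prod_list_zero_iff)
  hence pos: "prod_list ds > 0" "e > 0" using Cons.prems(1) by simp_all
  have eq: "gcd m e * prod_list (map (gcd m) ds) = e * prod_list ds" using Cons.prems by simp
  have l: "gcd m e \<le> e" "prod_list (map (gcd m) ds) \<le> prod_list ds"
    using le[of ds] Cons.prems(1) pos by (simp_all add: gcd_le2_nat)
  have 1: "gcd m e = e"
  proof (rule ccontr)
    assume "gcd m e \<noteq> e"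
    hence "gcd m e < e" using l by simp
    hence "gcd m e * prod_list (map (gcd m) ds) < e * prod_list ds"
      using l pos by (meson le_less_trans mult_le_mono2 mult_less_mono1)
    thus False using eq by simp
  qed
  hence 2: "prod_list (map (gcd m) ds) = prod_list ds" using eq pos by simp
  have "d = e \<or> d \<in> set ds" using Cons.prems(3) by simp
  thus ?case
  proof (elim disjE)
    assume "d \<in> set ds"
    thus ?thesis using Cons.IH[OF _ 2] Cons.prems(1) by simp
  next
    assume "d = e"
    thus ?thesis using 1 gcd_dvd1[of m e] by simp
  qed
qed auto

definition divisor_chain :: "nat list \<Rightarrow> bool" where
  "divisor_chain ds \<longleftrightarrow> sorted_wrt (\<lambda>a b. b dvd a) ds"

definition invariant_factors :: "nat \<Rightarrow> nat list set" where
  "invariant_factors n = {ds. divisor_chain ds \<and> (\<forall>d\<in>set ds. d > 1) \<and> prod_list ds = n}"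

text \<open>
  For \<open>m\<close> the head of one list, all gcds with that list are its entries themselves, so the head of the
  other list divides \<open>m\<close>. By symmetry the heads agree, and cancelling them leaves shorter lists.
\<close>
lemma divisor_chain_eqI:
  assumes "divisor_chain ds" "divisor_chain es" "\<forall>d\<in>set ds. d > 1" "\<forall>d\<in>set es. d > 1"
    and "\<And>m. prod_list (map (gcd m) ds) = prod_list (map (gcd m) es)"
  shows "ds = es"
  using assms
proof (induction ds es rule: list_induct2')
  case (2 d ds)
  from "2.prems"(5)[of 0] have "d * prod_list ds = 1" by simp
  with "2.prems"(3) show ?case by simp
next
  case (3 e es)
  from "3.prems"(5)[of 0] have "1 = e * prod_list es" by simp
  with "3.prems"(4) show ?case by simp
next
  case (4 d ds e es)
  have *: "y dvd x" if "divisor_chain (x # xs)" "\<forall>d\<in>set (x # xs). d > 1" "\<forall>d\<in>set (y # ys). d > 1"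
     "\<And>m. prod_list (map (gcd m) (x # xs)) = prod_list (map (gcd m) (y # ys))" for x y :: nat and xs ys
  proof -
    have "map (gcd x) (x # xs) = x # xs"
      using that(1) by (auto simp: divisor_chain_def gcd_nat.absorb2 intro!: map_idI)
    hence "prod_list (map (gcd x) (y # ys)) = prod_list (map (gcd 0) (x # xs))"
      using that(4)[of x] map_idI[of "x # xs" "gcd 0"] by simp
    also have "\<dots> = prod_list (y # ys)" using that(4)[of 0] map_idI[of "y # ys" "gcd 0"] by simp
    finally show ?thesis
      using prod_list_gcd_eq_imp_dvd[of "y # ys" x y] that(3) by fastforce
  qed
  have "e dvd d" using *[of d ds e es] "4.prems" by blast
  moreover have "d dvd e" using *[of e es d ds] "4.prems" by metis
  ultimately have "d = e" by (simp add: dvd_antisym)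
  moreover have "prod_list (map (gcd m) ds) = prod_list (map (gcd m) es)" for m
    using "4.prems"(3) "4.prems"(5)[of m] \<open>d = e\<close> by simp
  ultimately show ?case using 4 by (auto simp: divisor_chain_def)
qed auto

lemma (in group) generate_iso_integer_mod_group:
  assumes fin: "finite (carrier G)" and a: "a \<in> carrier G"
  shows "integer_mod_group (ord a) \<cong> subgroup_generated G {a}"
proof (rule is_isoI)
  define d where "d = ord a"
  have d: "d > 0" using ord_pos_finite[OF fin a] by (simp add: d_def)
  have car: "carrier (subgroup_generated G {a}) = range (\<lambda>n::int. a [^] n)"
    using carrier_subgroup_generated_by_singleton[OF a] .
  have eq: "a [^] (x mod int d) = a [^] x" for x :: int
    using a by (simp add: int_pow_eq d_def minus_mod_eq_mult_div)
  show "(\<lambda>n::int. a [^] n) \<in> iso (integer_mod_group (ord a)) (subgroup_generated G {a})"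
    unfolding iso_def hom_def bij_betw_def
  proof (intro CollectI conjI ballI)
    show "([^]) a \<in> carrier (integer_mod_group (ord a)) \<rightarrow> carrier (subgroup_generated G {a})"
      using car by auto
    show "a [^] (x \<otimes>\<^bsub>integer_mod_group (ord a)\<^esub> y) = a [^] x \<otimes>\<^bsub>subgroup_generated G {a}\<^esub> a [^] y" for x y
      using a eq by (simp add: d_def int_pow_mult)
    show "inj_on (([^]) a) (carrier (integer_mod_group (ord a)))"
    proof (rule inj_onI)
      fix x y assume xy: "x \<in> carrier (integer_mod_group (ord a))" "y \<in> carrier (integer_mod_group (ord a))" "a [^] x = a [^] y"
      hence "int d dvd (y - x)" using a by (simp add: int_pow_eq d_def)
      thus "x = y" using xy(1,2) d
        by (metis atLeastLessThan_iff carrier_integer_mod_group d_def less_not_refl mod_eq_dvd_iff mod_pos_pos_trivial)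
    qed
    show "([^]) a ` carrier (integer_mod_group (ord a)) = carrier (subgroup_generated G {a})"
    proof -
      have "a [^] x \<in> ([^]) a ` {0..<int d}" for x :: int
        using eq[of x] d by (intro image_eqI[of _ _ "x mod int d"]) auto
      thus ?thesis using car d by (auto simp: carrier_integer_mod_group d_def)
    qed
  qed
qed

text \<open>
  An element whose order is the exponent generates a direct factor, and induction applies to a
  complement. The orders of the cyclic factors of the complement divide the exponent, which makes the
  list of orders a divisor chain.
\<close>
theorem comm_group_iso_cyclic_product:
  fixes G :: "'a monoid"
  assumes "comm_group G" "finite (carrier G)"
  shows "\<exists>ds. divisor_chain ds \<and> (\<forall>d\<in>set ds. d > 1) \<and> G \<cong> cyclic_product ds"
  using assms
proof (induction "card (carrier G)" arbitrary: G rule: less_induct)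
  case less
  interpret comm_group G by fact
  note fin = less.prems(2)
  obtain a where a: "a \<in> carrier G" and max: "\<And>x. x \<in> carrier G \<Longrightarrow> ord x dvd ord a"
    using exists_ord_eq_exponent[OF fin] by blast
  define d where "d = ord a"
  show ?case
  proof (cases "d = 1")
    case True
    have "x = \<one>\<^bsub>G\<^esub>" if "x \<in> carrier G" for x
      using max[OF that] True ord_eq_1[OF that] by (simp add: d_def)
    hence "carrier G = {\<one>\<^bsub>G\<^esub>}" by auto
    hence "(\<lambda>x. []) \<in> iso G (cyclic_product [])"
      by (auto simp: iso_def hom_def bij_betw_def singleton_group_def)
    hence "G \<cong> cyclic_product []" by (rule is_isoI)
    thus ?thesis by (intro exI[of _ "[]"]) (auto simp: divisor_chain_def)
  next
    case False
    hence d: "d > 1" using ord_pos_finite[OF fin a] by (simp add: d_def)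
    obtain H where H: "subgroup H G" "generate G {a} \<inter> H = {\<one>\<^bsub>G\<^esub>}" "generate G {a} <#>\<^bsub>G\<^esub> H = carrier G"
      using exists_complement_of_max_ord[OF fin a max] by blast
    define A where "A = generate G {a}"
    have sA: "subgroup A G" unfolding A_def using a by (simp add: generate_is_subgroup)
    define GA where "GA = subgroup_generated G A"
    define GH where "GH = subgroup_generated G H"
    have GA: "GA = subgroup_generated G {a}"
    proof -
      have "generate G (carrier G \<inter> A) = A"
        using subgroup.carrier_subgroup_generated_subgroup[OF sA] by (simp add: subgroup_generated_def)
      thus ?thesis using a by (simp add: GA_def subgroup_generated_def A_def)
    qed
    have cGH: "carrier GH = H" unfolding GH_def using H(1) subgroup.carrier_subgroup_generated_subgroup by blast
    interpret D: group_disjoint_sum G A H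
      by (simp add: group_disjoint_sum_def sA H(1) is_group)
    have grp: "comm_group GH" "group GA"
      unfolding GH_def GA_def by (simp_all add: abelian_subgroup_generated group_subgroup_generated comm_group_axioms)
    have "GA \<times>\<times> GH \<cong> G"
      using D.iso_group_mul[OF comm_group_axioms] H(2,3)
      by (auto simp: GA_def GH_def A_def intro: is_isoI)
    moreover have Zd: "integer_mod_group d \<cong> GA"
      unfolding GA d_def by (rule generate_iso_integer_mod_group[OF fin a])
    ultimately have isoG: "integer_mod_group d \<times>\<times> GH \<cong> G"
      by (meson group.DirProd_iso_trans group_integer_mod_group iso_refl iso_trans)
    have finH: "finite (carrier GH)" using cGH H(1) fin by (metis finite_subset subgroup.subset)
    have "card (carrier G) = d * card (carrier GH)"
      using iso_same_card[OF isoG] d by (simp add: card_cartesian_product carrier_integer_mod_group)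
    moreover have "card (carrier GH) > 0"
      using finH cGH subgroup.one_closed[OF H(1)] unfolding card_gt_0_iff by blast
    ultimately have "card (carrier GH) < card (carrier G)" using d by simp
    from less.hyps[OF this grp(1) finH] obtain ds where
      ds: "divisor_chain ds" "\<forall>d\<in>set ds. d > 1" "GH \<cong> cyclic_product ds" by blast
    have "torsion_count GH d = card (carrier GH)"
    proof -
      have "x [^]\<^bsub>GH\<^esub> d = \<one>\<^bsub>GH\<^esub>" if "x \<in> carrier GH" for x
      proof -
        have "x \<in> carrier G" using that cGH subgroup.mem_carrier[OF H(1)] by auto
        hence "x [^]\<^bsub>G\<^esub> d = \<one>\<^bsub>G\<^esub>" using max by (simp add: pow_eq_id d_def)
        thus ?thesis by (simp add: GH_def subgroup_generated_def flip: nat_pow_consistent)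
      qed
      thus ?thesis unfolding torsion_count_def by (metis (mono_tags, lifting) Collect_cong Collect_mem_eq)
    qed
    moreover have "group GH" using grp(1) comm_group.axioms(2) by blast
    moreover note group_cyclic_product ds(3)
    ultimately have "prod_list (map (gcd d) ds) = prod_list ds"
      using torsion_count_iso[of GH "cyclic_product ds"] torsion_count_cyclic_product[of ds] ds(2)
        card_cyclic_product[of ds] iso_same_card[of GH "cyclic_product ds"]
      by (metis bot_nat_0.not_eq_extremum not_one_less_zero)
    hence "e dvd d" if "e \<in> set ds" for e
      using prod_list_gcd_eq_imp_dvd[of ds d e] ds(2) that by fastforce
    hence "divisor_chain (d # ds)" using ds by (simp add: divisor_chain_def)
    moreover have "G \<cong> cyclic_product (d # ds)"
    proof -
      have "G \<cong> integer_mod_group d \<times>\<times> GH"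
        by (rule group.iso_sym[OF _ isoG]) (simp add: DirProd_group \<open>group GH\<close>)
      also have "\<dots> \<cong> integer_mod_group d \<times>\<times> cyclic_product ds"
        by (rule group.DirProd_iso_trans) (use ds in simp_all)
      also have "\<dots> \<cong> cyclic_product (d # ds)" by (rule cyclic_product_Cons_iso)
      finally show ?thesis .
    qed
    ultimately show ?thesis using ds d by (intro exI[of _ "d # ds"]) simp
  qed
qed

text \<open>Transports a group to the type on which the isomorphism classes are counted.\<close>
lemma exists_nat_monoid_iso:
  fixes H :: "'a :: countable monoid"
  assumes "comm_group H"
  shows "\<exists>G :: nat monoid. comm_group G \<and> H \<cong> G"
proof -
  interpret comm_group H by fact
  define G :: "nat monoid" where
    "G = \<lparr>carrier = to_nat ` carrier H, mult = (\<lambda>u v. to_nat (from_nat u \<otimes>\<^bsub>H\<^esub> from_nat v)), one = to_nat \<one>\<^bsub>H\<^esub>\<rparr>"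
  have "comm_group G"
    by (rule comm_groupI) (auto simp: G_def m_ac intro: l_inv_ex)
  moreover have "to_nat \<in> iso H G"
    by (auto simp: iso_def hom_def bij_betw_def G_def inj_on_def)
  ultimately show ?thesis using is_isoI by blast
qed

text \<open>
  Every isomorphism class contains the cyclic product of exactly one divisor chain: one at least by the
  structure theorem, one at most because the torsion counts determine the chain.
\<close>
theorem num_abelian_groups_eq_card_invariant_factors:
  assumes "n > 0"
  shows "num_abelian_groups n = card (invariant_factors n)"
proof -
  define A where "A = abelian_groups_of_order n"
  define R where "R = {(G, H). G \<in> A \<and> H \<in> A \<and> G \<cong> H}"
  have A: "comm_group G" "group G" "card (carrier G) = n" "finite (carrier G)" if "G \<in> A" for G
    using that assms comm_group.axioms(2)[of G] by (auto simp: A_def abelian_groups_of_order_def intro: card_ge_0_finite)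
  have eqR: "equiv A R"
    by (rule equivI) (auto simp: R_def refl_on_def sym_def trans_def intro: iso_trans group.iso_sym A)
  define N where "N ds = (SOME G :: nat monoid. comm_group G \<and> cyclic_product ds \<cong> G)" for ds
  have N: "comm_group (N ds)" "cyclic_product ds \<cong> N ds" for ds
    using someI_ex[OF exists_nat_monoid_iso[OF comm_group_cyclic_product[of ds]]] by (auto simp: N_def)
  have NA: "N ds \<in> A" if "ds \<in> invariant_factors n" for ds
  proof -
    have "\<forall>d\<in>set ds. d > 0" using that by (fastforce simp: invariant_factors_def)
    hence "card (carrier (N ds)) = n"
      using iso_same_card[OF N(2)[of ds]] card_cyclic_product[of ds] that by (simp add: invariant_factors_def)
    thus ?thesis using N(1) by (simp add: A_def abelian_groups_of_order_def)
  qed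
  have "bij_betw (\<lambda>ds. R `` {N ds}) (invariant_factors n) (A // R)"
    unfolding bij_betw_def
  proof
    show "inj_on (\<lambda>ds. R `` {N ds}) (invariant_factors n)"
    proof (rule inj_onI)
      fix ds es assume *: "ds \<in> invariant_factors n" "es \<in> invariant_factors n" "R `` {N ds} = R `` {N es}"
      hence "(N ds, N es) \<in> R" using eq_equiv_class[OF *(3) eqR NA[OF *(2)]] by simp
      hence "N ds \<cong> N es" by (simp add: R_def)
      hence "cyclic_product ds \<cong> N es" using N(2)[of ds] iso_trans by blast
      moreover have "N es \<cong> cyclic_product es" by (rule group.iso_sym[OF group_cyclic_product N(2)])
      ultimately have "cyclic_product ds \<cong> cyclic_product es" using iso_trans by blast
      hence "torsion_count (cyclic_product ds) m = torsion_count (cyclic_product es) m" for m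
        by (intro torsion_count_iso group_cyclic_product)
      moreover have "\<forall>d\<in>set ds. d > 0" "\<forall>d\<in>set es. d > 0" using * by (fastforce simp: invariant_factors_def)+
      ultimately have "prod_list (map (gcd m) ds) = prod_list (map (gcd m) es)" for m
        by (simp add: torsion_count_cyclic_product)
      thus "ds = es" using * by (intro divisor_chain_eqI) (auto simp: invariant_factors_def)
    qed
    show "(\<lambda>ds. R `` {N ds}) ` invariant_factors n = A // R"
    proof (intro equalityI subsetI)
      fix X assume "X \<in> A // R"
      then obtain G where G: "G \<in> A" "X = R `` {G}" by (auto elim: quotientE)
      obtain ds where ds: "divisor_chain ds" "\<forall>d\<in>set ds. d > 1" "G \<cong> cyclic_product ds"
        using comm_group_iso_cyclic_product[OF A(1,4)[OF G(1)]] by blast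
      have "\<forall>d\<in>set ds. d > 0" using ds by fastforce
      hence "prod_list ds = n" using iso_same_card[OF ds(3)] A(3)[OF G(1)] card_cyclic_product[of ds] by simp
      hence inv: "ds \<in> invariant_factors n" using ds by (simp add: invariant_factors_def)
      moreover have "G \<cong> N ds" using ds(3) N(2)[of ds] iso_trans by blast
      hence "(G, N ds) \<in> R" using G(1) NA[OF inv] by (simp add: R_def)
      hence "X = R `` {N ds}" using equiv_class_eq[OF eqR] G(2) by simp
      ultimately show "X \<in> (\<lambda>ds. R `` {N ds}) ` invariant_factors n" by blast
    qed (use NA in \<open>auto intro: quotientI\<close>)
  qed
  hence "card (A // R) = card (invariant_factors n)" using bij_betw_same_card by force
  thus ?thesis by (simp add: num_abelian_groups_def A_def R_def)
qed

section \<open>Mellin integrals on the positive half-line\<close>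

lemma nn_integral_powr_exp:
  fixes z c :: real
  assumes z: "z > 0" and c: "c > 0"
  shows "(\<integral>\<^sup>+t\<in>{0<..}. ennreal (t powr (z - 1) * exp (- (c * t))) \<partial>lborel) = ennreal (Gamma z * c powr - z)"
proof -
  have "ennreal (Gamma z) = (\<integral>\<^sup>+t. ennreal (indicator {0..} t * t powr (z - 1) / exp t) \<partial>lborel)"
    by (rule Gamma_conv_nn_integral_real[OF z])
  also have "\<dots> = ennreal c * (\<integral>\<^sup>+t. ennreal (indicator {0..} (c * t) * (c * t) powr (z - 1) / exp (c * t)) \<partial>lborel)"
    using nn_integral_real_affine[where c = c and t = 0 and f = "\<lambda>t. ennreal (indicator {0..} t * t powr (z - 1) / exp t)"] c
    by simp
  also have "(\<integral>\<^sup>+t. ennreal (indicator {0..} (c * t) * (c * t) powr (z - 1) / exp (c * t)) \<partial>lborel)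
      = (\<integral>\<^sup>+t. ennreal (c powr (z - 1)) * (ennreal (t powr (z - 1) * exp (- (c * t))) * indicator {0<..} t) \<partial>lborel)"
    using c by (intro nn_integral_cong)
      (auto simp: indicator_def powr_mult exp_minus field_simps zero_le_mult_iff zero_less_mult_iff simp flip: ennreal_mult')
  also have "\<dots> = ennreal (c powr (z - 1)) * (\<integral>\<^sup>+t\<in>{0<..}. ennreal (t powr (z - 1) * exp (- (c * t))) \<partial>lborel)"
    by (rule nn_integral_cmult) auto
  finally have "ennreal (c powr - z) * ennreal (Gamma z) = ennreal (c powr - z) * (ennreal c * (ennreal (c powr (z - 1)) *
     (\<integral>\<^sup>+t\<in>{0<..}. ennreal (t powr (z - 1) * exp (- (c * t))) \<partial>lborel)))" by simp
  also have "\<dots> = ennreal (c powr - z * c * c powr (z - 1)) *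
     (\<integral>\<^sup>+t\<in>{0<..}. ennreal (t powr (z - 1) * exp (- (c * t))) \<partial>lborel)"
    using c by (simp add: ennreal_mult' mult_ac)
  also have "c powr - z * c * c powr (z - 1) = 1"
    using c by (simp add: powr_diff powr_minus field_simps)
  finally show ?thesis using z c by (simp add: ennreal_mult' mult.commute)
qed

text \<open>
  Writing \<open>1 / (y + c)\<close> as a Laplace integral and exchanging the integrals leaves two Gamma integrals.
\<close>
lemma nn_integral_powr_div_add:
  fixes p c :: real
  assumes p: "0 < p" "p < 1" and c: "c > 0"
  shows "(\<integral>\<^sup>+y\<in>{0<..}. ennreal (y powr (p - 1) / (y + c)) \<partial>lborel)
    = ennreal (Gamma p * Gamma (1 - p) * c powr (p - 1))"
proof -
  have "(\<integral>\<^sup>+y\<in>{0<..}. ennreal (y powr (p - 1) / (y + c)) \<partial>lborel) =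
     (\<integral>\<^sup>+y\<in>{0<..}. (\<integral>\<^sup>+v\<in>{0<..}. ennreal (y powr (p - 1) * exp (- ((y + c) * v))) \<partial>lborel) \<partial>lborel)"
  proof (rule nn_integral_cong)
    fix y :: real
    show "ennreal (y powr (p - 1) / (y + c)) * indicator {0<..} y =
      (\<integral>\<^sup>+v\<in>{0<..}. ennreal (y powr (p - 1) * exp (- ((y + c) * v))) \<partial>lborel) * indicator {0<..} y"
    proof (cases "y > 0")
      case True
      have "(\<integral>\<^sup>+v\<in>{0<..}. ennreal (y powr (p - 1) * exp (- ((y + c) * v))) \<partial>lborel) =
        (\<integral>\<^sup>+v. ennreal (y powr (p - 1)) * (ennreal (v powr (1 - 1) * exp (- ((y + c) * v))) * indicator {0<..} v) \<partial>lborel)"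
        by (intro nn_integral_cong) (auto simp: indicator_def simp flip: ennreal_mult')
      also have "\<dots> = ennreal (y powr (p - 1)) * (\<integral>\<^sup>+v\<in>{0<..}. ennreal (v powr (1 - 1) * exp (- ((y + c) * v))) \<partial>lborel)"
        by (rule nn_integral_cmult) auto
      also have "\<dots> = ennreal (y powr (p - 1)) * ennreal (1 / (y + c))"
        using nn_integral_powr_exp[of 1 "y + c"] True c by (simp add: powr_minus field_simps)
      finally show ?thesis using True c by (simp flip: ennreal_mult')
    qed simp
  qed
  also have "\<dots> = (\<integral>\<^sup>+y. (\<integral>\<^sup>+v. ennreal (y powr (p - 1) * exp (- ((y + c) * v))) * indicator {0<..} v * indicator {0<..} y \<partial>lborel) \<partial>lborel)"
    by (intro nn_integral_cong nn_integral_multc[symmetric]) auto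
  also have "\<dots> = (\<integral>\<^sup>+v. (\<integral>\<^sup>+y. ennreal (y powr (p - 1) * exp (- ((y + c) * v))) * indicator {0<..} v * indicator {0<..} y \<partial>lborel) \<partial>lborel)"
    by (rule lborel_pair.Fubini'[symmetric]) measurable
  also have "\<dots> = (\<integral>\<^sup>+v. ennreal (Gamma p) * (ennreal (v powr ((1 - p) - 1) * exp (- (c * v))) * indicator {0<..} v) \<partial>lborel)"
  proof (rule nn_integral_cong)
    fix v :: real
    show "(\<integral>\<^sup>+y. ennreal (y powr (p - 1) * exp (- ((y + c) * v))) * indicator {0<..} v * indicator {0<..} y \<partial>lborel)
      = ennreal (Gamma p) * (ennreal (v powr ((1 - p) - 1) * exp (- (c * v))) * indicator {0<..} v)"
    proof (cases "v > 0")
      case True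
      have "(\<integral>\<^sup>+y. ennreal (y powr (p - 1) * exp (- ((y + c) * v))) * indicator {0<..} v * indicator {0<..} y \<partial>lborel)
        = (\<integral>\<^sup>+y. ennreal (exp (- (c * v))) * (ennreal (y powr (p - 1) * exp (- (v * y))) * indicator {0<..} y) \<partial>lborel)"
        using True by (intro nn_integral_cong)
          (auto simp: indicator_def algebra_simps exp_diff exp_minus exp_add field_simps simp flip: ennreal_mult')
      also have "\<dots> = ennreal (exp (- (c * v))) * (\<integral>\<^sup>+y\<in>{0<..}. ennreal (y powr (p - 1) * exp (- (v * y))) \<partial>lborel)"
        by (rule nn_integral_cmult) auto
      also have "\<dots> = ennreal (exp (- (c * v))) * ennreal (Gamma p * v powr - p)"
        using nn_integral_powr_exp[of p v] p True by simp
      finally show ?thesis using True p by (simp add: mult_ac ennreal_mult' flip: ennreal_mult')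
    qed simp
  qed
  also have "\<dots> = ennreal (Gamma p) * (\<integral>\<^sup>+v\<in>{0<..}. ennreal (v powr ((1 - p) - 1) * exp (- (c * v))) \<partial>lborel)"
    by (rule nn_integral_cmult) auto
  also have "\<dots> = ennreal (Gamma p) * ennreal (Gamma (1 - p) * c powr (p - 1))"
    using nn_integral_powr_exp[of "1 - p" c] p c by simp
  finally show ?thesis using p c by (simp add: mult_ac flip: ennreal_mult')
qed

text \<open>
  The substitution \<open>y = x\<^sup>2\<close> leads to the preceding integral with \<open>p = (1 - a) / 2\<close>, and the
  reflection formula turns the Gamma values into a cosine.
\<close>
lemma nn_integral_powr_pfd_term:
  fixes a c :: real
  assumes a: "0 < a" "a < 1" and c: "c > 0"
  shows "(\<integral>\<^sup>+x\<in>{0<..}. ennreal (x powr (- a - 1) * (2 * x / (x\<^sup>2 + c\<^sup>2))) \<partial>lborel)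
    = ennreal (pi / cos (pi * a / 2) * c powr (- a - 1))"
proof -
  define p where "p = (1 - a) / 2"
  define b where "b = Gamma p * Gamma (1 - p) * (c\<^sup>2) powr (p - 1)"
  define f :: "real \<Rightarrow> real" where "f y = y powr (p - 1) / (y + c\<^sup>2)" for y
  have p: "0 < p" "p < 1" using a by (auto simp: p_def)
  have p2: "2 * (p - 1) = - a - 1" by (simp add: p_def field_simps)
  have b0: "b \<ge> 0" using p by (auto simp: b_def intro!: mult_nonneg_nonneg Gamma_real_nonneg)
  have nn: "(\<integral>\<^sup>+y. ennreal (f y * indicator {0<..} y) \<partial>lborel) = ennreal b"
  proof -
    have "(\<integral>\<^sup>+y. ennreal (f y * indicator {0<..} y) \<partial>lborel) = (\<integral>\<^sup>+y\<in>{0<..}. ennreal (y powr (p - 1) / (y + c\<^sup>2)) \<partial>lborel)"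
      by (intro nn_integral_cong) (auto simp: f_def indicator_def)
    thus ?thesis using nn_integral_powr_div_add[OF p, of "c\<^sup>2"] c by (simp add: b_def)
  qed
  have "((\<lambda>y. f y * indicator {0<..} y) has_integral b) UNIV"
    by (rule nn_integral_has_integral[OF _ _ nn b0]) (auto simp: f_def indicator_def)
  also have "(\<lambda>y. f y * indicator {0<..} y) = (\<lambda>y. if y \<in> {0<..} then f y else 0)" by (auto simp: indicator_def)
  finally have hi: "(f has_integral b) {0<..}" unfolding has_integral_restrict_UNIV .
  have ai: "f absolutely_integrable_on {0<..}"
    by (rule nonnegative_absolutely_integrable_1) (use hi in \<open>auto simp: f_def\<close>)
  have img: "(\<lambda>x. x\<^sup>2) ` {0<..} = {(0::real)<..}"
  proof (intro equalityI subsetI)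
    fix y :: real assume "y \<in> {0<..}"
    thus "y \<in> (\<lambda>x. x\<^sup>2) ` {0<..}" by (intro image_eqI[of _ _ "sqrt y"]) auto
  qed auto
  have "(\<lambda>x. \<bar>2 * x\<bar> * f (x\<^sup>2)) absolutely_integrable_on {0<..} \<and> integral {0<..} (\<lambda>x. \<bar>2 * x\<bar> * f (x\<^sup>2)) = b
     \<longleftrightarrow> f absolutely_integrable_on ((\<lambda>x. x\<^sup>2) ` {0<..}) \<and> integral ((\<lambda>x. x\<^sup>2) ` {0<..}) f = b"
  proof (rule has_absolute_integral_change_of_variables_1')
    show "inj_on (\<lambda>x. x\<^sup>2) {(0::real)<..}" by (auto simp: inj_on_def)
  qed (auto intro!: derivative_eq_intros)
  hence "(\<lambda>x. \<bar>2 * x\<bar> * f (x\<^sup>2)) absolutely_integrable_on {0<..}" "integral {0<..} (\<lambda>x. \<bar>2 * x\<bar> * f (x\<^sup>2)) = b"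
    using ai hi unfolding img by (auto simp: integral_unique)
  hence "((\<lambda>x. \<bar>2 * x\<bar> * f (x\<^sup>2)) has_integral b) {0<..}"
    by (metis absolutely_integrable_on_def integrable_integral)
  hence "(\<integral>\<^sup>+x. ennreal (indicator {0<..} x * (\<bar>2 * x\<bar> * f (x\<^sup>2))) \<partial>lborel) = ennreal b"
    by (intro nn_integral_has_integral_lebesgue) (auto simp: f_def)
  also have "(\<integral>\<^sup>+x. ennreal (indicator {0<..} x * (\<bar>2 * x\<bar> * f (x\<^sup>2))) \<partial>lborel)
    = (\<integral>\<^sup>+x\<in>{0<..}. ennreal (x powr (- a - 1) * (2 * x / (x\<^sup>2 + c\<^sup>2))) \<partial>lborel)"
  proof (rule nn_integral_cong)
    fix x :: real
    have "(x\<^sup>2) powr (p - 1) = x powr (- a - 1)" if "x > 0"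
      unfolding p2[symmetric] powr_powr[symmetric] using that by simp
    thus "ennreal (indicator {0<..} x * (\<bar>2 * x\<bar> * f (x\<^sup>2))) =
      ennreal (x powr (- a - 1) * (2 * x / (x\<^sup>2 + c\<^sup>2))) * indicator {0<..} x"
      by (auto simp: indicator_def f_def)
  qed
  also have "b = pi / cos (pi * a / 2) * c powr (- a - 1)"
  proof -
    have "Gamma p * Gamma (1 - p) = pi / sin (pi * p)"
    proof -
      have "complex_of_real (Gamma p * Gamma (1 - p)) = Gamma (of_real p) * Gamma (1 - of_real p)"
        by (simp flip: Gamma_complex_of_real)
      also have "\<dots> = of_real (pi / sin (pi * p))"
        by (simp add: Gamma_reflection_complex sin_of_real flip: of_real_mult)
      finally show ?thesis by (simp only: of_real_eq_iff)
    qed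
    also have "sin (pi * p) = cos (pi * a / 2)"
    proof -
      have *: "pi / 2 - pi * p = pi * a / 2" by (simp add: p_def field_simps)
      have "sin (pi * p) = cos (pi / 2 - pi * p)" by (simp add: sin_cos_eq)
      thus ?thesis unfolding * .
    qed
    finally have "Gamma p * Gamma (1 - p) = pi / cos (pi * a / 2)" .
    moreover have "(c\<^sup>2) powr (p - 1) = c powr (- a - 1)"
      unfolding p2[symmetric] powr_powr[symmetric] using c by simp
    ultimately show ?thesis by (simp add: b_def)
  qed
  finally show ?thesis .
qed

text \<open>
  Subtracting \<open>1\<close> from the exponential extends Euler's integral to the argument \<open>-a\<close>: the difference is
  the integral of \<open>x exp (- t x)\<close> over \<open>t\<close> from \<open>0\<close> to \<open>u\<close>.
\<close>
lemma nn_integral_powr_one_minus_exp: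
  fixes a u :: real
  assumes a: "0 < a" "a < 1" and u: "u \<ge> 0"
  shows "(\<integral>\<^sup>+x\<in>{0<..}. ennreal (x powr (- a - 1) * (1 - exp (- (u * x)))) \<partial>lborel)
     = ennreal (Gamma (1 - a) / a * u powr a)"
proof -
  have "(\<integral>\<^sup>+x\<in>{0<..}. ennreal (x powr (- a - 1) * (1 - exp (- (u * x)))) \<partial>lborel) =
    (\<integral>\<^sup>+x. (\<integral>\<^sup>+t. ennreal (x powr - a * exp (- (t * x))) * indicator {0..u} t * indicator {0<..} x \<partial>lborel) \<partial>lborel)"
  proof (rule nn_integral_cong)
    fix x :: real
    show "ennreal (x powr (- a - 1) * (1 - exp (- (u * x)))) * indicator {0<..} x =
      (\<integral>\<^sup>+t. ennreal (x powr - a * exp (- (t * x))) * indicator {0..u} t * indicator {0<..} x \<partial>lborel)"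
    proof (cases "x > 0")
      case True
      have "(\<integral>\<^sup>+t. ennreal (x powr - a * exp (- (t * x))) * indicator {0..u} t \<partial>lborel) =
          ennreal (- (x powr (- a - 1)) * exp (- (u * x)) - (- (x powr (- a - 1)) * exp (- (0 * x))))"
        by (rule nn_integral_FTC_Icc)
           (use True u in \<open>auto intro!: derivative_eq_intros simp: powr_diff field_simps\<close>)
      thus ?thesis using True by (simp add: algebra_simps)
    qed simp
  qed
  also have "\<dots> = (\<integral>\<^sup>+t. (\<integral>\<^sup>+x. ennreal (x powr - a * exp (- (t * x))) * indicator {0..u} t * indicator {0<..} x \<partial>lborel) \<partial>lborel)"
    by (rule lborel_pair.Fubini'[symmetric]) measurable
  also have "\<dots> = (\<integral>\<^sup>+t. ennreal (indicator {0..u} t * (Gamma (1 - a) * t powr (a - 1))) \<partial>lborel)"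
  proof (rule nn_integral_cong_AE, rule AE_mp[OF AE_lborel_singleton[of 0]], rule AE_I2, rule impI)
    fix t :: real assume t0: "t \<noteq> 0"
    show "(\<integral>\<^sup>+x. ennreal (x powr - a * exp (- (t * x))) * indicator {0..u} t * indicator {0<..} x \<partial>lborel) =
      ennreal (indicator {0..u} t * (Gamma (1 - a) * t powr (a - 1)))"
      using nn_integral_powr_exp[of "1 - a" t] t0 a by (auto simp: indicator_def)
  qed
  also have "((\<lambda>t. Gamma (1 - a) * t powr (a - 1)) has_integral (Gamma (1 - a) * (u powr (a - 1 + 1) / (a - 1 + 1)))) {0..u}"
    using a u by (intro has_integral_mult_right has_integral_powr_from_0) auto
  hence "(\<integral>\<^sup>+t. ennreal (indicator {0..u} t * (Gamma (1 - a) * t powr (a - 1))) \<partial>lborel) =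
     ennreal (Gamma (1 - a) * (u powr (a - 1 + 1) / (a - 1 + 1)))"
    using a by (intro nn_integral_has_integral_lebesgue) (auto intro!: mult_nonneg_nonneg Gamma_real_nonneg)
  finally show ?thesis by (simp add: mult_ac)
qed

section \<open>Partial fractions and the trapezoidal rule for exponentials\<close>

text \<open>The logarithmic derivative of the reflection formula for the Gamma function.\<close>
lemma Digamma_reflection:
  fixes z :: complex
  assumes z: "z \<notin> \<int>"
  shows "Digamma z - Digamma (1 - z) = - of_real pi * cos (of_real pi * z) / sin (of_real pi * z)"
proof -
  have z': "1 - z \<notin> \<int>" using z by (metis Ints_1 Ints_diff diff_diff_eq2 add_diff_cancel_left')
  have np: "z \<notin> \<int>\<^sub>\<le>\<^sub>0" "1 - z \<notin> \<int>\<^sub>\<le>\<^sub>0" using z z' nonpos_Ints_subset_Ints by auto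
  have s: "sin (of_real pi * z) \<noteq> 0" using z by (auto simp: sin_eq_0)
  have "((\<lambda>w. Gamma w * Gamma (1 - w)) has_field_derivative
      Gamma z * Gamma (1 - z) * (Digamma z - Digamma (1 - z))) (at z)"
    by (rule derivative_eq_intros refl np)+ (auto simp: algebra_simps)
  moreover have "((\<lambda>w. of_real pi / sin (of_real pi * w)) has_field_derivative
      (of_real pi / sin (of_real pi * z)) * (- of_real pi * cos (of_real pi * z) / sin (of_real pi * z))) (at z)"
    using s by (auto intro!: derivative_eq_intros simp: field_simps power2_eq_square)
  hence "((\<lambda>w. Gamma w * Gamma (1 - w)) has_field_derivative
      (of_real pi / sin (of_real pi * z)) * (- of_real pi * cos (of_real pi * z) / sin (of_real pi * z))) (at z)"
    by (simp add: Gamma_reflection_complex)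
  ultimately have "Gamma z * Gamma (1 - z) * (Digamma z - Digamma (1 - z)) =
      (of_real pi / sin (of_real pi * z)) * (- of_real pi * cos (of_real pi * z) / sin (of_real pi * z))"
    by (rule DERIV_unique)
  hence "(of_real pi / sin (of_real pi * z)) * (Digamma z - Digamma (1 - z)) =
      (of_real pi / sin (of_real pi * z)) * (- of_real pi * cos (of_real pi * z) / sin (of_real pi * z))"
    by (simp only: Gamma_reflection_complex)
  thus ?thesis using s by (subst (asm) mult_left_cancel) auto
qed

lemma cot_partial_fractions:
  fixes z :: complex
  assumes z: "z \<notin> \<int>"
  shows "(\<lambda>k. 1 / (of_nat (Suc k) - z) - 1 / (of_nat (Suc k) + z)) sums
     (1 / z - of_real pi * cos (of_real pi * z) / sin (of_real pi * z))"
proof -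
  have z0: "z \<noteq> 0" "1 - z \<noteq> 0" using z by auto
  have *: "(\<lambda>k. inverse (of_nat (Suc k)) - inverse (w + of_nat k)) sums (Digamma w + euler_mascheroni)"
    if "w \<noteq> 0" for w :: complex
    using summable_sums[OF summable_Digamma[OF that]] by (simp add: Digamma_def)
  have "(\<lambda>k. (inverse (of_nat (Suc k)) - inverse (z + of_nat k)) -
      (inverse (of_nat (Suc k)) - inverse ((1 - z) + of_nat k))) sums
      ((Digamma z + euler_mascheroni) - (Digamma (1 - z) + euler_mascheroni))"
    by (intro sums_diff * z0)
  moreover have "(\<lambda>k. inverse (z + of_nat k) - inverse (z + of_nat (Suc k))) sums (inverse (z + of_nat 0) - 0)"
  proof (rule telescope_sums')
    show "(\<lambda>n. inverse (z + of_nat n)) \<longlonglongrightarrow> 0"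
      by (rule filterlim_compose[OF tendsto_inverse_0 tendsto_add_filterlim_at_infinity[OF tendsto_const tendsto_of_nat]])
  qed
  ultimately have "(\<lambda>k. ((inverse (of_nat (Suc k)) - inverse (z + of_nat k)) -
      (inverse (of_nat (Suc k)) - inverse ((1 - z) + of_nat k))) +
      (inverse (z + of_nat k) - inverse (z + of_nat (Suc k)))) sums
      ((Digamma z + euler_mascheroni) - (Digamma (1 - z) + euler_mascheroni) + (inverse (z + of_nat 0) - 0))"
    by (rule sums_add)
  thus ?thesis using Digamma_reflection[OF z] by (simp add: inverse_eq_divide algebra_simps)
qed

text \<open>The partial fractions of the cotangent at the point \<open>\<i> x / (2 pi)\<close>.\<close>
lemma exp_minus_one_partial_fractions:
  fixes x :: real
  assumes x: "x > 0"
  shows "(\<lambda>k. 2 * x / (x\<^sup>2 + (2 * pi * real (Suc k))\<^sup>2)) sums (1 / (exp x - 1) - 1 / x + 1 / 2)"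
proof -
  have cancel: "- (2 * pi) * t / (- (2 * pi)) = t" for t by simp
  define z where "z = \<i> * of_real (x / (2 * pi))"
  have z0: "z \<noteq> 0" "Re z = 0" "Im z = x / (2 * pi)" using x by (auto simp: z_def)
  have zI: "z \<notin> \<int>"
  proof
    assume "z \<in> \<int>"
    then obtain n where "z = of_int n" by (elim Ints_cases)
    hence "Im z = 0" by simp
    thus False using x z0 by simp
  qed
  have e: "exp x \<noteq> 1" "exp x - 1 \<noteq> 0" using x by auto
  have cs: "of_real pi * cos (of_real pi * z) / sin (of_real pi * z) = - \<i> * of_real (pi * (exp x + 1) / (exp x - 1))"
  proof -
    have pz: "\<i> * (of_real pi * z) = of_real (- (x / 2))" by (simp add: z_def field_simps)
    define t where "t = exp (x / 2)"
    have t: "t > 1" "exp x = t\<^sup>2" using x by (auto simp: t_def power2_eq_square simp flip: exp_add)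
    have ex: "exp (\<i> * (of_real pi * z)) = of_real (1 / t)" "exp (- (\<i> * (of_real pi * z))) = of_real t"
      unfolding pz of_real_minus[symmetric] exp_of_real by (simp_all add: t_def exp_minus inverse_eq_divide)
    have c: "cos (of_real pi * z) = of_real ((1 / t + t) / 2)"
      using ex by (simp add: cos_exp_eq)
    have s: "sin (of_real pi * z) = - \<i> * of_real ((1 / t - t) / 2)"
      using ex by (simp add: sin_exp_eq field_simps)
    have "t\<^sup>2 > 1\<^sup>2" using t by (intro power_strict_mono) auto
    hence nz: "1 / t - t \<noteq> 0" "t\<^sup>2 - 1 \<noteq> 0" "t \<noteq> 0" using t(1) by (auto simp: field_simps power2_eq_square)
    have r: "pi * ((1 / t + t) / 2) / ((1 / t - t) / 2) = - (pi * (t\<^sup>2 + 1) / (t\<^sup>2 - 1))"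
      using nz by (simp add: divide_simps power2_eq_square) (simp add: algebra_simps)
    have i: "u / (- \<i> * v) = \<i> * (u / v)" for u v :: complex
      by (cases "v = 0") (simp_all add: divide_simps)
    have "of_real pi * cos (of_real pi * z) / sin (of_real pi * z) = \<i> * of_real (pi * ((1 / t + t) / 2) / ((1 / t - t) / 2))"
      unfolding c s i by simp
    thus ?thesis unfolding r t(2) by simp
  qed
  have "(\<lambda>k. \<i> * (1 / (of_nat (Suc k) - z) - 1 / (of_nat (Suc k) + z))) sums
     (\<i> * (1 / z - of_real pi * cos (of_real pi * z) / sin (of_real pi * z)))"
    by (rule sums_mult[OF cot_partial_fractions[OF zI]])
  also have "(\<lambda>k. \<i> * (1 / (of_nat (Suc k) - z) - 1 / (of_nat (Suc k) + z))) =
     (\<lambda>k. of_real (- (2 * pi) * (2 * x / (x\<^sup>2 + (2 * pi * real (Suc k))\<^sup>2))))"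
  proof
    fix k
    define m where "m = real (Suc k)"
    define y where "y = x / (2 * pi)"
    have m: "m > 0" by (simp add: m_def)
    have d: "of_real m - z \<noteq> 0" "of_real m + z \<noteq> 0"
      using m by (auto simp: complex_eq_iff z0)
    have "of_real m ^ 2 - z ^ 2 = (of_real m - z) * (of_real m + z)"
      by (simp add: power2_eq_square algebra_simps)
    hence "\<i> * (1 / (of_real m - z) - 1 / (of_real m + z)) = \<i> * (2 * z / (of_real m ^ 2 - z ^ 2))"
      using d by (simp add: divide_simps)
    also have "z ^ 2 = - complex_of_real (y\<^sup>2)"
      unfolding z_def y_def[symmetric] by (simp add: power_mult_distrib)
    also have "of_real m ^ 2 - - complex_of_real (y\<^sup>2) = complex_of_real (m\<^sup>2 + y\<^sup>2)" by simp
    also have "\<i> * (2 * z / complex_of_real (m\<^sup>2 + y\<^sup>2)) = of_real (- 2 * y / (m\<^sup>2 + y\<^sup>2))"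
      by (simp add: z_def y_def)
    also have "- 2 * y / (m\<^sup>2 + y\<^sup>2) = - (2 * pi) * (2 * x / (x\<^sup>2 + (2 * pi * m)\<^sup>2))"
    proof -
      have "x = 2 * pi * y" by (simp add: y_def)
      hence 1: "x\<^sup>2 + (2 * pi * m)\<^sup>2 = (2 * pi)\<^sup>2 * (m\<^sup>2 + y\<^sup>2)" by (simp add: power_mult_distrib algebra_simps)
      have 2: "- (2 * pi) * (2 * x / ((2 * pi)\<^sup>2 * r)) = - 2 * y / r" for r :: real
        unfolding \<open>x = 2 * pi * y\<close> by (simp add: power2_eq_square)
      show ?thesis unfolding 1 2 ..
    qed
    finally show "\<i> * (1 / (of_nat (Suc k) - z) - 1 / (of_nat (Suc k) + z)) =
      of_real (- (2 * pi) * (2 * x / (x\<^sup>2 + (2 * pi * real (Suc k))\<^sup>2)))" by (simp add: m_def)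
  qed
  also have "\<i> * (1 / z - of_real pi * cos (of_real pi * z) / sin (of_real pi * z)) =
     of_real (2 * pi / x - pi * (exp x + 1) / (exp x - 1))"
    unfolding cs using x by (simp add: z_def algebra_simps)
  finally have "(\<lambda>k. - (2 * pi) * (2 * x / (x\<^sup>2 + (2 * pi * real (Suc k))\<^sup>2))) sums (2 * pi / x - pi * (exp x + 1) / (exp x - 1))"
    by (simp only: sums_of_real_iff)
  from sums_divide[OF this, of "- (2 * pi)"] have
    "(\<lambda>k. 2 * x / (x\<^sup>2 + (2 * pi * real (Suc k))\<^sup>2)) sums ((2 * pi / x - pi * (exp x + 1) / (exp x - 1)) / (- (2 * pi)))"
    unfolding cancel .
  also have "(2 * pi / x - pi * (exp x + 1) / (exp x - 1)) / (- (2 * pi)) = 1 / (exp x - 1) - 1 / x + 1 / 2"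
    using x e by (simp add: divide_simps) (simp add: algebra_simps)
  finally show ?thesis .
qed

text \<open>
  The error of the trapezoidal rule for the function \<open>u \<mapsto> exp (- u x)\<close> on the interval \<open>[n, n + 1]\<close>.
\<close>
definition trapezoid_exp :: "nat \<Rightarrow> real \<Rightarrow> real" where
  "trapezoid_exp n x = exp (- (real n * x)) * ((1 + exp (- x)) / 2 - (1 - exp (- x)) / x)"

text \<open>The trapezoidal rule overestimates the integral of a convex function.\<close>
lemma trapezoid_exp_nonneg:
  assumes x: "x > 0"
  shows "trapezoid_exp n x \<ge> 0"
proof -
  define f where "f x = x * (1 + exp (- x)) - 2 * (1 - exp (- x))" for x :: real
  have "f 0 \<le> f x"
  proof (rule DERIV_nonneg_imp_nondecreasing[of 0 x f])
    fix t :: real assume t: "0 \<le> t" "t \<le> x"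
    have "1 + t \<le> exp t" by simp
    hence "(1 + t) * exp (- t) \<le> exp t * exp (- t)" by (intro mult_right_mono) auto
    hence "1 - exp (- t) - t * exp (- t) \<ge> 0" by (simp add: algebra_simps flip: exp_add)
    moreover have "(f has_field_derivative (1 - exp (- t) - t * exp (- t))) (at t)"
      unfolding f_def by (auto intro!: derivative_eq_intros simp: algebra_simps)
    ultimately show "\<exists>y. (f has_real_derivative y) (at t) \<and> 0 \<le> y" by blast
  qed (use x in auto)
  hence "(1 - exp (- x)) / x \<le> (1 + exp (- x)) / 2" using x by (simp add: f_def field_simps)
  thus ?thesis by (simp add: trapezoid_exp_def)
qed

lemma trapezoid_exp_sums:
  assumes x: "x > 0"
  shows "(\<lambda>n. trapezoid_exp n x) sums (1 / (exp x - 1) - 1 / x + 1 / 2)"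
proof -
  define q where "q = exp (- x)"
  have q: "norm q < 1" "1 - q \<noteq> 0" "q > 0" "q \<noteq> 1" using x by (auto simp: q_def)
  have "(\<lambda>n. q ^ n * ((1 + q) / 2 - (1 - q) / x)) sums (1 / (1 - q) * ((1 + q) / 2 - (1 - q) / x))"
    by (intro sums_mult2 geometric_sums q)
  also have "(\<lambda>n. q ^ n * ((1 + q) / 2 - (1 - q) / x)) = (\<lambda>n. trapezoid_exp n x)"
    by (auto simp: trapezoid_exp_def q_def simp flip: exp_of_nat_mult)
  also have "1 / (1 - q) * ((1 + q) / 2 - (1 - q) / x) = (1 + q) / (2 * (1 - q)) - 1 / x"
    using q x by (simp add: field_simps)
  also have "(1 + q) / (2 * (1 - q)) = 1 / (exp x - 1) + 1 / 2"
  proof -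
    have "exp x = 1 / q" by (simp add: q_def exp_minus inverse_eq_divide)
    thus ?thesis using q x by (simp add: divide_simps) (simp add: algebra_simps)
  qed
  finally show ?thesis by (simp add: algebra_simps)
qed

text \<open>
  The Mellin transform turns \<open>1 - exp (- u x)\<close> into a multiple of \<open>u powr a\<close>, hence the trapezoidal
  error of \<open>exp (- u x)\<close> into that of \<open>u powr a\<close>. All integrands are nonnegative, so the integrals
  over \<open>u\<close> and \<open>x\<close> may be exchanged.
\<close>
lemma nn_integral_trapezoid_exp:
  fixes a :: real and n :: nat
  assumes a: "0 < a" "a < 1"
  defines "D \<equiv> ((real n + 1) powr (a + 1) - real n powr (a + 1)) / (a + 1) - (real n powr a + (real n + 1) powr a) / 2"
  shows "D \<ge> 0"
    and "(\<integral>\<^sup>+x\<in>{0<..}. ennreal (x powr (- a - 1) * trapezoid_exp n x) \<partial>lborel) = ennreal (Gamma (1 - a) / a * D)"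
proof -
  define K where "K = Gamma (1 - a) / a"
  have K: "K > 0" using a by (simp add: K_def Gamma_real_pos)
  define I where "I = (\<integral>\<^sup>+x\<in>{0<..}. ennreal (x powr (- a - 1) * trapezoid_exp n x) \<partial>lborel)"
  define P where "P = ((real n + 1) powr (a + 1) - real n powr (a + 1)) / (a + 1)"
  define Q where "Q = (real n powr a + (real n + 1) powr a) / 2"
  define A where "A u = (\<lambda>x::real. ennreal (x powr (- a - 1) * (1 - exp (- (u * x)))) * indicator {0<..} x)" for u
  have A: "integral\<^sup>N lborel (A u) = ennreal (K * u powr a)" if "u \<ge> 0" for u
    using nn_integral_powr_one_minus_exp[OF a that] by (simp add: A_def K_def)
  have split_ennreal: "ennreal (r + 1/2 * (s + t)) = ennreal r + ennreal (1/2) * (ennreal s + ennreal t)"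
    if "r \<ge> 0" "s \<ge> 0" "t \<ge> 0" for r s t :: real
  proof -
    have "ennreal (r + 1/2 * (s + t)) = ennreal r + ennreal (1/2 * (s + t))"
      by (rule ennreal_plus) (use that in auto)
    also have "ennreal (1/2 * (s + t)) = ennreal (1/2) * ennreal (s + t)"
      by (rule ennreal_mult) (use that in auto)
    also have "ennreal (s + t) = ennreal s + ennreal t"
      by (rule ennreal_plus) (use that in auto)
    finally show ?thesis .
  qed
  have Am [measurable]: "A u \<in> borel_measurable lborel" for u unfolding A_def by measurable
  have tm [measurable]: "trapezoid_exp n \<in> borel_measurable lborel"
    unfolding trapezoid_exp_def[abs_def] by measurable
  have eq: "(\<integral>\<^sup>+u. A u x * indicator {real n..real n + 1} u \<partial>lborel) =
     ennreal (x powr (- a - 1) * trapezoid_exp n x) * indicator {0<..} x + ennreal (1/2) * (A (real n) x + A (real n + 1) x)" for x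
  proof (cases "x > 0")
    case True
    let ?F = "\<lambda>u. x powr (- a - 1) * (u + exp (- (u * x)) / x)"
    have "(\<integral>\<^sup>+u. ennreal (x powr (- a - 1) * (1 - exp (- (u * x)))) * indicator {real n..real n + 1} u \<partial>lborel)
       = ennreal (?F (real n + 1) - ?F (real n))"
    proof (rule nn_integral_FTC_Icc)
      fix u assume u: "u \<in> {real n..real n + 1}"
      show "(?F has_real_derivative x powr (- a - 1) * (1 - exp (- (u * x)))) (at u)"
        using True by (auto intro!: derivative_eq_intros simp: field_simps)
      have "u * x \<ge> 0" using True u by auto
      thus "0 \<le> x powr (- a - 1) * (1 - exp (- (u * x)))" by simp
    qed auto
    also have "?F (real n + 1) - ?F (real n) = x powr (- a - 1) * trapezoid_exp n x +
       1/2 * (x powr (- a - 1) * (1 - exp (- (real n * x))) + x powr (- a - 1) * (1 - exp (- ((real n + 1) * x))))"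
    proof -
      have "exp (- ((real n + 1) * x)) = exp (- (real n * x)) * exp (- x)" by (simp add: algebra_simps flip: exp_add)
      thus ?thesis using True by (simp add: trapezoid_exp_def field_simps)
    qed
    also have "ennreal \<dots> = ennreal (x powr (- a - 1) * trapezoid_exp n x) +
       ennreal (1/2) * (ennreal (x powr (- a - 1) * (1 - exp (- (real n * x)))) + ennreal (x powr (- a - 1) * (1 - exp (- ((real n + 1) * x)))))"
      by (rule split_ennreal) (use True trapezoid_exp_nonneg[OF True, of n] in auto)
    finally show ?thesis using True by (simp add: A_def)
  qed (simp add: A_def)
  have "I + ennreal (K * Q) = (\<integral>\<^sup>+x. (\<integral>\<^sup>+u. A u x * indicator {real n..real n + 1} u \<partial>lborel) \<partial>lborel)"
  proof -
    have "(\<integral>\<^sup>+x. (\<integral>\<^sup>+u. A u x * indicator {real n..real n + 1} u \<partial>lborel) \<partial>lborel) =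
      I + ennreal (1/2) * (ennreal (K * real n powr a) + ennreal (K * (real n + 1) powr a))"
      unfolding eq I_def using A[of "real n"] A[of "real n + 1"]
      by (subst nn_integral_add) (auto simp: nn_integral_cmult nn_integral_add)
    also have "ennreal (1/2) * (ennreal (K * real n powr a) + ennreal (K * (real n + 1) powr a)) = ennreal (K * Q)"
      using split_ennreal[of 0 "K * real n powr a" "K * (real n + 1) powr a"] K
      by (simp add: Q_def algebra_simps add_divide_distrib)
    finally show ?thesis by simp
  qed
  also have "\<dots> = (\<integral>\<^sup>+u. (\<integral>\<^sup>+x. A u x * indicator {real n..real n + 1} u \<partial>lborel) \<partial>lborel)"
    unfolding A_def by (rule lborel_pair.Fubini'[symmetric]) measurable
  also have "\<dots> = (\<integral>\<^sup>+u. ennreal (K * u powr a) * indicator {real n..real n + 1} u \<partial>lborel)"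
    by (intro nn_integral_cong) (auto simp: indicator_def A)
  also have "\<dots> = (\<integral>\<^sup>+u. ennreal (indicator {real n..real n + 1} u * (K * u powr a)) \<partial>lborel)"
    by (intro nn_integral_cong) (auto simp: indicator_def)
  also have "((\<lambda>u. K * u powr a) has_integral
      K * ((real n + 1) powr (a + 1) / (a + 1)) - K * (real n powr (a + 1) / (a + 1))) {real n..real n + 1}"
  proof (intro fundamental_theorem_of_calculus_interior)
    fix u assume u: "u \<in> {real n<..<real n + 1}"
    have "((\<lambda>u. u powr (a + 1)) has_real_derivative (a + 1) * u powr a) (at u)"
      using u has_real_derivative_powr[of u "a + 1"] by simp
    hence "((\<lambda>u. K * (u powr (a + 1) / (a + 1))) has_real_derivative K * ((a + 1) * u powr a / (a + 1))) (at u)"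
      by (intro DERIV_cmult DERIV_cdivide)
    thus "((\<lambda>u. K * (u powr (a + 1) / (a + 1))) has_vector_derivative K * u powr a) (at u)"
      using a by (simp flip: has_real_derivative_iff_has_vector_derivative)
  qed (use a in \<open>auto intro!: continuous_intros continuous_on_powr'\<close>)
  hence "(\<integral>\<^sup>+u. ennreal (indicator {real n..real n + 1} u * (K * u powr a)) \<partial>lborel) =
      ennreal (K * ((real n + 1) powr (a + 1) / (a + 1)) - K * (real n powr (a + 1) / (a + 1)))"
    using K by (intro nn_integral_has_integral_lebesgue) auto
  also have "K * ((real n + 1) powr (a + 1) / (a + 1)) - K * (real n powr (a + 1) / (a + 1)) = K * P"
    by (simp add: P_def algebra_simps diff_divide_distrib)
  finally have main: "I + ennreal (K * Q) = ennreal (K * P)" .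
  have Q0: "Q \<ge> 0" by (simp add: Q_def)
  have P0: "P \<ge> 0" using a by (auto simp: P_def intro!: divide_nonneg_pos powr_mono2)
  have "ennreal (K * Q) \<le> ennreal (K * P)" unfolding main[symmetric] by simp
  hence PQ: "Q \<le> P" using K P0 by (simp add: ennreal_le_iff)
  have D: "D = P - Q" by (simp add: D_def P_def Q_def)
  show "D \<ge> 0" using PQ D by simp
  have "I = (I + ennreal (K * Q)) - ennreal (K * Q)" by simp
  also have "\<dots> = ennreal (K * D)" unfolding main D using K Q0 by (simp add: ennreal_minus algebra_simps)
  finally show "(\<integral>\<^sup>+x\<in>{0<..}. ennreal (x powr (- a - 1) * trapezoid_exp n x) \<partial>lborel) = ennreal (Gamma (1 - a) / a * D)"
    by (simp add: I_def K_def)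
qed

section \<open>Continuation of the zeta function and its functional equation\<close>

lemma summable_Suc_powr: "p < -1 \<Longrightarrow> summable (\<lambda>n. real (Suc n) powr p)"
  using summable_real_powr_iff[of p] summable_Suc_iff[of "\<lambda>n. real n powr p"] by simp

text \<open>
  The function \<open>1 / (exp x - 1) - 1 / x + 1 / 2\<close> is the sum of the trapezoidal errors and also the sum
  of its partial fractions. Integrating both against \<open>x powr (- a - 1)\<close> term by term gives the
  functional equation of the zeta function at \<open>-a\<close> in disguise.
\<close>
lemma trapezoid_powr_sums:
  fixes a :: real
  assumes a: "0 < a" "a < 1"
  shows "(\<lambda>n. ((real n + 1) powr (a + 1) - real n powr (a + 1)) / (a + 1) - (real n powr a + (real n + 1) powr a) / 2) sums
     (a / Gamma (1 - a) * (pi / cos (pi * a / 2) * (2 * pi) powr (- a - 1) * (\<Sum>k. real (Suc k) powr (- a - 1))))"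
proof -
  define D where "D n = ((real n + 1) powr (a + 1) - real n powr (a + 1)) / (a + 1) - (real n powr a + (real n + 1) powr a) / 2" for n :: nat
  define K where "K = Gamma (1 - a) / a"
  have K: "K > 0" using a by (simp add: K_def Gamma_real_pos)
  have D0: "D n \<ge> 0" for n unfolding D_def by (rule nn_integral_trapezoid_exp[OF a])
  define C where "C = pi / cos (pi * a / 2)"
  have "cos (pi * a / 2) > 0" using a by (intro cos_gt_zero) auto
  hence C0: "C \<ge> 0" by (simp add: C_def)
  define t where "t k x = 2 * x / (x\<^sup>2 + (2 * pi * real (Suc k))\<^sup>2)" for k :: nat and x :: real
  have sumR: "summable (\<lambda>k. C * (2 * pi * real (Suc k)) powr (- a - 1))"
    using a by (auto simp: powr_mult intro!: summable_mult summable_Suc_powr simp del: of_nat_Suc)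
  have "(\<Sum>n. ennreal (K * D n)) = (\<Sum>n. (\<integral>\<^sup>+x\<in>{0<..}. ennreal (x powr (- a - 1) * trapezoid_exp n x) \<partial>lborel))"
    using nn_integral_trapezoid_exp(2)[OF a] by (simp add: K_def D_def)
  also have "\<dots> = (\<integral>\<^sup>+x. (\<Sum>n. ennreal (x powr (- a - 1) * trapezoid_exp n x) * indicator {0<..} x) \<partial>lborel)"
  proof (rule nn_integral_suminf[symmetric])
    show "(\<lambda>x. ennreal (x powr (- a - 1) * trapezoid_exp n x) * indicator {0<..} x) \<in> borel_measurable lborel" for n
      unfolding trapezoid_exp_def by measurable
  qed
  also have "\<dots> = (\<integral>\<^sup>+x. (\<Sum>k. ennreal (x powr (- a - 1) * t k x) * indicator {0<..} x) \<partial>lborel)"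
  proof (rule nn_integral_cong)
    fix x :: real
    show "(\<Sum>n. ennreal (x powr (- a - 1) * trapezoid_exp n x) * indicator {0<..} x) =
      (\<Sum>k. ennreal (x powr (- a - 1) * t k x) * indicator {0<..} x)"
    proof (cases "x > 0")
      case True
      let ?h = "x powr (- a - 1) * (1 / (exp x - 1) - 1 / x + 1 / 2)"
      have h1: "(\<lambda>n. x powr (- a - 1) * trapezoid_exp n x) sums ?h"
        by (intro sums_mult trapezoid_exp_sums True)
      have h2: "(\<lambda>k. x powr (- a - 1) * t k x) sums ?h"
        unfolding t_def by (intro sums_mult exp_minus_one_partial_fractions True)
      have "(\<Sum>n. ennreal (x powr (- a - 1) * trapezoid_exp n x)) = ennreal ?h"
        by (rule suminf_ennreal_eq[OF _ h1]) (use trapezoid_exp_nonneg[OF True] in simp)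
      moreover have "(\<Sum>k. ennreal (x powr (- a - 1) * t k x)) = ennreal ?h"
        by (rule suminf_ennreal_eq[OF _ h2]) (use True in \<open>simp add: t_def\<close>)
      ultimately have "(\<Sum>n. ennreal (x powr (- a - 1) * trapezoid_exp n x)) = (\<Sum>k. ennreal (x powr (- a - 1) * t k x))"
        by (simp only:)
      thus ?thesis using True by simp
    qed simp
  qed
  also have "\<dots> = (\<Sum>k. (\<integral>\<^sup>+x\<in>{0<..}. ennreal (x powr (- a - 1) * t k x) \<partial>lborel))"
  proof (rule nn_integral_suminf)
    show "(\<lambda>x. ennreal (x powr (- a - 1) * t k x) * indicator {0<..} x) \<in> borel_measurable lborel" for k
      unfolding t_def by measurable
  qed
  also have "\<dots> = (\<Sum>k. ennreal (C * (2 * pi * real (Suc k)) powr (- a - 1)))"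
    using nn_integral_powr_pfd_term[OF a] by (simp add: t_def C_def)
  finally have eq: "(\<Sum>n. ennreal (K * D n)) = (\<Sum>k. ennreal (C * (2 * pi * real (Suc k)) powr (- a - 1)))" .
  have "(\<Sum>n. ennreal (K * D n)) \<noteq> top_class.top"
    unfolding eq using sumR C0 by (intro ennreal_suminf_neq_top) auto
  hence sumL: "summable (\<lambda>n. K * D n)"
    using K D0 by (intro summable_suminf_not_top) auto
  have "ennreal (\<Sum>n. K * D n) = ennreal (\<Sum>k. C * (2 * pi * real (Suc k)) powr (- a - 1))"
  proof -
    have "(\<Sum>n. ennreal (K * D n)) = ennreal (\<Sum>n. K * D n)"
      by (rule suminf_ennreal2) (use K D0 sumL in auto)
    moreover have "(\<Sum>k. ennreal (C * (2 * pi * real (Suc k)) powr (- a - 1))) =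
        ennreal (\<Sum>k. C * (2 * pi * real (Suc k)) powr (- a - 1))"
      by (rule suminf_ennreal2) (use C0 sumR in \<open>auto simp del: of_nat_Suc\<close>)
    ultimately show ?thesis using eq by (simp only:)
  qed
  hence "(\<Sum>n. K * D n) = (\<Sum>k. C * (2 * pi * real (Suc k)) powr (- a - 1))"
    using K D0 C0 sumL sumR by (subst (asm) ennreal_inj) (auto intro!: suminf_nonneg)
  also have "\<dots> = (\<Sum>k. C * (2 * pi) powr (- a - 1) * real (Suc k) powr (- a - 1))"
    by (simp add: powr_mult mult_ac del: of_nat_Suc)
  also have "\<dots> = C * (2 * pi) powr (- a - 1) * (\<Sum>k. real (Suc k) powr (- a - 1))"
    using a by (intro suminf_mult summable_Suc_powr) auto
  finally have "(\<lambda>n. K * D n) sums (C * (2 * pi) powr (- a - 1) * (\<Sum>k. real (Suc k) powr (- a - 1)))"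
    using sumL by (simp add: sums_iff del: suminf_mult)
  from sums_mult[OF this, of "1 / K"] K
  have "D sums (1 / K * (C * (2 * pi) powr (- a - 1) * (\<Sum>k. real (Suc k) powr (- a - 1))))"
    by simp
  thus ?thesis by (simp add: D_def[abs_def] K_def C_def)
qed

text \<open>
  Multiplied by \<open>s (s + 1) / 2\<close>, this is the error of the trapezoidal rule for \<open>u powr (- s)\<close> on the
  interval \<open>[n + 1, n + 2]\<close>. The kernel \<open>v (1 - v)\<close> arises by integrating by parts twice.
\<close>
definition trapezoid_remainder :: "nat \<Rightarrow> complex \<Rightarrow> complex" where
  "trapezoid_remainder n s = integral {0..1}
     (\<lambda>v. of_real (v * (1 - v)) * exp (- (s + 2) * of_real (ln (real (Suc n) + v))))"

lemma holomorphic_trapezoid_remainder: "trapezoid_remainder n holomorphic_on UNIV"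
proof -
  have "(\<lambda>s. integral (cbox 0 1) (\<lambda>v. of_real (v * (1 - v)) * exp (- (s + 2) * of_real (ln (real (Suc n) + v))))) holomorphic_on UNIV"
  proof (rule leibniz_rule_holomorphic)
    fix s :: complex and v :: real
    show "((\<lambda>s. of_real (v * (1 - v)) * exp (- (s + 2) * of_real (ln (real (Suc n) + v)))) has_field_derivative
      of_real (v * (1 - v)) * (exp (- (s + 2) * of_real (ln (real (Suc n) + v))) * (- of_real (ln (real (Suc n) + v))))) (at s within UNIV)"
      by (auto intro!: derivative_eq_intros)
  next
    fix s :: complex
    show "(\<lambda>v. of_real (v * (1 - v)) * exp (- (s + 2) * of_real (ln (real (Suc n) + v)))) integrable_on cbox 0 1"
      by (intro integrable_continuous continuous_intros) auto
  next
    show "continuous_on (UNIV \<times> cbox 0 1) (\<lambda>(s, v). of_real (v * (1 - v)) *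
      (exp (- (s + 2) * of_real (ln (real (Suc n) + v))) * (- of_real (ln (real (Suc n) + v)))) :: complex)"
      unfolding case_prod_unfold by (intro continuous_intros) auto
  qed auto
  thus ?thesis by (simp add: trapezoid_remainder_def[abs_def])
qed

lemma norm_trapezoid_remainder_le:
  assumes "Re s \<ge> -2"
  shows "norm (trapezoid_remainder n s) \<le> real (Suc n) powr (- (Re s + 2))"
proof -
  have "norm (integral {0..1} (\<lambda>v. of_real (v * (1 - v)) * exp (- (s + 2) * of_real (ln (real (Suc n) + v)))))
    \<le> integral {0..1} (\<lambda>v::real. real (Suc n) powr (- (Re s + 2)))"
  proof (rule integral_norm_bound_integral)
    fix v :: real assume v: "v \<in> {0..1}"
    have "norm (exp (- (s + 2) * of_real (ln (real (Suc n) + v)))) = exp (- (Re s + 2) * ln (real (Suc n) + v))"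
      by (simp add: norm_exp_eq_Re)
    also have "\<dots> \<le> exp (- (Re s + 2) * ln (real (Suc n)))"
      unfolding exp_le_cancel_iff using v assms by (intro mult_left_mono_neg) auto
    also have "\<dots> = real (Suc n) powr (- (Re s + 2))" by (simp add: powr_def)
    finally have 1: "norm (exp (- (s + 2) * of_real (ln (real (Suc n) + v)))) \<le> real (Suc n) powr (- (Re s + 2))" .
    have "v * (1 - v) \<le> 1 * 1" using v by (intro mult_mono) auto
    hence "norm (of_real (v * (1 - v)) :: complex) \<le> 1" using v by (simp only: norm_of_real) auto
    from mult_mono[OF this 1] show "norm (of_real (v * (1 - v)) * exp (- (s + 2) * of_real (ln (real (Suc n) + v))))
      \<le> real (Suc n) powr (- (Re s + 2))" by (simp only: norm_mult) simp
  qed (auto intro!: integrable_continuous_interval continuous_intros)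
  thus ?thesis by (simp add: trapezoid_remainder_def)
qed

lemma trapezoid_remainder_eq:
  fixes n :: nat and s :: complex
  assumes s: "s \<noteq> 1"
  defines "N \<equiv> of_nat (Suc n) :: complex"
  shows "s * (s + 1) / 2 * trapezoid_remainder n s =
     (N powr (- s) + (N + 1) powr (- s)) / 2 - ((N + 1) powr (1 - s) - N powr (1 - s)) / (1 - s)"
proof -
  define A where "A z = z * (1 - z) * (- s * (N + z) powr (- s - 1)) - (1 - 2 * z) * (N + z) powr (- s)
      - 2 * ((N + z) powr (1 - s) / (1 - s))" for z
  have ex: "exp (- (s + 2) * of_real (ln (real (Suc n) + v))) = (N + of_real v) powr (- s - 2)" if "v \<ge> 0" for v
  proof -
    have "N + of_real v = complex_of_real (real (Suc n) + v)" by (simp add: N_def)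
    moreover have "real (Suc n) + v > 0" using that by simp
    ultimately show ?thesis by (simp add: powr_def Ln_of_real algebra_simps del: of_real_add of_nat_Suc)
  qed
  have der: "(A has_field_derivative (z * (1 - z) * (s * (s + 1) * (N + z) powr (- s - 2)))) (at z)"
    if z: "z = of_real v" "v \<ge> 0" for z v
  proof -
    have np: "N + z \<notin> \<real>\<^sub>\<le>\<^sub>0" using z by (auto simp: N_def complex_nonpos_Reals_iff)
    have p: "((\<lambda>z. (N + z) powr w) has_field_derivative (w * (N + z) powr (w - 1))) (at z)" for w
      using np by (auto intro!: derivative_eq_intros)
    have c: "1 - s \<noteq> 0" using s by simp
    have "(A has_field_derivative
      (((1 * (1 - z) + (0 - 1) * z) * (- s * (N + z) powr (- s - 1)) + (- s * ((- s - 1) * (N + z) powr (- s - 1 - 1))) * (z * (1 - z)))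
       - ((0 - 2 * 1) * (N + z) powr (- s) + (- s * (N + z) powr (- s - 1)) * (1 - 2 * z))
       - 2 * ((1 - s) * (N + z) powr (1 - s - 1) / (1 - s)))) (at z)"
      unfolding A_def by (intro DERIV_diff DERIV_mult DERIV_cmult DERIV_cdivide p DERIV_ident DERIV_const)
    also have "((1 * (1 - z) + (0 - 1) * z) * (- s * (N + z) powr (- s - 1)) + (- s * ((- s - 1) * (N + z) powr (- s - 1 - 1))) * (z * (1 - z)))
       - ((0 - 2 * 1) * (N + z) powr (- s) + (- s * (N + z) powr (- s - 1)) * (1 - 2 * z))
       - 2 * ((1 - s) * (N + z) powr (1 - s - 1) / (1 - s)) = z * (1 - z) * (s * (s + 1) * (N + z) powr (- s - 2))"
    proof -
      have e: "- s - 1 - 1 = - s - 2" "1 - s - 1 = - s" by simp_all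
      have "2 * ((1 - s) * (N + z) powr (- s) / (1 - s)) = 2 * (N + z) powr (- s)" using c by simp
      thus ?thesis unfolding e by (simp add: algebra_simps)
    qed
    finally show ?thesis .
  qed
  have "((\<lambda>v. of_real v * (1 - of_real v) * (s * (s + 1) * (N + of_real v) powr (- s - 2))) has_integral
      (A (of_real 1) - A (of_real 0))) {0..1}"
  proof (rule fundamental_theorem_of_calculus)
    fix v :: real assume "v \<in> {0..1}"
    hence "v \<ge> 0" by simp
    from has_vector_derivative_real_field[OF der[OF refl this]]
    show "((\<lambda>v. A (of_real v)) has_vector_derivative of_real v * (1 - of_real v) *
      (s * (s + 1) * (N + of_real v) powr (- s - 2))) (at v within {0..1})" .
  qed simp
  hence "((\<lambda>v. (s * (s + 1)) * (of_real (v * (1 - v)) * exp (- (s + 2) * of_real (ln (real (Suc n) + v))))) has_integral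
      (A 1 - A 0)) {0..1}"
  proof (rule has_integral_eq_rhs[OF has_integral_eq[rotated]])
    fix v :: real assume "v \<in> {0..1}"
    hence "v \<ge> 0" by simp
    show "of_real v * (1 - of_real v) * (s * (s + 1) * (N + of_real v) powr (- s - 2)) =
      s * (s + 1) * (of_real (v * (1 - v)) * exp (- (s + 2) * of_real (ln (real (Suc n) + v))))"
      unfolding ex[OF \<open>v \<ge> 0\<close>] by (simp only: of_real_mult of_real_diff of_real_1 mult_ac)
  qed simp
  hence "integral {0..1} (\<lambda>v. (s * (s + 1)) * (of_real (v * (1 - v)) * exp (- (s + 2) * of_real (ln (real (Suc n) + v))))) = A 1 - A 0"
    by (rule integral_unique)
  hence "(s * (s + 1)) * trapezoid_remainder n s = A 1 - A 0"
    by (simp add: trapezoid_remainder_def)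
  moreover have "A 1 - A 0 = N powr (- s) + (N + 1) powr (- s) - 2 * (((N + 1) powr (1 - s) - N powr (1 - s)) / (1 - s))"
    by (simp add: A_def diff_divide_distrib algebra_simps)
  ultimately have *: "(s * (s + 1)) * trapezoid_remainder n s =
      N powr (- s) + (N + 1) powr (- s) - 2 * (((N + 1) powr (1 - s) - N powr (1 - s)) / (1 - s))"
    by (simp only:)
  have "s * (s + 1) / 2 * trapezoid_remainder n s = ((s * (s + 1)) * trapezoid_remainder n s) / 2" by simp
  moreover have "(X - 2 * Y) / 2 = X / 2 - Y" for X Y :: complex by (simp add: diff_divide_distrib)
  ultimately show ?thesis unfolding * by (simp only:)
qed

text \<open>
  Comparing the zeta series with an integral by the trapezoidal rule gives this expression, which
  retains a meaning for \<open>Re s > -1\<close>.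
\<close>
definition zeta_right :: "complex \<Rightarrow> complex" where
  "zeta_right s = 1 / (s - 1) + 1 / 2 + s * (s + 1) / 2 * (\<Sum>n. trapezoid_remainder n s)"

lemma summable_trapezoid_remainder: "Re s > -1 \<Longrightarrow> summable (\<lambda>n. trapezoid_remainder n s)"
  by (rule summable_comparison_test'[OF summable_Suc_powr[of "- (Re s + 2)"], of 0])
     (simp, rule norm_trapezoid_remainder_le, simp)

lemma holomorphic_sum_trapezoid_remainder:
  "(\<lambda>s. \<Sum>n. trapezoid_remainder n s) holomorphic_on {s. Re s > -1}"
proof (rule holomorphic_uniform_sequence)
  show "open {s. Re s > -1}" by (rule open_halfspace_Re_gt)
  show "(\<lambda>s. \<Sum>k<n. trapezoid_remainder k s) holomorphic_on {s. Re s > -1}" for n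
    by (intro holomorphic_on_sum holomorphic_on_subset[OF holomorphic_trapezoid_remainder]) auto
  fix s0 assume s0: "s0 \<in> {s. Re s > -1}"
  define r where "r = (Re s0 + 1) / 2"
  have r: "r > 0" using s0 by (simp add: r_def)
  have Re: "Re s \<ge> r - 1" if "s \<in> cball s0 r" for s
  proof -
    have "\<bar>Re (s0 - s)\<bar> \<le> r" using that abs_Re_le_cmod[of "s0 - s"] by (simp add: dist_norm)
    hence "Re s0 - Re s \<le> r" by simp
    thus ?thesis unfolding r_def by (simp add: field_simps)
  qed
  have "uniform_limit (cball s0 r) (\<lambda>n s. \<Sum>k<n. trapezoid_remainder k s) (\<lambda>s. \<Sum>k. trapezoid_remainder k s) sequentially"
  proof (rule Weierstrass_m_test)
    fix n s assume s: "s \<in> cball s0 r"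
    have "norm (trapezoid_remainder n s) \<le> real (Suc n) powr (- (Re s + 2))"
      using Re[OF s] r by (intro norm_trapezoid_remainder_le) auto
    also have "\<dots> \<le> real (Suc n) powr (- (r + 1))"
      using Re[OF s] by (intro powr_mono) auto
    finally show "norm (trapezoid_remainder n s) \<le> real (Suc n) powr (- (r + 1))" .
  qed (use summable_Suc_powr[of "- (r + 1)"] r in simp)
  moreover have "cball s0 r \<subseteq> {s. Re s > -1}" using Re r by force
  ultimately show "\<exists>d>0. cball s0 d \<subseteq> {s. Re s > -1} \<and>
     uniform_limit (cball s0 d) (\<lambda>n s. \<Sum>k<n. trapezoid_remainder k s) (\<lambda>s. \<Sum>k. trapezoid_remainder k s) sequentially"
    using r by blast
qed

lemma holomorphic_zeta_right: "zeta_right holomorphic_on {s. Re s > -1} - {1}"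
  unfolding zeta_right_def
  by (intro holomorphic_intros holomorphic_on_subset[OF holomorphic_sum_trapezoid_remainder]) auto

lemma tendsto_of_nat_powr_0:
  assumes "Re w < 0"
  shows "(\<lambda>n. of_nat (Suc n) powr w :: complex) \<longlonglongrightarrow> 0"
proof (rule tendsto_norm_zero_cancel)
  have "(\<lambda>n. real n powr Re w) \<longlonglongrightarrow> 0"
    using assms by (intro tendsto_neg_powr filterlim_real_sequentially) auto
  hence "(\<lambda>n. real (Suc n) powr Re w) \<longlonglongrightarrow> 0" by (rule LIMSEQ_Suc)
  thus "(\<lambda>n. norm (of_nat (Suc n) powr w :: complex)) \<longlonglongrightarrow> 0"
    by (simp add: norm_powr_real_powr)
qed

text \<open>
  The integrals in the trapezoidal errors telescope, which is where the pole comes from.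
\<close>
lemma zeta_right_sums:
  assumes s: "Re s > 1"
  shows "(\<lambda>n. 1 / of_nat (Suc n) powr s) sums zeta_right s"
proof -
  have s1: "s \<noteq> 1" using s by auto
  define N :: "nat \<Rightarrow> complex" where "N n = of_nat (Suc n)" for n
  define R where "R n = s * (s + 1) / 2 * trapezoid_remainder n s" for n
  have R: "R n = (N n powr (- s) + N (Suc n) powr (- s)) / 2 - (N (Suc n) powr (1 - s) - N n powr (1 - s)) / (1 - s)" for n
    using trapezoid_remainder_eq[OF s1, of n] by (simp add: R_def N_def add_ac)
  have partial: "(\<Sum>n<M. N n powr (- s)) =
      (\<Sum>n<M. R n) + 1 / 2 - N M powr (- s) / 2 + (N M powr (1 - s) - 1) / (1 - s)" for M
  proof (induction M)
    case (Suc M)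
    have "(\<Sum>n<Suc M. N n powr (- s)) = (\<Sum>n<M. R n) + 1 / 2 + N M powr (- s) / 2 + (N M powr (1 - s) - 1) / (1 - s)"
      unfolding sum.lessThan_Suc Suc by (simp add: field_simps)
    also have "\<dots> = (\<Sum>n<Suc M. R n) + 1 / 2 - N (Suc M) powr (- s) / 2 + (N (Suc M) powr (1 - s) - 1) / (1 - s)"
      unfolding sum.lessThan_Suc R by (simp add: diff_divide_distrib add_divide_distrib)
    finally show ?case .
  qed (simp add: N_def)
  have "(\<lambda>M. (\<Sum>n<M. R n) + 1 / 2 - N M powr (- s) / 2 + (N M powr (1 - s) - 1) / (1 - s)) \<longlonglongrightarrow>
     (\<Sum>n. R n) + 1 / 2 - 0 / 2 + (0 - 1) / (1 - s)"
    unfolding N_def using s s1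
    by (intro tendsto_intros tendsto_of_nat_powr_0 summable_LIMSEQ)
       (auto simp: R_def intro!: summable_mult summable_trapezoid_remainder)
  moreover have "(\<Sum>n. R n) = s * (s + 1) / 2 * (\<Sum>n. trapezoid_remainder n s)"
    unfolding R_def using s by (intro suminf_mult summable_trapezoid_remainder) auto
  moreover have "(0 - 1) / (1 - s) = 1 / (s - 1)" using s1 by (simp add: field_simps)
  ultimately have "(\<lambda>M. (\<Sum>n<M. N n powr (- s))) \<longlonglongrightarrow>
      s * (s + 1) / 2 * (\<Sum>n. trapezoid_remainder n s) + 1 / 2 - 0 / 2 + 1 / (s - 1)"
    unfolding partial by (simp only:)
  also have "s * (s + 1) / 2 * (\<Sum>n. trapezoid_remainder n s) + 1 / 2 - 0 / 2 + 1 / (s - 1) = zeta_right s"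
    by (simp add: zeta_right_def)
  finally have "(\<lambda>M. (\<Sum>n<M. N n powr (- s))) \<longlonglongrightarrow> zeta_right s" .
  thus ?thesis by (simp add: sums_def N_def powr_minus inverse_eq_divide)
qed

lemma of_nat_powr_of_real: "n > 0 \<Longrightarrow> (of_nat n :: complex) powr of_real x = of_real (real n powr x)"
  using powr_of_real[of "real n" x] by simp

text \<open>
  At \<open>s = -a\<close> the remainders are the errors summed in \<open>trapezoid_powr_sums\<close>, except for the interval
  \<open>[0, 1]\<close>; the error there accounts for \<open>1 / (s - 1) + 1 / 2\<close>.
\<close>
lemma zeta_right_of_neg_real:
  fixes a :: real
  assumes a: "0 < a" "a < 1"
  shows "zeta_right (of_real (- a)) = - of_real
    (a / Gamma (1 - a) * (pi / cos (pi * a / 2) * (2 * pi) powr (- a - 1) * (\<Sum>k. real (Suc k) powr (- a - 1))))"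
    (is "_ = - of_real ?S")
proof -
  define D where "D n = ((real n + 1) powr (a + 1) - real n powr (a + 1)) / (a + 1) - (real n powr a + (real n + 1) powr a) / 2" for n :: nat
  let ?s = "complex_of_real (- a)"
  have s1: "?s \<noteq> 1" using a by (simp only: of_real_eq_1_iff)
  have "D sums ?S" using trapezoid_powr_sums[OF a] unfolding D_def .
  hence "(\<lambda>n. D (Suc n)) sums (?S - D 0)"
    using sums_split_initial_segment[of D ?S 1] by simp
  hence "(\<lambda>n. complex_of_real (- D (Suc n))) sums (of_real (- (?S - D 0)))"
    unfolding sums_of_real_iff by (rule sums_minus)
  moreover have "complex_of_real (- D (Suc n)) = ?s * (?s + 1) / 2 * trapezoid_remainder n ?s" for n
  proof -
    define N where "N = real (Suc n)"
    have N: "N > 0" by (simp add: N_def)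
    have p: "complex_of_real N powr of_real x = of_real (N powr x)"
      "(complex_of_real N + 1) powr of_real x = of_real ((N + 1) powr x)" for x
      using powr_of_real[of N x] powr_of_real[of "N + 1" x] N by simp_all
    have e: "- ?s = of_real a" "1 - ?s = of_real (a + 1)" by simp_all
    have "?s * (?s + 1) / 2 * trapezoid_remainder n ?s =
      (of_real N powr (- ?s) + (of_real N + 1) powr (- ?s)) / 2 -
      ((of_real N + 1) powr (1 - ?s) - of_real N powr (1 - ?s)) / (1 - ?s)"
      using trapezoid_remainder_eq[OF s1, of n] by (simp add: N_def)
    also have "\<dots> = of_real ((N powr a + (N + 1) powr a) / 2 - ((N + 1) powr (a + 1) - N powr (a + 1)) / (a + 1))"
      unfolding e p by simp
    also have "\<dots> = of_real (- D (Suc n))" by (simp add: D_def N_def)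
    finally show ?thesis ..
  qed
  ultimately have "(\<lambda>n. ?s * (?s + 1) / 2 * trapezoid_remainder n ?s) sums (of_real (- (?S - D 0)))"
    by (simp only:)
  moreover have "(\<lambda>n. ?s * (?s + 1) / 2 * trapezoid_remainder n ?s) sums (?s * (?s + 1) / 2 * (\<Sum>n. trapezoid_remainder n ?s))"
    using a by (intro sums_mult summable_sums summable_trapezoid_remainder) auto
  ultimately have "?s * (?s + 1) / 2 * (\<Sum>n. trapezoid_remainder n ?s) = of_real (- (?S - D 0))"
    using sums_unique2 by blast
  hence "zeta_right ?s = of_real (1 / (- a - 1) + 1 / 2 + - (?S - D 0))"
    by (simp add: zeta_right_def)
  also have "1 / (- a - 1) + 1 / 2 + - (?S - D 0) = - ?S"
    using a by (simp add: D_def divide_simps) (simp add: algebra_simps)?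
  finally show ?thesis by simp
qed

lemma zeta_right_functional_equation_real:
  fixes a :: real
  assumes a: "0 < a" "a < 1"
  defines "s \<equiv> complex_of_real (- a)"
  shows "2 * cos (of_real pi * s / 2) * zeta_right s = of_real (2 * pi) powr s * rGamma s * zeta_right (1 - s)"
proof -
  define Z where "Z = (\<Sum>k. real (Suc k) powr (- a - 1))"
  have Z: "zeta_right (1 - s) = of_real Z"
  proof -
    have "(\<lambda>n. 1 / of_nat (Suc n) powr (1 - s)) sums zeta_right (1 - s)"
      using a by (intro zeta_right_sums) (simp add: s_def)
    moreover have "(\<lambda>n. complex_of_real (real (Suc n) powr (- a - 1))) sums of_real Z"
      unfolding sums_of_real_iff Z_def using a by (intro summable_sums summable_Suc_powr) auto
    moreover have "1 / of_nat (Suc n) powr (1 - s) = complex_of_real (real (Suc n) powr (- a - 1))" for n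
    proof -
      have "1 - s = of_real (a + 1)" by (simp add: s_def)
      hence "of_nat (Suc n) powr (1 - s) = complex_of_real (real (Suc n) powr (a + 1))"
        using of_nat_powr_of_real[of "Suc n" "a + 1"] by (simp only:)
      moreover have "real (Suc n) powr (- a - 1) = 1 / real (Suc n) powr (a + 1)"
        using powr_minus_divide[of "real (Suc n)" "a + 1"] by simp
      ultimately show ?thesis by (simp only: of_real_divide of_real_1)
    qed
    ultimately show ?thesis using sums_unique2 by simp
  qed
  have c: "cos (pi * a / 2) > 0" using a by (intro cos_gt_zero) auto
  have g: "Gamma (1 - a) > 0" using a by (intro Gamma_real_pos) auto
  have rg: "rGamma s = of_real (- a / Gamma (1 - a))"
  proof -
    have "rGamma s = complex_of_real (rGamma (- a))" unfolding s_def rGamma_complex_of_real ..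
    also have "rGamma (- a) = - a * rGamma (1 - a)"
      using rGamma_plus1[of "- a"] by (simp add: add.commute)
    finally show ?thesis by (simp add: rGamma_inverse_Gamma divide_inverse)
  qed
  have p: "of_real (2 * pi) powr s = complex_of_real ((2 * pi) powr - a)"
    unfolding s_def by (rule powr_of_real) auto
  have co: "cos (of_real pi * s / 2) = complex_of_real (cos (pi * a / 2))"
  proof -
    have "of_real pi * s / 2 = complex_of_real (- (pi * a / 2))" by (simp add: s_def)
    thus ?thesis by (simp only: cos_of_real cos_minus)
  qed
  have zs: "zeta_right s = of_real (- (a / Gamma (1 - a) * (pi / cos (pi * a / 2) * (2 * pi) powr (- a - 1) * Z)))"
    using zeta_right_of_neg_real[OF a] by (simp add: s_def Z_def)
  have pw: "(2 * pi) powr (- a - 1) = (2 * pi) powr (- a) / (2 * pi)"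
    by (simp add: powr_diff)
  have "2 * cos (pi * a / 2) * (- (a / Gamma (1 - a) * (pi / cos (pi * a / 2) * (2 * pi) powr (- a - 1) * Z)))
      = (2 * pi) powr - a * (- a / Gamma (1 - a)) * Z"
    unfolding pw using c g by (simp add: field_simps)
  hence "complex_of_real (2 * cos (pi * a / 2) * (- (a / Gamma (1 - a) * (pi / cos (pi * a / 2) * (2 * pi) powr (- a - 1) * Z))))
      = of_real ((2 * pi) powr - a * (- a / Gamma (1 - a)) * Z)" by (simp only:)
  thus ?thesis unfolding Z rg p co zs by (simp only: of_real_mult of_real_numeral)
qed

lemma holomorphic_zeta_right_reflected:
  assumes "\<And>s. s \<in> S \<Longrightarrow> Re s < 2 \<and> s \<noteq> 0"
  shows "(\<lambda>s. zeta_right (1 - s)) holomorphic_on S"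
proof -
  have "zeta_right holomorphic_on (\<lambda>s. 1 - s) ` S"
    by (rule holomorphic_on_subset[OF holomorphic_zeta_right]) (use assms in auto)
  moreover have "(\<lambda>s. 1 - s) holomorphic_on S" by (intro holomorphic_intros)
  ultimately show ?thesis using holomorphic_on_compose by (fastforce simp: o_def)
qed

text \<open>
  Both sides are holomorphic in the punctured strip and agree on the real interval from \<open>-1\<close> to \<open>0\<close>.
\<close>
lemma zeta_right_functional_equation:
  assumes s: "-1 < Re s" "Re s < 2" "s \<noteq> 0" "s \<noteq> 1"
  shows "2 * cos (of_real pi * s / 2) * zeta_right s = of_real (2 * pi) powr s * rGamma s * zeta_right (1 - s)"
proof -
  define S where "S = {s. -1 < Re s \<and> Re s < 2} - {0, 1 :: complex}"
  define f where "f s = 2 * cos (of_real pi * s / 2) * zeta_right s - of_real (2 * pi) powr s * rGamma s * zeta_right (1 - s)" for s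
  have op: "open {s. -1 < Re s \<and> Re s < 2}"
    using open_Int[OF open_halfspace_Re_gt[of "-1"] open_halfspace_Re_lt[of 2]] by (simp add: Int_def)
  have cv: "convex {s. -1 < Re s \<and> Re s < 2}"
    using convex_Int[OF convex_halfspace_Re_gt[of "-1"] convex_halfspace_Re_lt[of 2]] by (simp add: Int_def)
  have "f s = 0"
  proof (rule analytic_continuation[of f S "{z. \<exists>a. 0 < a \<and> a < 1 \<and> z = of_real (- a)}" "of_real (- 1 / 2)"])
    have "(\<lambda>s. zeta_right (1 - s)) holomorphic_on S"
      by (rule holomorphic_zeta_right_reflected) (auto simp: S_def)
    moreover have "zeta_right holomorphic_on S"
      by (rule holomorphic_on_subset[OF holomorphic_zeta_right]) (auto simp: S_def)
    ultimately show "f holomorphic_on S" unfolding f_def by (intro holomorphic_intros) auto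
    show "open S" unfolding S_def by (intro open_Diff op) auto
    show "connected S" unfolding S_def
      by (rule connected_open_delete_finite[OF op]) (auto intro: convex_connected cv)
    show "{z. \<exists>a. 0 < a \<and> a < 1 \<and> z = of_real (- a)} \<subseteq> S" by (auto simp: S_def complex_eq_iff)
    show "of_real (- 1 / 2) \<in> S" by (auto simp: S_def complex_eq_iff)
    show "of_real (- 1 / 2) islimpt {z. \<exists>a. 0 < a \<and> a < 1 \<and> z = complex_of_real (- a)}"
      unfolding islimpt_approachable
    proof (intro allI impI)
      fix e :: real assume e: "e > 0"
      define h where "h = min (e / 2) (1 / 4)"
      have h: "0 < h" "h \<le> 1 / 4" "h < e" using e by (auto simp: h_def)
      show "\<exists>x'\<in>{z. \<exists>a. 0 < a \<and> a < 1 \<and> z = complex_of_real (- a)}. x' \<noteq> of_real (- 1 / 2) \<and> dist x' (of_real (- 1 / 2)) < e"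
      proof (intro bexI conjI)
        show "complex_of_real (- (1 / 2 + h)) \<noteq> of_real (- 1 / 2)" using h by (simp only: of_real_eq_iff)
        have "dist (complex_of_real (- (1 / 2 + h))) (of_real (- 1 / 2)) = \<bar>- (1 / 2 + h) - (- 1 / 2)\<bar>"
          by (simp only: dist_of_real dist_real_def)
        thus "dist (complex_of_real (- (1 / 2 + h))) (of_real (- 1 / 2)) < e" using h by simp
        show "complex_of_real (- (1 / 2 + h)) \<in> {z. \<exists>a. 0 < a \<and> a < 1 \<and> z = complex_of_real (- a)}"
          using h by (intro CollectI exI[of _ "1 / 2 + h"]) auto
      qed
    qed
    show "f z = 0" if "z \<in> {z. \<exists>a. 0 < a \<and> a < 1 \<and> z = complex_of_real (- a)}" for z
      using that zeta_right_functional_equation_real by (auto simp: f_def)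
    show "s \<in> S" using s by (auto simp: S_def)
  qed
  thus ?thesis by (simp add: f_def)
qed

text \<open>
  The functional equation, read as a formula for the values left of the imaginary axis.
\<close>
definition zeta_left :: "complex \<Rightarrow> complex" where
  "zeta_left s = 2 * cos (of_real pi * (1 - s) / 2) * Gamma (1 - s) * of_real (2 * pi) powr (s - 1) * zeta_right (1 - s)"

lemma holomorphic_zeta_left: "zeta_left holomorphic_on {s. Re s < 0}"
proof -
  have "(\<lambda>s. zeta_right (1 - s)) holomorphic_on {s. Re s < 0}"
    by (rule holomorphic_zeta_right_reflected) auto
  moreover have "(\<lambda>s. Gamma (1 - s)) holomorphic_on {s. Re s < 0}"
  proof (intro holomorphic_intros)
    fix z :: complex assume z: "z \<in> {s. Re s < 0}"
    show "1 - z \<notin> \<int>\<^sub>\<le>\<^sub>0"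
    proof
      assume "1 - z \<in> \<int>\<^sub>\<le>\<^sub>0"
      then obtain n where n: "1 - z = of_int n" "n \<le> 0" by (elim nonpos_Ints_cases)
      hence "Re (1 - z) = of_int n" by simp
      thus False using z n(2) by simp
    qed
  qed
  moreover have "(\<lambda>s. cos (of_real pi * (1 - s) / 2)) holomorphic_on {s. Re s < 0}"
      "(\<lambda>s. of_real (2 * pi) powr (s - 1)) holomorphic_on {s. Re s < 0}"
    by (intro holomorphic_intros; simp)+
  ultimately show ?thesis unfolding zeta_left_def by (intro holomorphic_on_mult holomorphic_on_const)
qed

lemma zeta_left_eq_zeta_right:
  assumes "-1 < Re s" "Re s < 0"
  shows "zeta_left s = zeta_right s"
proof -
  define w where "w = 1 - s"
  have w: "Re w > 1" "Re w < 2" "w \<noteq> 0" "w \<noteq> 1" "1 - w = s" using assms by (auto simp: w_def)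
  have "w \<notin> \<int>\<^sub>\<le>\<^sub>0" using w(1) by (auto elim!: nonpos_Ints_cases)
  hence g: "rGamma w * Gamma w = 1" by (simp add: rGamma_inverse_Gamma Gamma_eq_zero_iff)
  have p: "of_real (2 * pi) powr w * of_real (2 * pi) powr (s - 1) = (1::complex)"
    by (simp add: w_def flip: powr_add)
  have "zeta_left s = (2 * cos (of_real pi * w / 2) * zeta_right w) * Gamma w * of_real (2 * pi) powr (s - 1)"
    by (simp add: zeta_left_def w_def mult_ac)
  also have "2 * cos (of_real pi * w / 2) * zeta_right w = of_real (2 * pi) powr w * rGamma w * zeta_right s"
    using zeta_right_functional_equation[of w] w by simp
  also have "of_real (2 * pi) powr w * rGamma w * zeta_right s * Gamma w * of_real (2 * pi) powr (s - 1)
     = (of_real (2 * pi) powr w * of_real (2 * pi) powr (s - 1)) * (rGamma w * Gamma w) * zeta_right s"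
    by (simp only: mult_ac)
  finally show ?thesis unfolding p g by simp
qed

lemma riemann_zeta_unique:
  fixes f g :: "complex \<Rightarrow> complex"
  assumes f: "f holomorphic_on (- {1})" "\<And>s. Re s > 1 \<Longrightarrow> (\<lambda>n. 1 / of_nat (Suc n) powr s) sums f s" "f 1 = 0"
    and g: "g holomorphic_on (- {1})" "\<And>s. Re s > 1 \<Longrightarrow> (\<lambda>n. 1 / of_nat (Suc n) powr s) sums g s" "g 1 = 0"
  shows "f = g"
proof
  fix s show "f s = g s"
  proof (cases "s = 1")
    case False
    show ?thesis
    proof (rule analytic_continuation_open[where f = f and g = g and z = s and s = "{s. Re s > 1}" and s' = "- {1}"])
      show "{s. Re s > 1} \<noteq> {}" by (auto intro!: exI[of _ 2])
      show "connected (- {1 :: complex})" by (rule connected_punctured_universe) auto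
      show "f z = g z" if "z \<in> {s. Re s > 1}" for z
        using sums_unique2[OF f(2) g(2)] that by auto
    qed (use f g False in \<open>auto intro: open_halfspace_Re_gt\<close>)
  qed (use f g in auto)
qed

text \<open>
  The functions \<open>zeta_right\<close> and \<open>zeta_left\<close> agree on a common strip and together have the properties
  that characterise \<open>riemann_zeta\<close>; only one function has them, by the identity theorem.
\<close>
lemma riemann_zeta_spec:
  "riemann_zeta holomorphic_on (- {1}) \<and>
    (\<forall>s. Re s > 1 \<longrightarrow> (\<lambda>n. 1 / of_nat (Suc n) powr s) sums riemann_zeta s) \<and> riemann_zeta 1 = 0"
  (is "?P riemann_zeta")
  and riemann_zeta_eq_zeta_right: "Re s > -1 \<Longrightarrow> s \<noteq> 1 \<Longrightarrow> riemann_zeta s = zeta_right s"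
proof -
  define Z where "Z s = (if s = 1 then 0 else if Re s > -1 then zeta_right s else zeta_left s)" for s
  have ZR: "Z s = zeta_right s" if "Re s > -1" "s \<noteq> 1" for s using that by (simp add: Z_def)
  have ZL: "Z s = zeta_left s" if "Re s < 0" for s
    using that zeta_left_eq_zeta_right[of s] by (auto simp: Z_def)
  have "Z holomorphic_on ({s. Re s > -1} - {1}) \<union> {s. Re s < 0}"
  proof (rule holomorphic_on_Un)
    show "Z holomorphic_on {s. Re s > -1} - {1}"
      by (rule holomorphic_transform[OF holomorphic_zeta_right]) (auto simp: ZR)
    show "Z holomorphic_on {s. Re s < 0}"
      by (rule holomorphic_transform[OF holomorphic_zeta_left]) (auto simp: ZL)
  qed (auto intro!: open_Diff open_halfspace_Re_gt open_halfspace_Re_lt)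
  moreover have "({s. Re s > -1} - {1}) \<union> {s. Re s < 0} = - {1}" by auto
  moreover have "Z s = zeta_right s" if "Re s > 1" for s using that by (intro ZR) auto
  ultimately have Z: "?P Z" using zeta_right_sums by (simp add: Z_def[of 1])
  have "riemann_zeta = Z"
    unfolding riemann_zeta_def
  proof (rule the_equality)
    show "?P Z" by (rule Z)
  next
    fix f assume "?P f"
    thus "f = Z" using Z by (intro riemann_zeta_unique) auto
  qed
  thus "?P riemann_zeta" "Re s > -1 \<Longrightarrow> s \<noteq> 1 \<Longrightarrow> riemann_zeta s = zeta_right s"
    using Z ZR by auto
qed

lemma holomorphic_riemann_zeta: "riemann_zeta holomorphic_on (- {1})"
  and riemann_zeta_sums: "Re s > 1 \<Longrightarrow> (\<lambda>n. 1 / of_nat (Suc n) powr s) sums riemann_zeta s"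
  using riemann_zeta_spec by auto

lemma riemann_zeta_functional_equation:
  assumes s: "0 < Re s" "Re s < 1"
  shows "2 * cos (of_real pi * s / 2) * riemann_zeta s = of_real (2 * pi) powr s * rGamma s * riemann_zeta (1 - s)"
proof -
  have "s \<noteq> 0" "s \<noteq> 1" "1 - s \<noteq> 1" using s by auto
  thus ?thesis
    using zeta_right_functional_equation[of s] riemann_zeta_eq_zeta_right[of s]
      riemann_zeta_eq_zeta_right[of "1 - s"] s by simp
qed

lemma holomorphic_on_cnj_cnj:
  assumes "f holomorphic_on S" "open S" "\<And>z. z \<in> S \<Longrightarrow> cnj z \<in> S"
  shows "(\<lambda>z. cnj (f (cnj z))) holomorphic_on S"
proof -
  have "\<exists>f'. ((\<lambda>z. cnj (f (cnj z))) has_field_derivative f') (at z)" if z: "z \<in> S" for z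
  proof -
    obtain f' where "(f has_field_derivative f') (at (cnj z))"
      using assms z by (metis holomorphic_on_open)
    hence "((cnj \<circ> f \<circ> cnj) has_field_derivative cnj f') (at z)"
      using has_field_derivative_cnj_cnj[of f f' z] by simp
    thus ?thesis by (auto simp: o_def)
  qed
  thus ?thesis using assms(2) by (simp add: holomorphic_on_open)
qed

lemma cnj_of_nat_powr: "cnj (of_nat (Suc n) powr s) = of_nat (Suc n) powr cnj s"
  by (simp add: cnj_powr complex_nonneg_Reals_iff)

lemma riemann_zeta_cnj: "riemann_zeta (cnj s) = cnj (riemann_zeta s)"
proof -
  have "(\<lambda>s. cnj (riemann_zeta (cnj s))) = riemann_zeta"
  proof (rule riemann_zeta_unique)
    show "(\<lambda>s. cnj (riemann_zeta (cnj s))) holomorphic_on - {1}"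
      by (rule holomorphic_on_cnj_cnj[OF holomorphic_riemann_zeta]) (auto simp: complex_eq_iff)
    fix s :: complex assume "Re s > 1"
    hence "(\<lambda>n. 1 / of_nat (Suc n) powr cnj s) sums riemann_zeta (cnj s)" by (intro riemann_zeta_sums) simp
    hence "(\<lambda>n. cnj (1 / of_nat (Suc n) powr cnj s)) sums cnj (riemann_zeta (cnj s))"
      by (subst sums_cnj)
    thus "(\<lambda>n. 1 / of_nat (Suc n) powr s) sums cnj (riemann_zeta (cnj s))"
      by (simp add: cnj_of_nat_powr del: of_nat_Suc)
  qed (use riemann_zeta_spec in auto)
  thus ?thesis by (metis complex_cnj_cnj)
qed

lemma riemann_zeta_real: "riemann_zeta (of_real x) = of_real (Re (riemann_zeta (of_real x)))"
  using riemann_zeta_cnj[of "of_real x"] by (simp add: complex_eq_iff)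

lemma riemann_zeta_pole: "((\<lambda>s. (s - 1) * riemann_zeta s) \<longlongrightarrow> 1) (at 1)"
proof -
  define E where "E s = (s - 1) * (1 / 2 + s * (s + 1) / 2 * (\<Sum>n. trapezoid_remainder n s))" for s
  have "(\<lambda>s. 1 + E s) holomorphic_on {s. Re s > -1}"
    unfolding E_def by (intro holomorphic_intros holomorphic_sum_trapezoid_remainder) auto
  hence "continuous_on {s. Re s > -1} (\<lambda>s. 1 + E s)" by (rule holomorphic_on_imp_continuous_on)
  hence "isCont (\<lambda>s. 1 + E s) 1"
    by (rule continuous_on_interior) (simp add: interior_open open_halfspace_Re_gt)
  hence "((\<lambda>s. 1 + E s) \<longlongrightarrow> 1) (at 1)" by (simp add: isCont_def E_def)
  moreover have "\<forall>\<^sub>F s in at 1. 1 + E s = (s - 1) * riemann_zeta s"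
  proof -
    have "\<forall>\<^sub>F s in at 1. s \<in> {s. Re s > -1} - {1::complex}"
      by (rule eventually_at_in_open) (auto intro: open_halfspace_Re_gt)
    thus ?thesis
    proof eventually_elim
      case (elim s)
      thus ?case by (simp add: riemann_zeta_eq_zeta_right zeta_right_def E_def field_simps)
    qed
  qed
  ultimately show ?thesis by (rule Lim_transform_eventually)
qed

text \<open>
  In the expansion that defines \<open>zeta_right\<close> only the factor \<open>s (s + 1)\<close> grows.
\<close>
lemma norm_riemann_zeta_le:
  assumes "Re s \<ge> 1 / 2" "\<bar>Im s\<bar> \<ge> 1"
  shows "norm (riemann_zeta s) \<le> (3 + (\<Sum>n. real (Suc n) powr (- (5 / 2)))) * norm s ^ 2"
proof -
  let ?C = "\<Sum>n. real (Suc n) powr (- (5 / 2))"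
  have s1: "s \<noteq> 1" using assms by auto
  have ns: "norm s \<ge> 1" using assms abs_Im_le_cmod[of s] by linarith
  have sumC: "summable (\<lambda>n. real (Suc n) powr (- (5 / 2)))" by (intro summable_Suc_powr) auto
  have C0: "?C \<ge> 0" by (intro suminf_nonneg sumC) auto
  have "norm (trapezoid_remainder n s) \<le> real (Suc n) powr (- (5 / 2))" for n
  proof -
    have "norm (trapezoid_remainder n s) \<le> real (Suc n) powr (- (Re s + 2))"
      using assms by (intro norm_trapezoid_remainder_le) auto
    also have "\<dots> \<le> real (Suc n) powr (- (5 / 2))" using assms by (intro powr_mono) auto
    finally show ?thesis .
  qed
  hence "norm (\<Sum>n. trapezoid_remainder n s) \<le> ?C"
    by (intro norm_suminf_le sumC)
  moreover have "norm s * norm (s + 1) \<le> norm s * (norm s + 1)"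
    using norm_triangle_ineq[of s 1] by (intro mult_left_mono) auto
  ultimately have "norm s * norm (s + 1) / 2 * norm (\<Sum>n. trapezoid_remainder n s) \<le> norm s * (norm s + 1) / 2 * ?C"
    by (rule_tac mult_mono[OF divide_right_mono]) auto
  hence "norm (s * (s + 1) / 2 * (\<Sum>n. trapezoid_remainder n s)) \<le> norm s * (norm s + 1) / 2 * ?C"
    by (simp only: norm_mult norm_divide norm_numeral)
  also have "\<dots> \<le> norm s * (norm s + norm s) / 2 * ?C"
    using ns C0 by (intro mult_right_mono divide_right_mono mult_left_mono add_mono) auto
  also have "\<dots> = ?C * norm s ^ 2" by (simp add: power2_eq_square)
  finally have 1: "norm (s * (s + 1) / 2 * (\<Sum>n. trapezoid_remainder n s)) \<le> ?C * norm s ^ 2" .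
  have "norm (s - 1) \<ge> 1" using assms abs_Im_le_cmod[of "s - 1"] by simp
  hence 2: "norm (1 / (s - 1)) \<le> 1" by (simp add: norm_divide divide_le_eq)
  have 3: "1 \<le> norm s ^ 2" using ns by simp
  have "riemann_zeta s = 1 / (s - 1) + 1 / 2 + s * (s + 1) / 2 * (\<Sum>n. trapezoid_remainder n s)"
    using riemann_zeta_eq_zeta_right[of s] assms s1 by (simp add: zeta_right_def)
  hence "norm (riemann_zeta s) \<le> norm (1 / (s - 1)) + norm (1 / 2 :: complex) + norm (s * (s + 1) / 2 * (\<Sum>n. trapezoid_remainder n s))"
    by (metis (no_types, lifting) norm_triangle_le norm_triangle_ineq add_mono order_refl)
  also have "\<dots> \<le> 1 + 1 / 2 + ?C * norm s ^ 2" using 1 2 by (intro add_mono) (auto simp: norm_divide)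
  also have "\<dots> \<le> (3 + ?C) * norm s ^ 2" using 3 by (simp add: algebra_simps)
  finally show ?thesis .
qed

section \<open>The size of the zeta function on both sides of the critical line\<close>

text \<open>
  The logarithm \<open>ln (y\<^sup>2 + t\<^sup>2) - 2 ln y\<close> of \<open>1 + t\<^sup>2 / y\<^sup>2\<close> is convex in \<open>y\<close>, and \<open>y + \<theta>\<close> lies between
  \<open>y\<close> and \<open>y + 1\<close>.
\<close>
lemma one_plus_square_quotient_interpolate:
  fixes y t \<theta> :: real
  assumes y: "y > 0" and \<theta>: "0 \<le> \<theta>" "\<theta> \<le> 1"
  shows "1 + t\<^sup>2 / (y + \<theta>)\<^sup>2 \<le> (1 + t\<^sup>2 / y\<^sup>2) powr (1 - \<theta>) * (1 + t\<^sup>2 / (y + 1)\<^sup>2) powr \<theta>"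
proof -
  define \<phi> where "\<phi> y = ln (y\<^sup>2 + t\<^sup>2) - 2 * ln y" for y :: real
  have \<phi>: "\<phi> y = ln (1 + t\<^sup>2 / y\<^sup>2)" if "y > 0" for y
  proof -
    have "1 + t\<^sup>2 / y\<^sup>2 = (y\<^sup>2 + t\<^sup>2) / y\<^sup>2" using that by (simp add: field_simps)
    moreover have "y\<^sup>2 + t\<^sup>2 > 0" using that by (simp add: add_pos_nonneg)
    ultimately show ?thesis using that by (simp add: \<phi>_def ln_div ln_realpow)
  qed
  have conv: "convex_on {0<..} \<phi>"
  proof (rule f''_ge0_imp_convex)
    fix x :: real assume x: "x \<in> {0<..}"
    have p: "x\<^sup>2 + t\<^sup>2 > 0" using x by (simp add: add_pos_nonneg)
    show "(\<phi> has_real_derivative (2 * x / (x\<^sup>2 + t\<^sup>2) - 2 / x)) (at x)"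
      unfolding \<phi>_def using x p by (auto intro!: derivative_eq_intros)
    show "((\<lambda>x. 2 * x / (x\<^sup>2 + t\<^sup>2) - 2 / x) has_real_derivative
      (2 * (x\<^sup>2 + t\<^sup>2) - 2 * x * (2 * x)) / (x\<^sup>2 + t\<^sup>2)\<^sup>2 + 2 / x\<^sup>2) (at x)"
      using x p by (auto intro!: derivative_eq_intros simp: power2_eq_square)
    have "2 * x\<^sup>2 / (x\<^sup>2 + t\<^sup>2)\<^sup>2 \<le> 2 / x\<^sup>2"
    proof -
      have "x\<^sup>2 * x\<^sup>2 \<le> (x\<^sup>2 + t\<^sup>2)\<^sup>2" unfolding power2_eq_square[of "x\<^sup>2 + t\<^sup>2"]
        by (intro mult_mono) auto
      thus ?thesis using x p by (simp add: divide_simps)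
    qed
    moreover have "(2 * (x\<^sup>2 + t\<^sup>2) - 2 * x * (2 * x)) / (x\<^sup>2 + t\<^sup>2)\<^sup>2 = 2 * t\<^sup>2 / (x\<^sup>2 + t\<^sup>2)\<^sup>2 - 2 * x\<^sup>2 / (x\<^sup>2 + t\<^sup>2)\<^sup>2"
      by (simp add: power2_eq_square flip: diff_divide_distrib)
    moreover have "2 * t\<^sup>2 / (x\<^sup>2 + t\<^sup>2)\<^sup>2 \<ge> 0" by simp
    ultimately show "0 \<le> (2 * (x\<^sup>2 + t\<^sup>2) - 2 * x * (2 * x)) / (x\<^sup>2 + t\<^sup>2)\<^sup>2 + 2 / x\<^sup>2"
      by linarith
  qed auto
  have "\<phi> ((1 - \<theta>) *\<^sub>R y + \<theta> *\<^sub>R (y + 1)) \<le> (1 - \<theta>) * \<phi> y + \<theta> * \<phi> (y + 1)"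
    by (rule convex_onD[OF conv]) (use y \<theta> in auto)
  also have "(1 - \<theta>) *\<^sub>R y + \<theta> *\<^sub>R (y + 1) = y + \<theta>" by (simp add: algebra_simps)
  finally have "ln (1 + t\<^sup>2 / (y + \<theta>)\<^sup>2) \<le> (1 - \<theta>) * ln (1 + t\<^sup>2 / y\<^sup>2) + \<theta> * ln (1 + t\<^sup>2 / (y + 1)\<^sup>2)"
    using y \<theta> by (simp add: \<phi>)
  hence "exp (ln (1 + t\<^sup>2 / (y + \<theta>)\<^sup>2)) \<le> exp ((1 - \<theta>) * ln (1 + t\<^sup>2 / y\<^sup>2) + \<theta> * ln (1 + t\<^sup>2 / (y + 1)\<^sup>2))"
    by (simp only: exp_le_cancel_iff)
  moreover have pos: "1 + t\<^sup>2 / x\<^sup>2 > 0" for x :: real by (simp add: add_pos_nonneg)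
  ultimately show ?thesis by (simp add: exp_add powr_def less_imp_neq[OF pos, symmetric])
qed

text \<open>
  In the approximating products of both \<open>rGamma\<close> values the exponential factors have the same modulus, so
  they cancel in the quotient.
\<close>
lemma rGamma_quotient_LIMSEQ:
  fixes y t :: real
  assumes y: "y > 0"
  shows "(\<lambda>n. \<Prod>k\<le>n. 1 + t\<^sup>2 / (y + real k)\<^sup>2) \<longlonglongrightarrow> (norm (rGamma (Complex y t)) / rGamma y)\<^sup>2"
proof -
  have ry: "rGamma y > 0" using y by (simp add: rGamma_inverse_Gamma Gamma_real_pos)
  have "(\<lambda>n. (norm (rGamma_series (Complex y t) n) / norm (rGamma_series y n))\<^sup>2) \<longlonglongrightarrow>
      (norm (rGamma (Complex y t)) / norm (rGamma y))\<^sup>2"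
    using ry by (intro tendsto_intros) auto
  moreover have "(norm (rGamma_series (Complex y t) n) / norm (rGamma_series y n))\<^sup>2 = (\<Prod>k\<le>n. 1 + t\<^sup>2 / (y + real k)\<^sup>2)"
    if "n > 0" for n
  proof -
    have "norm (pochhammer (Complex y t) (Suc n)) = (\<Prod>k\<le>n. norm (Complex (y + real k) t))"
      unfolding pochhammer_prod lessThan_Suc_atMost[symmetric] atLeast0LessThan prod_norm[symmetric]
      by (intro prod.cong arg_cong[of _ _ norm]) (auto simp: complex_eq_iff)
    moreover have "norm (pochhammer y (Suc n)) = (\<Prod>k\<le>n. y + real k)"
      unfolding pochhammer_prod lessThan_Suc_atMost[symmetric] atLeast0LessThan prod_norm[symmetric]
      using y by (intro prod.cong) auto
    moreover have "norm (fact n * exp (Complex y t * of_real (ln (real n)))) = norm (fact n * exp (y * ln (real n)))"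
      by (simp add: norm_mult)
    ultimately have "norm (rGamma_series (Complex y t) n) / norm (rGamma_series y n) =
        (\<Prod>k\<le>n. norm (Complex (y + real k) t)) / (\<Prod>k\<le>n. y + real k)"
      by (simp add: rGamma_series_def norm_divide)
    also have "\<dots> = (\<Prod>k\<le>n. norm (Complex (y + real k) t) / (y + real k))" by (rule prod_dividef[symmetric])
    finally have "(norm (rGamma_series (Complex y t) n) / norm (rGamma_series y n))\<^sup>2 =
       (\<Prod>k\<le>n. (norm (Complex (y + real k) t) / (y + real k))\<^sup>2)" by (simp add: prod_power_distrib)
    also have "\<dots> = (\<Prod>k\<le>n. 1 + t\<^sup>2 / (y + real k)\<^sup>2)"
    proof (rule prod.cong)
      fix k
      have "y + real k > 0" using y by simp
      thus "(norm (Complex (y + real k) t) / (y + real k))\<^sup>2 = 1 + t\<^sup>2 / (y + real k)\<^sup>2"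
        by (simp add: power_divide cmod_power2 field_simps)
    qed simp
    finally show ?thesis .
  qed
  hence "\<forall>\<^sub>F n in sequentially. (norm (rGamma_series (Complex y t) n) / norm (rGamma_series y n))\<^sup>2 = (\<Prod>k\<le>n. 1 + t\<^sup>2 / (y + real k)\<^sup>2)"
    using eventually_gt_at_top[of 0] by (rule eventually_mono[rotated])
  ultimately show ?thesis using ry by (simp add: Lim_transform_eventually)
qed

lemma norm_rGamma_half:
  fixes t :: real
  shows "(norm (rGamma (Complex (1 / 2) t)))\<^sup>2 = cosh (pi * t) / pi"
proof -
  define z where "z = Complex (1 / 2) t"
  have "complex_of_real ((norm (rGamma z))\<^sup>2) = rGamma z * rGamma (1 - z)"
  proof -
    have "1 - z = cnj z" by (simp add: z_def complex_eq_iff)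
    thus ?thesis by (simp only: complex_norm_square cnj_rGamma)
  qed
  also have "\<dots> = sin (of_real pi * z) / of_real pi" by (rule rGamma_reflection_complex)
  also have "of_real pi * z = of_real (pi / 2) + \<i> * of_real (pi * t)" by (simp add: z_def complex_eq_iff)
  also have "sin (of_real (pi / 2) + \<i> * of_real (pi * t)) = of_real (cosh (pi * t))"
  proof -
    have "sin (of_real (pi / 2) + \<i> * of_real (pi * t)) = cos (\<i> * of_real (pi * t))"
      unfolding sin_add sin_of_real cos_of_real by simp
    also have "\<dots> = of_real (cosh (pi * t))"
      unfolding cos_exp_eq by (simp add: cosh_def add.commute flip: exp_of_real)
    finally show ?thesis .
  qed
  finally show ?thesis unfolding z_def[symmetric] by (simp only: flip: of_real_divide) (simp only: of_real_eq_iff)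
qed

text \<open>
  A convexity argument in place of Stirling's formula. The quotient \<open>Q y\<close> of \<open>|rGamma (y + \<i> t)|\<^sup>2\<close> and
  \<open>(rGamma y)\<^sup>2\<close> is a product of factors that are logarithmically convex in \<open>y\<close>, so it can be interpolated
  between \<open>y = 1 / 2\<close> and \<open>y = 3 / 2\<close>. The first value is \<open>cosh (pi t)\<close> by the reflection formula, and the
  recurrence of \<open>rGamma\<close> yields the second.
\<close>
lemma norm_rGamma_le:
  fixes \<theta> t :: real
  assumes \<theta>: "0 \<le> \<theta>" "\<theta> \<le> 1" and t: "t > 0"
  shows "norm (rGamma (Complex (1 / 2 + \<theta>) t)) \<le> rGamma (1 / 2 + \<theta>) * exp (pi * t / 2) * t powr (- \<theta>)"
proof -
  define P where "P y n = (\<Prod>k\<le>n. 1 + t\<^sup>2 / (y + real k)\<^sup>2)" for y :: real and n :: nat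
  define Q where "Q y = (norm (rGamma (Complex y t)) / rGamma y)\<^sup>2" for y :: real
  have lim: "P y \<longlonglongrightarrow> Q y" if "y > 0" for y
    unfolding P_def Q_def by (rule rGamma_quotient_LIMSEQ[OF that])
  have rpos: "rGamma y > 0" if "y > 0" for y :: real
    using that by (simp add: rGamma_inverse_Gamma Gamma_real_pos)
  have nz: "rGamma (Complex y t) \<noteq> 0" for y
  proof
    assume "rGamma (Complex y t) = 0"
    hence "Complex y t \<in> \<int>\<^sub>\<le>\<^sub>0" by (simp add: rGamma_eq_zero_iff)
    then obtain n where "Complex y t = of_int n" by (elim nonpos_Ints_cases)
    hence "Im (Complex y t) = 0" by simp
    thus False using t by simp
  qed
  have Qpos: "Q y > 0" if "y > 0" for y
    using nz[of y] rpos[OF that] by (simp add: Q_def)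
  have "P (1 / 2 + \<theta>) n \<le> P (1 / 2) n powr (1 - \<theta>) * P (3 / 2) n powr \<theta>" for n
  proof -
    have "P (1 / 2 + \<theta>) n \<le> (\<Prod>k\<le>n. (1 + t\<^sup>2 / (1 / 2 + real k)\<^sup>2) powr (1 - \<theta>) * (1 + t\<^sup>2 / (3 / 2 + real k)\<^sup>2) powr \<theta>)"
      unfolding P_def
    proof (rule prod_mono, intro conjI)
      fix k
      show "1 + t\<^sup>2 / (1 / 2 + \<theta> + real k)\<^sup>2 \<le> (1 + t\<^sup>2 / (1 / 2 + real k)\<^sup>2) powr (1 - \<theta>) * (1 + t\<^sup>2 / (3 / 2 + real k)\<^sup>2) powr \<theta>"
        using one_plus_square_quotient_interpolate[of "1 / 2 + real k" \<theta> t] \<theta> by (simp add: add_ac)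
    qed simp
    also have "\<dots> = P (1 / 2) n powr (1 - \<theta>) * P (3 / 2) n powr \<theta>"
    proof -
      have "(\<Prod>k\<in>A. f k powr a) = (\<Prod>k\<in>A. f k) powr a" if "\<And>k. f k \<ge> 0" for A :: "nat set" and f and a :: real
        using that by (induction A rule: infinite_finite_induct) (auto simp: powr_mult prod_nonneg)
      thus ?thesis unfolding P_def prod.distrib by simp
    qed
    finally show ?thesis .
  qed
  hence "Q (1 / 2 + \<theta>) \<le> Q (1 / 2) powr (1 - \<theta>) * Q (3 / 2) powr \<theta>"
    using \<theta> Qpos[of "1 / 2"] Qpos[of "3 / 2"]
    by (intro LIMSEQ_le[OF lim tendsto_mult[OF tendsto_powr[OF lim tendsto_const] tendsto_powr[OF lim tendsto_const]]]) auto
  also have "Q (3 / 2) = Q (1 / 2) / (1 + 4 * t\<^sup>2)"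
  proof -
    have "Complex (1 / 2) t + 1 = Complex (3 / 2) t" by (simp add: complex_eq_iff)
    hence "rGamma (Complex (1 / 2) t) = Complex (1 / 2) t * rGamma (Complex (3 / 2) t)"
      using rGamma_plus1[of "Complex (1 / 2) t"] by simp
    hence 1: "(norm (rGamma (Complex (1 / 2) t)))\<^sup>2 = (1 / 4 + t\<^sup>2) * (norm (rGamma (Complex (3 / 2) t)))\<^sup>2"
      by (simp add: norm_mult power_mult_distrib cmod_power2 power_divide)
    have 2: "rGamma (1 / 2 :: real) = 1 / 2 * rGamma (3 / 2)"
      using rGamma_plus1[of "1 / 2 :: real"] by simp
    have "Q (1 / 2) = (1 + 4 * t\<^sup>2) * Q (3 / 2)"
      unfolding Q_def power_divide 1 2 using rpos[of "3 / 2"]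
      by (simp add: power_mult_distrib power_divide field_simps)
    moreover have "1 + 4 * t\<^sup>2 > 0" by (simp add: add_pos_nonneg)
    ultimately show ?thesis by simp
  qed
  also have "Q (1 / 2) powr (1 - \<theta>) * (Q (1 / 2) / (1 + 4 * t\<^sup>2)) powr \<theta> = Q (1 / 2) * (1 + 4 * t\<^sup>2) powr (- \<theta>)"
    using Qpos[of "1 / 2"] by (simp add: powr_divide powr_diff powr_minus_divide)
  also have "\<dots> \<le> exp (pi * t) * (t\<^sup>2) powr (- \<theta>)"
  proof (intro mult_mono)
    have "rGamma (1 / 2 :: real) = 1 / sqrt pi"
      by (simp add: rGamma_inverse_Gamma Gamma_one_half_real inverse_eq_divide)
    hence "Q (1 / 2) = cosh (pi * t)"
      unfolding Q_def power_divide norm_rGamma_half by (simp add: power_divide)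
    also have "cosh (pi * t) \<le> exp (pi * t)"
      using t by (simp add: cosh_def)
    finally show "Q (1 / 2) \<le> exp (pi * t)" .
    show "(1 + 4 * t\<^sup>2) powr - \<theta> \<le> (t\<^sup>2) powr - \<theta>"
      using t \<theta> by (intro powr_mono2') auto
  qed auto
  also have "(t\<^sup>2) powr (- \<theta>) = (t powr (- \<theta>))\<^sup>2"
    using t by (simp add: powr_powr mult.commute flip: powr_numeral)
  also have "exp (pi * t) = (exp (pi * t / 2))\<^sup>2" by (simp flip: exp_double)
  finally have "(norm (rGamma (Complex (1 / 2 + \<theta>) t)) / rGamma (1 / 2 + \<theta>))\<^sup>2 \<le> (exp (pi * t / 2) * t powr (- \<theta>))\<^sup>2"
    by (simp add: Q_def power_mult_distrib)
  hence "norm (rGamma (Complex (1 / 2 + \<theta>) t)) / rGamma (1 / 2 + \<theta>) \<le> exp (pi * t / 2) * t powr (- \<theta>)"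
    by (rule power2_le_imp_le) simp
  thus ?thesis using rpos[of "1 / 2 + \<theta>"] \<theta> by (simp add: field_simps)
qed

text \<open>
  In the functional equation, written as
  \<open>\<zeta>(s) rGamma (1 - s) = (2 pi) powr s \<zeta>(1 - s) sin (pi s / 2) / pi\<close>, the sine has size
  \<open>exp (pi t / 2)\<close>. The bound for \<open>rGamma (1 - s)\<close> contains the same exponential, and a
  power of \<open>t\<close> is left over.
\<close>
lemma norm_riemann_zeta_ge_reflected:
  fixes \<sigma> :: real
  assumes \<sigma>: "0 < \<sigma>" "\<sigma> \<le> 1 / 2"
  obtains c where "c > 0"
    "\<And>t. t \<ge> 1 \<Longrightarrow> norm (riemann_zeta (Complex \<sigma> t)) \<ge> c * t powr (1 / 2 - \<sigma>) * norm (riemann_zeta (Complex (1 - \<sigma>) t))"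
proof -
  define c where "c = (2 * pi) powr \<sigma> / (4 * pi * rGamma (1 - \<sigma>))"
  have rg: "rGamma (1 - \<sigma>) > 0" using \<sigma> by (simp add: rGamma_inverse_Gamma Gamma_real_pos)
  have c: "c > 0" using rg by (simp add: c_def)
  have "norm (riemann_zeta (Complex \<sigma> t)) \<ge> c * t powr (1 / 2 - \<sigma>) * norm (riemann_zeta (Complex (1 - \<sigma>) t))"
    if t: "t \<ge> 1" for t
  proof -
    define s where "s = Complex \<sigma> t"
    have co: "cos (of_real pi * s / 2) \<noteq> 0"
    proof
      assume "cos (of_real pi * s / 2) = 0"
      then obtain n where "of_real pi * s / 2 = of_real (of_int n * pi + pi / 2)"
        by (auto simp: cos_eq_0)
      hence "Im (of_real pi * s / 2) = 0" by (simp only: Im_complex_of_real)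
      thus False using t by (simp add: s_def)
    qed
    have "2 * cos (of_real pi * s / 2) * (riemann_zeta s * rGamma (1 - s)) =
       (2 * cos (of_real pi * s / 2) * riemann_zeta s) * rGamma (1 - s)" by (simp only: mult_ac)
    also have "2 * cos (of_real pi * s / 2) * riemann_zeta s = of_real (2 * pi) powr s * rGamma s * riemann_zeta (1 - s)"
      using \<sigma> by (intro riemann_zeta_functional_equation) (auto simp: s_def)
    also have "of_real (2 * pi) powr s * rGamma s * riemann_zeta (1 - s) * rGamma (1 - s) =
       of_real (2 * pi) powr s * riemann_zeta (1 - s) * (rGamma s * rGamma (1 - s))" by (simp only: mult_ac)
    also have "rGamma s * rGamma (1 - s) = 2 * sin (of_real pi * s / 2) * cos (of_real pi * s / 2) / of_real pi"
      using sin_double[of "of_real pi * s / 2"] by (simp add: rGamma_reflection_complex)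
    finally have "2 * cos (of_real pi * s / 2) * (riemann_zeta s * rGamma (1 - s)) =
      2 * cos (of_real pi * s / 2) * (of_real (2 * pi) powr s * riemann_zeta (1 - s) * sin (of_real pi * s / 2) / of_real pi)"
      by (simp add: field_simps)
    hence eq: "riemann_zeta s * rGamma (1 - s) = of_real (2 * pi) powr s * riemann_zeta (1 - s) * sin (of_real pi * s / 2) / of_real pi"
      using co by (subst (asm) mult_left_cancel) simp_all
    have cn: "1 - s = cnj (Complex (1 - \<sigma>) t)" by (simp add: s_def complex_eq_iff)
    have n1: "norm (riemann_zeta (1 - s)) = norm (riemann_zeta (Complex (1 - \<sigma>) t))"
      unfolding cn riemann_zeta_cnj by simp
    have n2: "norm (rGamma (1 - s)) = norm (rGamma (Complex (1 - \<sigma>) t))"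
      unfolding cn by (simp only: cnj_rGamma[symmetric] complex_mod_cnj)
    have n3: "norm (rGamma (Complex (1 - \<sigma>) t)) \<le> rGamma (1 - \<sigma>) * exp (pi * t / 2) * t powr (- (1 / 2 - \<sigma>))"
      using norm_rGamma_le[of "1 / 2 - \<sigma>" t] \<sigma> t by simp
    have n4: "norm (complex_of_real (2 * pi) powr s) = (2 * pi) powr \<sigma>"
      by (subst norm_powr_real_powr) (auto simp: s_def)
    have n5: "norm (sin (of_real pi * s / 2)) \<ge> exp (pi * t / 2) / 4"
    proof -
      have e2: "exp (pi * t / 2) \<ge> 2"
      proof -
        have "pi * t / 2 \<ge> pi / 2" using t by simp
        hence "pi * t / 2 \<ge> 1" using pi_gt3 by linarith
        thus ?thesis using exp_ge_add_one_self[of "pi * t / 2"] by linarith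
      qed
      have "norm (exp (- (\<i> * (of_real pi * s / 2)))) - norm (exp (\<i> * (of_real pi * s / 2))) \<le>
         norm (exp (- (\<i> * (of_real pi * s / 2))) - exp (\<i> * (of_real pi * s / 2)))" by (rule norm_triangle_ineq2)
      hence "exp (pi * t / 2) - exp (- (pi * t / 2)) \<le> norm (exp (\<i> * (of_real pi * s / 2)) - exp (- (\<i> * (of_real pi * s / 2))))"
        by (simp add: norm_minus_commute s_def)
      also have "\<dots> = 2 * norm (sin (of_real pi * s / 2))" by (simp add: sin_exp_eq norm_divide norm_mult)
      finally have "exp (pi * t / 2) - exp (- (pi * t / 2)) \<le> 2 * norm (sin (of_real pi * s / 2))" .
      moreover have "exp (- (pi * t / 2)) \<le> 1" using t by simp
      ultimately show ?thesis using e2 by linarith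
    qed
    let ?z = "norm (riemann_zeta (Complex (1 - \<sigma>) t))"
    have "(2 * pi) powr \<sigma> * ?z * (exp (pi * t / 2) / 4) / pi \<le> (2 * pi) powr \<sigma> * ?z * norm (sin (of_real pi * s / 2)) / pi"
      using n5 by (intro divide_right_mono mult_left_mono) auto
    also have "\<dots> = norm (riemann_zeta s * rGamma (1 - s))" unfolding eq norm_mult norm_divide n1 n4 by simp
    also have "\<dots> = norm (riemann_zeta s) * norm (rGamma (Complex (1 - \<sigma>) t))" by (simp add: norm_mult n2)
    also have "\<dots> \<le> norm (riemann_zeta s) * (rGamma (1 - \<sigma>) * exp (pi * t / 2) * t powr (- (1 / 2 - \<sigma>)))"
      by (intro mult_left_mono n3) auto
    finally have "(2 * pi) powr \<sigma> * ?z / (4 * pi) * exp (pi * t / 2) \<le>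
        norm (riemann_zeta s) * rGamma (1 - \<sigma>) * t powr (- (1 / 2 - \<sigma>)) * exp (pi * t / 2)" by (simp add: mult_ac)
    hence "(2 * pi) powr \<sigma> * ?z / (4 * pi) \<le> norm (riemann_zeta s) * rGamma (1 - \<sigma>) * t powr (- (1 / 2 - \<sigma>))"
      by (rule mult_right_le_imp_le) simp
    hence "(2 * pi) powr \<sigma> * ?z / (4 * pi) / rGamma (1 - \<sigma>) * t powr (1 / 2 - \<sigma>) \<le>
       norm (riemann_zeta s) * rGamma (1 - \<sigma>) * t powr (- (1 / 2 - \<sigma>)) / rGamma (1 - \<sigma>) * t powr (1 / 2 - \<sigma>)"
      using rg by (intro mult_right_mono divide_right_mono) auto
    also have "\<dots> = norm (riemann_zeta s)" using rg t by (simp flip: powr_add)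
    finally show ?thesis by (simp add: c_def s_def mult_ac)
  qed
  thus ?thesis using that c by blast
qed

section \<open>Infinite products of zeta values\<close>

text \<open>
  Compared with the term at exponent \<open>a\<close>, each term from \<open>n = 2\<close> on carries the additional factor
  \<open>n powr (a - Re w)\<close>, which is largest at \<open>n = 2\<close>.
\<close>
lemma norm_riemann_zeta_minus_one_le:
  assumes a: "a > 1" and w: "Re w \<ge> a"
  shows "norm (riemann_zeta w - 1) \<le> (\<Sum>n. real (Suc n) powr (- a)) * 2 powr (a - Re w)"
proof -
  have "(\<lambda>n. 1 / of_nat (Suc n) powr w) sums riemann_zeta w" using a w by (intro riemann_zeta_sums) simp
  from sums_split_initial_segment[OF this, of 1]
  have sm: "(\<lambda>n. 1 / of_nat (Suc (Suc n)) powr w) sums (riemann_zeta w - 1)" by simp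
  have le: "norm (1 / of_nat (Suc (Suc n)) powr w) \<le> real (Suc n) powr (- a) * 2 powr (a - Re w)" for n
  proof -
    have "norm (1 / of_nat (Suc (Suc n)) powr w) = real (Suc (Suc n)) powr (- Re w)"
      using norm_powr_real_powr[of "of_nat (Suc (Suc n))" w] by (simp add: norm_divide powr_minus_divide)
    also have "\<dots> = real (Suc (Suc n)) powr (- a) * real (Suc (Suc n)) powr (a - Re w)"
      by (simp flip: powr_add)
    also have "\<dots> \<le> real (Suc n) powr (- a) * 2 powr (a - Re w)"
      using a w by (intro mult_mono powr_mono2') auto
    finally show ?thesis .
  qed
  have sa: "summable (\<lambda>n. real (Suc n) powr (- a))" using a by (intro summable_Suc_powr) simp
  have "norm (\<Sum>n. 1 / of_nat (Suc (Suc n)) powr w :: complex) \<le> (\<Sum>n. real (Suc n) powr (- a) * 2 powr (a - Re w))"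
    by (rule norm_suminf_le[OF le summable_mult2[OF sa]])
  also have "\<dots> = (\<Sum>n. real (Suc n) powr (- a)) * 2 powr (a - Re w)" by (rule suminf_mult2[OF sa, symmetric])
  also have "(\<Sum>n. 1 / of_nat (Suc (Suc n)) powr w :: complex) = riemann_zeta w - 1" using sm by (simp add: sums_iff)
  finally show ?thesis .
qed

text \<open>
  For \<open>m = 1\<close> this is the Dirichlet series of \<open>num_abelian_groups\<close>; for larger \<open>m\<close> the product converges
  on the larger half-plane \<open>Re s > 1 / m\<close>.
\<close>
definition zeta_tail :: "nat \<Rightarrow> complex \<Rightarrow> complex" where
  "zeta_tail m s = (\<Prod>i. riemann_zeta (of_nat (m + i) * s))"

lemma pos_if_of_nat_mult_gt_one:
  fixes x :: real
  assumes "real m * x > 1"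
  shows "x > 0"
  using assms by (metis less_trans zero_less_mult_pos of_nat_0_le_iff less_le mult_zero_left not_less zero_less_one)

lemma zeta_tail_factor_bound:
  assumes m: "real m * \<sigma> > 1"
  obtains C where "C \<ge> 0" "\<And>s i. Re s \<ge> \<sigma> \<Longrightarrow>
     norm (riemann_zeta (of_nat (m + i) * s) - 1) \<le> C * 2 powr (- (real m * Re s)) * (2 powr (- \<sigma>)) ^ i"
proof -
  have \<sigma>: "\<sigma> > 0" using m by (rule pos_if_of_nat_mult_gt_one)
  define a where "a = real m * \<sigma>"
  define C where "C = (\<Sum>n. real (Suc n) powr (- a)) * 2 powr a"
  have "summable (\<lambda>n. real (Suc n) powr (- a))" using m by (intro summable_Suc_powr) (simp add: a_def)
  hence C: "C \<ge> 0" unfolding C_def by (intro mult_nonneg_nonneg suminf_nonneg) auto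
  have "norm (riemann_zeta (of_nat (m + i) * s) - 1) \<le> C * 2 powr (- (real m * Re s)) * (2 powr (- \<sigma>)) ^ i"
    if s: "Re s \<ge> \<sigma>" for s i
  proof -
    have ge: "real (m + i) * Re s \<ge> real m * Re s + real i * \<sigma>"
      using s by (simp add: distrib_right mult_left_mono)
    have "a \<le> real m * Re s" using s by (simp add: a_def mult_left_mono)
    moreover have "real i * \<sigma> \<ge> 0" using \<sigma> by simp
    ultimately have "real (m + i) * Re s \<ge> a" using ge by linarith
    hence ga: "Re (of_nat (m + i) * s) \<ge> a" by simp
    have "norm (riemann_zeta (of_nat (m + i) * s) - 1) \<le>
       (\<Sum>n. real (Suc n) powr (- a)) * 2 powr (a - Re (of_nat (m + i) * s))"
      by (rule norm_riemann_zeta_minus_one_le[OF _ ga]) (use m in \<open>simp add: a_def\<close>)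
    also have "\<dots> = C * 2 powr (- (real (m + i) * Re s))"
      by (simp add: C_def flip: powr_add)
    also have "\<dots> \<le> C * 2 powr (- (real m * Re s) + (- \<sigma>) * real i)"
      using ge C by (intro mult_left_mono powr_mono) (auto simp: mult_ac)
    also have "\<dots> = C * 2 powr (- (real m * Re s)) * (2 powr (- \<sigma>)) ^ i"
      by (simp only: powr_add powr_powr[symmetric]) (simp add: powr_realpow)
    finally show ?thesis .
  qed
  thus ?thesis using that C by blast
qed

lemma zeta_tail_LIMSEQ:
  assumes m: "real m * Re s > 1"
  shows "(\<lambda>n. \<Prod>i<n. riemann_zeta (of_nat (m + i) * s)) \<longlonglongrightarrow> zeta_tail m s"
proof -
  have s: "Re s > 0" using m by (rule pos_if_of_nat_mult_gt_one)
  obtain C where C: "\<And>i. norm (riemann_zeta (of_nat (m + i) * s) - 1) \<le> C * 2 powr (- (real m * Re s)) * (2 powr (- Re s)) ^ i"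
    using zeta_tail_factor_bound[OF m] by (metis order_refl)
  have "2 powr (- Re s) < (1::real)" using s by (simp add: powr_less_one)
  hence "summable (\<lambda>i. C * 2 powr (- (real m * Re s)) * (2 powr (- Re s)) ^ i)"
    by (intro summable_mult summable_geometric) simp
  hence "summable (\<lambda>i. norm (riemann_zeta (of_nat (m + i) * s) - 1))"
    by (rule summable_comparison_test'[of _ 0]) (use C in simp)
  hence "convergent_prod (\<lambda>i. riemann_zeta (of_nat (m + i) * s))"
    by (intro abs_convergent_prod_imp_convergent_prod summable_imp_abs_convergent_prod)
  from convergent_prod_LIMSEQ[OF this] have "(\<lambda>n. \<Prod>i<Suc n. riemann_zeta (of_nat (m + i) * s)) \<longlonglongrightarrow> zeta_tail m s"
    unfolding zeta_tail_def lessThan_Suc_atMost .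
  thus ?thesis by (rule LIMSEQ_imp_Suc)
qed

lemma zeta_tail_rec:
  assumes m: "real m * Re s > 1"
  shows "zeta_tail m s = riemann_zeta (of_nat m * s) * zeta_tail (Suc m) s"
proof -
  have s: "Re s > 0" using m by (rule pos_if_of_nat_mult_gt_one)
  hence m': "real (Suc m) * Re s > 1" using m by (simp add: distrib_right)
  have "(\<lambda>n. \<Prod>i<Suc n. riemann_zeta (of_nat (m + i) * s)) \<longlonglongrightarrow> zeta_tail m s"
    by (rule LIMSEQ_Suc[OF zeta_tail_LIMSEQ[OF m]])
  moreover have "(\<Prod>i<Suc n. riemann_zeta (of_nat (m + i) * s)) =
      riemann_zeta (of_nat m * s) * (\<Prod>i<n. riemann_zeta (of_nat (Suc m + i) * s))" for n
    unfolding prod.lessThan_Suc_shift by simp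
  ultimately have "(\<lambda>n. riemann_zeta (of_nat m * s) * (\<Prod>i<n. riemann_zeta (of_nat (Suc m + i) * s))) \<longlonglongrightarrow> zeta_tail m s"
    by (simp only:)
  moreover have "(\<lambda>n. riemann_zeta (of_nat m * s) * (\<Prod>i<n. riemann_zeta (of_nat (Suc m + i) * s))) \<longlonglongrightarrow>
     riemann_zeta (of_nat m * s) * zeta_tail (Suc m) s"
    by (intro tendsto_intros zeta_tail_LIMSEQ[OF m'])
  ultimately show ?thesis by (rule LIMSEQ_unique)
qed

lemma norm_zeta_tail_minus_one_le:
  assumes m: "real m * \<sigma> > 1"
  obtains K where "K \<ge> 0" "\<And>s. Re s \<ge> \<sigma> \<Longrightarrow> norm (zeta_tail m s - 1) \<le> exp (K * 2 powr (- (real m * Re s))) - 1"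
proof -
  have \<sigma>: "\<sigma> > 0" using m by (rule pos_if_of_nat_mult_gt_one)
  obtain C where C: "C \<ge> 0" "\<And>s i. Re s \<ge> \<sigma> \<Longrightarrow>
     norm (riemann_zeta (of_nat (m + i) * s) - 1) \<le> C * 2 powr (- (real m * Re s)) * (2 powr (- \<sigma>)) ^ i"
    using zeta_tail_factor_bound[OF m] by blast
  have q: "norm (2 powr (- \<sigma>) :: real) < 1" using \<sigma> by (simp add: powr_less_one)
  define K where "K = C * (\<Sum>i. (2 powr (- \<sigma>)) ^ i)"
  have sg: "summable (\<lambda>i. (2 powr (- \<sigma>) :: real) ^ i)" by (rule summable_geometric[OF q])
  have K: "K \<ge> 0" unfolding K_def using C(1) by (intro mult_nonneg_nonneg suminf_nonneg sg) auto
  have "norm (zeta_tail m s - 1) \<le> exp (K * 2 powr (- (real m * Re s))) - 1" if s: "Re s \<ge> \<sigma>" for s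
  proof -
    have "real m * \<sigma> \<le> real m * Re s" using s by (simp add: mult_left_mono)
    hence ms: "real m * Re s > 1" using m by linarith
    define u where "u i = riemann_zeta (of_nat (m + i) * s) - 1" for i
    have lim: "(\<lambda>n. norm ((\<Prod>i<n. riemann_zeta (of_nat (m + i) * s)) - 1)) \<longlonglongrightarrow> norm (zeta_tail m s - 1)"
      by (intro tendsto_intros zeta_tail_LIMSEQ ms)
    have "norm ((\<Prod>i<n. riemann_zeta (of_nat (m + i) * s)) - 1) \<le> exp (K * 2 powr (- (real m * Re s))) - 1" for n
    proof -
      have "norm ((\<Prod>i<n. 1 + u i) - 1) \<le> (\<Prod>i<n. 1 + norm (u i)) - 1"
        by (rule norm_prod_minus1_le_prod_minus1)
      also have "(\<Prod>i<n. 1 + norm (u i)) \<le> exp (\<Sum>i<n. norm (u i))" by (rule prod_le_exp_sum) simp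
      also have "(\<Sum>i<n. norm (u i)) \<le> (\<Sum>i<n. C * 2 powr (- (real m * Re s)) * (2 powr (- \<sigma>)) ^ i)"
        unfolding u_def by (intro sum_mono C s)
      also have "\<dots> = C * 2 powr (- (real m * Re s)) * (\<Sum>i<n. (2 powr (- \<sigma>)) ^ i)" by (simp add: sum_distrib_left)
      also have "\<dots> \<le> C * 2 powr (- (real m * Re s)) * (\<Sum>i. (2 powr (- \<sigma>)) ^ i)"
        using C(1) by (intro mult_left_mono sum_le_suminf sg) auto
      also have "\<dots> = K * 2 powr (- (real m * Re s))" by (simp add: K_def mult_ac)
      finally show ?thesis by (simp add: u_def)
    qed
    thus ?thesis by (intro LIMSEQ_le_const2[OF lim]) auto
  qed
  thus ?thesis using that K by blast
qed

lemma holomorphic_zeta_tail: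
  assumes m: "m > 0"
  shows "zeta_tail m holomorphic_on {s. Re s > 1 / real m}"
proof (rule holomorphic_uniform_sequence)
  let ?S = "{s. Re s > 1 / real m}"
  have z: "(\<lambda>s. riemann_zeta (of_nat (m + i) * s)) holomorphic_on ?S" for i
  proof -
    have "of_nat (m + i) * s \<noteq> 1" if "Re s > 1 / real m" for s
    proof -
      have s0: "Re s > 0" using that m by (meson divide_pos_pos less_trans of_nat_0_less_iff zero_less_one)
      have "1 < real m * Re s" using that m by (simp add: field_simps)
      also have "\<dots> \<le> real (m + i) * Re s" using s0 by (intro mult_right_mono) auto
      finally have "Re (of_nat (m + i) * s) > 1" by simp
      moreover have "w \<noteq> 1" if "Re w > 1" for w using that by auto
      ultimately show ?thesis by blast
    qed
    hence "riemann_zeta holomorphic_on ((\<lambda>s. of_nat (m + i) * s) ` ?S)"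
      by (intro holomorphic_on_subset[OF holomorphic_riemann_zeta]) auto
    moreover have "(\<lambda>s. of_nat (m + i) * s) holomorphic_on ?S" by (intro holomorphic_intros)
    ultimately show ?thesis using holomorphic_on_compose[of "\<lambda>s. of_nat (m + i) * s" ?S riemann_zeta] by (simp add: o_def)
  qed
  show "open ?S" by (rule open_halfspace_Re_gt)
  show "(\<lambda>s. \<Prod>i<n. riemann_zeta (of_nat (m + i) * s)) holomorphic_on ?S" for n
    by (intro holomorphic_on_prod z)
  fix s0 assume s0: "s0 \<in> ?S"
  define r where "r = (Re s0 - 1 / real m) / 2"
  have "2 * (x / 2) = x" for x :: real by simp
  hence r2: "2 * r = Re s0 - 1 / real m" unfolding r_def .
  define \<sigma> where "\<sigma> = 1 / real m + r"
  have r: "r > 0" using s0 by (simp add: r_def)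
  have m\<sigma>: "real m * \<sigma> > 1" using r m by (simp add: \<sigma>_def distrib_left)
  have \<sigma>0: "\<sigma> > 0" using r by (simp add: \<sigma>_def add_nonneg_pos)
  have Re: "Re s \<ge> \<sigma>" if "s \<in> cball s0 r" for s
  proof -
    have "\<bar>Re (s0 - s)\<bar> \<le> r" using that abs_Re_le_cmod[of "s0 - s"] by (simp add: dist_norm)
    hence "Re s0 - Re s \<le> r" by simp
    thus ?thesis using r2 unfolding \<sigma>_def by linarith
  qed
  have sub: "cball s0 r \<subseteq> ?S" using Re r by (force simp: \<sigma>_def)
  obtain C where C: "C \<ge> 0" "\<And>s i. Re s \<ge> \<sigma> \<Longrightarrow>
     norm (riemann_zeta (of_nat (m + i) * s) - 1) \<le> C * 2 powr (- (real m * Re s)) * (2 powr (- \<sigma>)) ^ i"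
    using zeta_tail_factor_bound[OF m\<sigma>] by blast
  have "uniformly_convergent_on (cball s0 r) (\<lambda>N s. \<Sum>i<N. norm (riemann_zeta (of_nat (m + i) * s) - 1))"
  proof (rule Weierstrass_m_test')
    fix i s assume s: "s \<in> cball s0 r"
    have "norm (norm (riemann_zeta (of_nat (m + i) * s) - 1)) \<le> C * 2 powr (- (real m * Re s)) * (2 powr (- \<sigma>)) ^ i"
      using C(2)[OF Re[OF s]] by simp
    also have "\<dots> \<le> C * 1 * (2 powr (- \<sigma>)) ^ i"
    proof (intro mult_right_mono mult_left_mono)
      have "real m * Re s \<ge> 0" using Re[OF s] \<sigma>0 by simp
      thus "2 powr (- (real m * Re s)) \<le> (1::real)" using powr_mono[of "- (real m * Re s)" 0 2] by simp
    qed (use C in auto)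
    finally show "norm (norm (riemann_zeta (of_nat (m + i) * s) - 1)) \<le> C * 1 * (2 powr (- \<sigma>)) ^ i" .
  next
    have "2 powr (- \<sigma>) < (1::real)" using \<sigma>0 by (simp add: powr_less_one)
    thus "summable (\<lambda>i. C * 1 * (2 powr (- \<sigma>)) ^ i)" by (intro summable_mult summable_geometric) simp
  qed
  moreover have "continuous_on (cball s0 r) (\<lambda>s. riemann_zeta (of_nat (m + i) * s))" for i
    by (rule holomorphic_on_imp_continuous_on[OF holomorphic_on_subset[OF z sub]])
  ultimately have "uniformly_convergent_on (cball s0 r) (\<lambda>N s. \<Prod>i<N. riemann_zeta (of_nat (m + i) * s))"
    by (intro uniformly_convergent_on_prod') auto
  hence "uniform_limit (cball s0 r) (\<lambda>N s. \<Prod>i<N. riemann_zeta (of_nat (m + i) * s))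
      (\<lambda>s. lim (\<lambda>N. \<Prod>i<N. riemann_zeta (of_nat (m + i) * s))) sequentially"
    by (simp add: uniformly_convergent_uniform_limit_iff)
  also have "?this \<longleftrightarrow> uniform_limit (cball s0 r) (\<lambda>N s. \<Prod>i<N. riemann_zeta (of_nat (m + i) * s)) (zeta_tail m) sequentially"
  proof (rule uniform_limit_cong')
    fix s assume "s \<in> cball s0 r"
    hence "real m * Re s \<ge> real m * \<sigma>" using Re[of s] by (intro mult_left_mono) auto
    hence "real m * Re s > 1" using m\<sigma> by linarith
    thus "lim (\<lambda>N. \<Prod>i<N. riemann_zeta (of_nat (m + i) * s)) = zeta_tail m s"
      by (intro limI zeta_tail_LIMSEQ)
  qed simp
  finally show "\<exists>d>0. cball s0 d \<subseteq> ?S \<and> uniform_limit (cball s0 d) (\<lambda>n s. \<Prod>i<n. riemann_zeta (of_nat (m + i) * s)) (zeta_tail m) sequentially"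
    using r sub by blast
qed

section \<open>The Dirichlet series counting abelian groups\<close>

text \<open>
  Unlike invariant factors, entries may be \<open>1\<close>, so that all chains considered have the same length.
\<close>
definition positive_divisor_chains :: "nat \<Rightarrow> nat list set" where
  "positive_divisor_chains K = {ds. divisor_chain ds \<and> (\<forall>d\<in>set ds. d > 0) \<and> length ds = K}"

lemma prod_list_map_mult: "prod_list (map ((*) (m::nat)) ds) = m ^ length ds * prod_list ds"
  by (induction ds) (auto simp: algebra_simps)

text \<open>Dividing a chain by its last entry leaves a chain that ends in \<open>1\<close>.\<close>
lemma bij_betw_extend_divisor_chain:
  "bij_betw (\<lambda>(ds, m). map ((*) m) (ds @ [1])) (positive_divisor_chains K \<times> {1..}) (positive_divisor_chains (Suc K))"
proof (rule bij_betwI[where g = "\<lambda>ds. (map (\<lambda>d. d div last ds) (butlast ds), last ds)"])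
  show "(\<lambda>(ds, m). map ((*) m) (ds @ [1])) \<in> positive_divisor_chains K \<times> {1..} \<rightarrow> positive_divisor_chains (Suc K)"
  proof
    fix x assume x: "x \<in> positive_divisor_chains K \<times> {1::nat..}"
    obtain ds m where [simp]: "x = (ds, m)" by (cases x)
    have ds: "sorted_wrt (\<lambda>a b. b dvd a) ds" "\<forall>d\<in>set ds. d > 0" "length ds = K" and m: "m > 0"
      using x by (auto simp: positive_divisor_chains_def divisor_chain_def)
    have "sorted_wrt (\<lambda>a b. m * b dvd m * a) ds"
      by (rule sorted_wrt_mono_rel[OF _ ds(1)]) simp
    hence "sorted_wrt (\<lambda>a b. b dvd a) (map ((*) m) ds)" by (simp only: sorted_wrt_map)
    thus "(case x of (ds, m) \<Rightarrow> map ((*) m) (ds @ [1])) \<in> positive_divisor_chains (Suc K)"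
      using ds m by (auto simp: positive_divisor_chains_def divisor_chain_def sorted_wrt_append)
  qed
  show "(\<lambda>ds. (map (\<lambda>d. d div last ds) (butlast ds), last ds)) \<in> positive_divisor_chains (Suc K) \<rightarrow> positive_divisor_chains K \<times> {1..}"
  proof
    fix es assume es: "es \<in> positive_divisor_chains (Suc K)"
    then obtain ds m where e: "es = ds @ [m]" by (cases es rule: rev_cases) (auto simp: positive_divisor_chains_def)
    have d: "sorted_wrt (\<lambda>a b. b dvd a) ds" "\<forall>d\<in>set ds. m dvd d \<and> d > 0" "m > 0" "length ds = K"
      using es by (auto simp: e positive_divisor_chains_def divisor_chain_def sorted_wrt_append)
    have "sorted_wrt (\<lambda>a b. b div m dvd a div m) ds"
      by (rule sorted_wrt_mono_rel[OF _ d(1)]) (use d in \<open>auto intro: div_dvd_div[THEN iffD2]\<close>)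
    moreover have "d div m > 0" if "d \<in> set ds" for d
      using d(2,3) that by (auto simp: div_greater_zero_iff intro: dvd_imp_le)
    ultimately show "(map (\<lambda>d. d div last es) (butlast es), last es) \<in> positive_divisor_chains K \<times> {1..}"
      using d by (auto simp: e positive_divisor_chains_def divisor_chain_def sorted_wrt_map)
  qed
  show "(map (\<lambda>d. d div last ((\<lambda>(ds, m). map ((*) m) (ds @ [1])) x)) (butlast ((\<lambda>(ds, m). map ((*) m) (ds @ [1])) x)),
      last ((\<lambda>(ds, m). map ((*) m) (ds @ [1])) x)) = x" if "x \<in> positive_divisor_chains K \<times> {1..}" for x
    using that by (cases x) (auto simp: butlast_append o_def)
  show "(\<lambda>(ds, m). map ((*) m) (ds @ [1])) (map (\<lambda>d. d div last es) (butlast es), last es) = es"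
    if es: "es \<in> positive_divisor_chains (Suc K)" for es
  proof -
    obtain ds m where e: "es = ds @ [m]" using es by (cases es rule: rev_cases) (auto simp: positive_divisor_chains_def)
    have "\<forall>d\<in>set ds. m dvd d" using es by (auto simp: e positive_divisor_chains_def divisor_chain_def sorted_wrt_append)
    hence "map (\<lambda>d. m * (d div m)) ds = ds" by (auto intro!: map_idI)
    thus ?thesis by (simp add: e o_def)
  qed
qed

lemma has_sum_product_complex:
  fixes f :: "'a \<Rightarrow> complex" and g :: "'b \<Rightarrow> complex"
  assumes f: "(f has_sum a) A" and g: "(g has_sum b) B"
  shows "((\<lambda>(x, y). f x * g y) has_sum (a * b)) (A \<times> B)"
proof (rule has_sum_SigmaI)
  show "((\<lambda>y. case (x, y) of (x, y) \<Rightarrow> f x * g y) has_sum f x * b) B" for x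
    using has_sum_cmult_right[OF g, of "f x"] by simp
  show "((\<lambda>x. f x * b) has_sum a * b) A" by (rule has_sum_cmult_left[OF f])
  have fa: "(\<lambda>x. norm (f x)) summable_on A" and ga: "(\<lambda>x. norm (g x)) summable_on B"
    using f g summable_on_iff_abs_summable_on_complex has_sum_imp_summable by blast+
  have "(\<lambda>p. norm (case p of (x, y) \<Rightarrow> f x * g y)) summable_on A \<times> B"
  proof (rule summable_on_SigmaI)
    show "((\<lambda>y. norm (case (x, y) of (x, y) \<Rightarrow> f x * g y)) has_sum (norm (f x) * infsum (\<lambda>y. norm (g y)) B)) B" for x
      using has_sum_cmult_right[OF has_sum_infsum[OF ga], of "norm (f x)"] by (simp add: norm_mult)
    show "(\<lambda>x. norm (f x) * infsum (\<lambda>y. norm (g y)) B) summable_on A"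
      using fa by (rule summable_on_cmult_left)
  qed simp
  thus "(\<lambda>(x, y). f x * g y) summable_on A \<times> B" by (rule abs_summable_summable)
qed

definition nat_weight :: "complex \<Rightarrow> nat \<Rightarrow> complex" where
  "nat_weight s n = 1 / of_nat n powr s"

lemma nat_weight_mult: "a > 0 \<Longrightarrow> b > 0 \<Longrightarrow> nat_weight s (a * b) = nat_weight s a * nat_weight s b"
proof -
  assume "a > 0" "b > 0"
  moreover from this have "Ln (of_nat (a * b) :: complex) = Ln (of_nat a) + Ln (of_nat b)"
    by (subst (1 2 3) Ln_of_nat) (simp_all add: ln_mult)
  ultimately show "nat_weight s (a * b) = nat_weight s a * nat_weight s b"
    by (simp add: nat_weight_def powr_def exp_add distrib_left del: of_nat_mult)
qed

lemma nat_weight_power: "a > 0 \<Longrightarrow> nat_weight s (a ^ k) = nat_weight (of_nat k * s) a"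
  using Ln_of_nat[of "a ^ k"] by (simp add: nat_weight_def powr_def Ln_of_nat ln_realpow mult_ac)

lemma riemann_zeta_has_sum:
  assumes "Re s > 1"
  shows "(nat_weight s has_sum riemann_zeta s) {1..}"
proof -
  have sm: "(\<lambda>n. nat_weight s (Suc n)) sums riemann_zeta s"
    using riemann_zeta_sums[OF assms] by (simp add: nat_weight_def)
  have "norm (nat_weight s (Suc n)) = real (Suc n) powr (- Re s)" for n
    using norm_powr_real_powr[of "of_nat (Suc n)" s] by (simp add: nat_weight_def norm_divide powr_minus_divide)
  hence "summable (\<lambda>n. norm (nat_weight s (Suc n)))"
    using summable_Suc_powr[of "- Re s"] assms by simp
  from norm_summable_imp_has_sum[OF this sm]
  have "((\<lambda>n. nat_weight s (Suc n)) has_sum riemann_zeta s) UNIV" .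
  moreover have "bij_betw Suc UNIV {1..}"
    by (auto simp: bij_betw_def image_iff Suc_le_eq gr0_conv_Suc)
  ultimately show ?thesis using has_sum_reindex_bij_betw[of Suc UNIV "{1..}" "nat_weight s"] by simp
qed

text \<open>
  The last entry \<open>m\<close> of a chain of length \<open>K + 1\<close> divides all entries, so splitting it off divides the
  product of the chain by \<open>m ^ (K + 1)\<close>; the sum over \<open>m\<close> is \<open>\<zeta>((K + 1) s)\<close>.
\<close>
lemma has_sum_positive_divisor_chains:
  assumes s: "Re s > 1"
  shows "((\<lambda>ds. nat_weight s (prod_list ds)) has_sum (\<Prod>i<K. riemann_zeta (of_nat (1 + i) * s))) (positive_divisor_chains K)"
proof (induction K)
  case 0
  have "positive_divisor_chains 0 = {[]}" by (auto simp: positive_divisor_chains_def divisor_chain_def)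
  thus ?case by (simp add: nat_weight_def has_sum_finite_iff)
next
  case (Suc K)
  have "Re s \<le> (1 + real K) * Re s" using s by (simp add: distrib_right)
  hence "(1 + real K) * Re s > 1" using s by linarith
  hence "Re (of_nat (Suc K) * s) > 1" by simp
  from has_sum_product_complex[OF Suc riemann_zeta_has_sum[OF this]]
  have "((\<lambda>(ds, m). nat_weight s (prod_list ds) * nat_weight (of_nat (Suc K) * s) m) has_sum
     (\<Prod>i<Suc K. riemann_zeta (of_nat (1 + i) * s))) (positive_divisor_chains K \<times> {1..})" by simp
  also have "?this \<longleftrightarrow> ((\<lambda>x. nat_weight s (prod_list ((\<lambda>(ds, m). map ((*) m) (ds @ [1])) x))) has_sum
     (\<Prod>i<Suc K. riemann_zeta (of_nat (1 + i) * s))) (positive_divisor_chains K \<times> {1..})"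
  proof (intro has_sum_cong)
    fix x assume x: "x \<in> positive_divisor_chains K \<times> {1::nat..}"
    obtain ds m where [simp]: "x = (ds, m)" by (cases x)
    have m: "m > 0" and l: "length ds = K" and "0 \<notin> set ds"
      using x by (auto simp: positive_divisor_chains_def)
    hence p: "prod_list ds > 0" by (metis neq0_conv prod_list_zero_iff)
    have "prod_list (map ((*) m) (ds @ [1])) = m ^ Suc K * prod_list ds"
      using prod_list_map_mult[of m "ds @ [1]"] l by simp
    hence "nat_weight s (prod_list (map ((*) m) (ds @ [1]))) = nat_weight s (m ^ Suc K) * nat_weight s (prod_list ds)"
      using m p by (simp only: nat_weight_mult zero_less_power)
    thus "(case x of (ds, m) \<Rightarrow> nat_weight s (prod_list ds) * nat_weight (of_nat (Suc K) * s) m) =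
       nat_weight s (prod_list ((\<lambda>(ds, m). map ((*) m) (ds @ [1])) x))"
      using m by (simp only: nat_weight_power split: prod.split) (simp add: mult.commute)
  qed
  also have "\<dots> \<longleftrightarrow> ?case"
    by (rule has_sum_reindex_bij_betw[OF bij_betw_extend_divisor_chain])
  finally show ?case .
qed

lemma length_le_prod_list: "\<forall>d\<in>set ds. d > (1::nat) \<Longrightarrow> length ds < prod_list ds"
proof (induction ds)
  case (Cons d ds)
  hence "Suc (length ds) \<le> 1 * prod_list ds" by simp
  also have "\<dots> < d * prod_list ds"
  proof (rule mult_strict_right_mono)
    have "length ds < prod_list ds" using Cons by simp
    thus "prod_list ds > 0" by linarith
  qed (use Cons in simp)
  finally show ?case by simp
qed simp

definition positive_chain_count :: "nat \<Rightarrow> nat \<Rightarrow> nat" where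
  "positive_chain_count K n = card {ds \<in> positive_divisor_chains K. prod_list ds = n}"

lemma finite_invariant_factors:
  assumes "n > 0"
  shows "finite (invariant_factors n)"
proof (rule finite_subset)
  show "invariant_factors n \<subseteq> {ds. set ds \<subseteq> {..n} \<and> length ds \<le> n}"
  proof
    fix ds assume ds: "ds \<in> invariant_factors n"
    have "d \<le> n" if "d \<in> set ds" for d
      using ds that assms prod_list_dvd[of d ds] by (auto simp: invariant_factors_def intro!: dvd_imp_le)
    thus "ds \<in> {ds. set ds \<subseteq> {..n} \<and> length ds \<le> n}"
      using ds length_le_prod_list[of ds] by (auto simp: invariant_factors_def)
  qed
qed (simp add: finite_lists_length_le)

text \<open>In a divisor chain the entries equal to \<open>1\<close> come last.\<close>
lemma bij_betw_pad_invariant_factors: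
  assumes n: "n > 0"
  shows "bij_betw (\<lambda>es. es @ replicate (K - length es) 1) {es \<in> invariant_factors n. length es \<le> K}
     {ds \<in> positive_divisor_chains K. prod_list ds = n}"
proof (rule bij_betwI[where g = "filter (\<lambda>d. d > 1)"])
  show "(\<lambda>es. es @ replicate (K - length es) 1) \<in> {es \<in> invariant_factors n. length es \<le> K} \<rightarrow>
     {ds \<in> positive_divisor_chains K. prod_list ds = n}"
  proof
    fix es assume es: "es \<in> {es \<in> invariant_factors n. length es \<le> K}"
    have "sorted_wrt (\<lambda>a b. b dvd a) (replicate j (1::nat))" for j by (induction j) auto
    thus "es @ replicate (K - length es) 1 \<in> {ds \<in> positive_divisor_chains K. prod_list ds = n}"
      using es by (fastforce simp: invariant_factors_def positive_divisor_chains_def divisor_chain_def sorted_wrt_append)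
  qed
  show "filter (\<lambda>d. d > 1) \<in> {ds \<in> positive_divisor_chains K. prod_list ds = n} \<rightarrow> {es \<in> invariant_factors n. length es \<le> K}"
  proof
    fix ds assume ds: "ds \<in> {ds \<in> positive_divisor_chains K. prod_list ds = n}"
    have "\<forall>d\<in>set ds. d > 0 \<Longrightarrow> prod_list (filter (\<lambda>d. d > 1) ds) = prod_list ds"
      by (induction ds) (auto simp: not_less le_Suc_eq)
    thus "filter (\<lambda>d. d > 1) ds \<in> {es \<in> invariant_factors n. length es \<le> K}"
      using ds by (auto simp: invariant_factors_def positive_divisor_chains_def divisor_chain_def sorted_wrt_filter)
  qed
  show "filter (\<lambda>d. d > 1) (es @ replicate (K - length es) 1) = es" if "es \<in> {es \<in> invariant_factors n. length es \<le> K}" for es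
    using that by (auto simp: invariant_factors_def intro!: filter_True)
  show "filter (\<lambda>d. d > 1) ds @ replicate (K - length (filter (\<lambda>d. d > 1) ds)) 1 = ds"
    if "ds \<in> {ds \<in> positive_divisor_chains K. prod_list ds = n}" for ds
  proof -
    have "filter (\<lambda>d. d > 1) ds @ replicate (length ds - length (filter (\<lambda>d. d > 1) ds)) 1 = ds"
      if "sorted_wrt (\<lambda>a b. b dvd a) ds" "\<forall>d\<in>set ds. d > 0" for ds :: "nat list"
      using that
    proof (induction ds)
      case (Cons d ds)
      show ?case
      proof (cases "d = 1")
        case False
        hence "d > 1" using Cons.prems by simp
        thus ?thesis using Cons by simp
      next
        case True
        hence one: "\<forall>e\<in>set ds. e = 1" using Cons.prems by auto
        hence "replicate (length ds) 1 = ds" using replicate_eqI[of ds "length ds" 1] by simp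
        moreover have "filter (\<lambda>d. d > 1) (d # ds) = []" using True one by (auto simp: filter_empty_conv)
        ultimately show ?thesis using True by simp
      qed
    qed simp
    thus ?thesis using that by (auto simp: positive_divisor_chains_def divisor_chain_def)
  qed
qed

lemma positive_chain_count_le: "n > 0 \<Longrightarrow> positive_chain_count K n \<le> num_abelian_groups n"
  unfolding positive_chain_count_def bij_betw_same_card[OF bij_betw_pad_invariant_factors, symmetric]
    num_abelian_groups_eq_card_invariant_factors
  by (intro card_mono finite_invariant_factors) auto

lemma positive_chain_count_eq:
  assumes "n > 0" "n \<le> K"
  shows "positive_chain_count K n = num_abelian_groups n"
proof -
  have "{es \<in> invariant_factors n. length es \<le> K} = invariant_factors n"
    using length_le_prod_list assms by (fastforce simp: invariant_factors_def)
  thus ?thesis using assms bij_betw_same_card[OF bij_betw_pad_invariant_factors[OF assms(1), of K]]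
    by (simp add: positive_chain_count_def num_abelian_groups_eq_card_invariant_factors)
qed

lemma positive_chain_count_0: "positive_chain_count K 0 = 0"
proof -
  have "{ds \<in> positive_divisor_chains K. prod_list ds = 0} = {}"
    by (auto simp: positive_divisor_chains_def prod_list_zero_iff)
  thus ?thesis by (simp only: positive_chain_count_def card.empty)
qed

lemma positive_chain_count_sums:
  assumes s: "Re s > 1"
  shows "(\<lambda>n. of_nat (positive_chain_count K (Suc n)) * nat_weight s (Suc n)) sums (\<Prod>i<K. riemann_zeta (of_nat (1 + i) * s))"
proof -
  have "((\<lambda>p. nat_weight s (fst p)) has_sum (\<Prod>i<K. riemann_zeta (of_nat (1 + i) * s)))
     (SIGMA n:UNIV. {ds \<in> positive_divisor_chains K. prod_list ds = n})"
  proof (subst has_sum_reindex_bij_witness[of _ "\<lambda>ds. (prod_list ds, ds)" snd])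
    show "((\<lambda>ds. nat_weight s (prod_list ds)) has_sum (\<Prod>i<K. riemann_zeta (of_nat (1 + i) * s))) (positive_divisor_chains K)"
      by (rule has_sum_positive_divisor_chains[OF s])
  qed auto
  hence "((\<lambda>n. of_nat (positive_chain_count K n) * nat_weight s n) has_sum (\<Prod>i<K. riemann_zeta (of_nat (1 + i) * s))) UNIV"
  proof (rule has_sum_SigmaD)
    fix n
    have "finite {ds \<in> positive_divisor_chains K. prod_list ds = n}"
    proof (cases "n = 0")
      case True
      hence "{ds \<in> positive_divisor_chains K. prod_list ds = n} = {}"
        by (auto simp: positive_divisor_chains_def prod_list_zero_iff)
      thus ?thesis by (simp only: finite.emptyI)
    next
      case False
      thus ?thesis using bij_betw_finite[OF bij_betw_pad_invariant_factors[of n K]] finite_invariant_factors[of n] by simp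
    qed
    thus "((\<lambda>ds. nat_weight s (fst (n, ds))) has_sum of_nat (positive_chain_count K n) * nat_weight s n)
        {ds \<in> positive_divisor_chains K. prod_list ds = n}"
      by (simp add: has_sum_finite_iff positive_chain_count_def)
  qed
  hence "(\<lambda>n. of_nat (positive_chain_count K n) * nat_weight s n) sums (\<Prod>i<K. riemann_zeta (of_nat (1 + i) * s))"
    by (rule has_sum_imp_sums)
  thus ?thesis by (subst sums_Suc_iff) (simp add: positive_chain_count_0)
qed

text \<open>
  The first \<open>N\<close> terms only involve chains of length \<open>N\<close>, so their sum is bounded by a partial
  product of zeta values, and these partial products converge.
\<close>
lemma num_abelian_groups_abs_summable:
  assumes x: "x > 1"
  shows "summable (\<lambda>n. real (num_abelian_groups (Suc n)) * real (Suc n) powr (- x))"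
proof -
  define P where "P K = (\<Prod>i<K. Re (riemann_zeta (of_nat (1 + i) * of_real x)))" for K
  have w: "nat_weight (of_real x) (Suc n) = of_real (real (Suc n) powr (- x))" for n
    using powr_of_real[of "real (Suc n)" x] by (simp add: nat_weight_def powr_minus_divide)
  have PC: "(\<Prod>i<K. riemann_zeta (of_nat (1 + i) * of_real x)) = of_real (P K)" for K
    unfolding P_def of_real_prod
  proof (rule prod.cong)
    fix i show "riemann_zeta (of_nat (1 + i) * of_real x) = of_real (Re (riemann_zeta (of_nat (1 + i) * of_real x)))"
      using riemann_zeta_real[of "real (1 + i) * x"] by simp
  qed simp
  have "convergent (\<lambda>K. complex_of_real (P K))"
    unfolding PC[symmetric] by (rule convergentI, rule zeta_tail_LIMSEQ) (use x in simp)
  hence "Bseq (\<lambda>K. complex_of_real (P K))" by (rule convergent_imp_Bseq)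
  then obtain B where B: "\<And>K. norm (P K) \<le> B" by (auto simp: Bseq_def)
  have sums: "(\<lambda>n. real (positive_chain_count K (Suc n)) * real (Suc n) powr (- x)) sums P K" for K
  proof -
    have "(\<lambda>n. complex_of_real (real (positive_chain_count K (Suc n)) * real (Suc n) powr (- x))) sums of_real (P K)"
      using positive_chain_count_sums[of "of_real x" K] x unfolding PC w by simp
    thus ?thesis by (simp only: sums_of_real_iff)
  qed
  show ?thesis
  proof (rule summableI_nonneg_bounded)
    fix N
    have "(\<Sum>n<N. real (num_abelian_groups (Suc n)) * real (Suc n) powr (- x)) =
       (\<Sum>n<N. real (positive_chain_count N (Suc n)) * real (Suc n) powr (- x))"
      by (intro sum.cong) (auto simp: positive_chain_count_eq)
    also have "\<dots> \<le> P N"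
      unfolding sums_unique[OF sums[of N]] by (intro sum_le_suminf sums_summable[OF sums]) auto
    also have "\<dots> \<le> B" using B[of N] by simp
    finally show "(\<Sum>n<N. real (num_abelian_groups (Suc n)) * real (Suc n) powr (- x)) \<le> B" .
  qed simp
qed

text \<open>
  The partial product of \<open>K\<close> zeta factors counts chains of length \<open>K\<close>. For each \<open>n\<close> this count is
  eventually \<open>num_abelian_groups n\<close> and never exceeds it, so the limit can be taken term by term.
\<close>
theorem num_abelian_groups_sums:
  assumes s: "Re s > 1"
  shows "(\<lambda>n. of_nat (num_abelian_groups (Suc n)) * nat_weight s (Suc n)) sums zeta_tail 1 s"
proof -
  let ?M = "\<lambda>n. real (num_abelian_groups (Suc n)) * real (Suc n) powr (- Re s)"
  have nw: "norm (nat_weight s (Suc n)) = real (Suc n) powr (- Re s)" for n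
    using norm_powr_real_powr[of "of_nat (Suc n)" s] by (simp add: nat_weight_def norm_divide powr_minus_divide)
  have T: "\<forall>\<^sub>F K in sequentially. summable (\<lambda>n. norm (of_nat (positive_chain_count K (Suc n)) * nat_weight s (Suc n)))"
    "summable (\<lambda>n. norm (of_nat (num_abelian_groups (Suc n)) * nat_weight s (Suc n)))"
    "(\<lambda>K. \<Sum>n. of_nat (positive_chain_count K (Suc n)) * nat_weight s (Suc n)) \<longlonglongrightarrow>
        (\<Sum>n. of_nat (num_abelian_groups (Suc n)) * nat_weight s (Suc n))"
  proof -
    have "(\<forall>\<^sub>F K in sequentially. summable (\<lambda>n. norm (of_nat (positive_chain_count K (Suc n)) * nat_weight s (Suc n)))) \<and>
      summable (\<lambda>n. norm (of_nat (num_abelian_groups (Suc n)) * nat_weight s (Suc n))) \<and>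
      (\<lambda>K. \<Sum>n. of_nat (positive_chain_count K (Suc n)) * nat_weight s (Suc n)) \<longlonglongrightarrow>
        (\<Sum>n. of_nat (num_abelian_groups (Suc n)) * nat_weight s (Suc n))"
    proof (rule tannerys_theorem[where M = ?M])
      fix n
      have "\<forall>\<^sub>F K in sequentially. of_nat (positive_chain_count K (Suc n)) * nat_weight s (Suc n) =
          of_nat (num_abelian_groups (Suc n)) * nat_weight s (Suc n)"
        using eventually_ge_at_top[of "Suc n"] by eventually_elim (simp add: positive_chain_count_eq)
      thus "(\<lambda>K. of_nat (positive_chain_count K (Suc n)) * nat_weight s (Suc n)) \<longlonglongrightarrow>
          of_nat (num_abelian_groups (Suc n)) * nat_weight s (Suc n)"
        by (rule tendsto_eventually)
    next
      show "\<forall>\<^sub>F (n, K) in at_top \<times>\<^sub>F sequentially. norm (of_nat (positive_chain_count K (Suc n)) * nat_weight s (Suc n)) \<le> ?M n"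
        by (intro always_eventually) (auto simp: norm_mult nw positive_chain_count_le intro!: mult_right_mono)
      show "summable ?M" by (rule num_abelian_groups_abs_summable[OF s])
    qed simp
    thus "\<forall>\<^sub>F K in sequentially. summable (\<lambda>n. norm (of_nat (positive_chain_count K (Suc n)) * nat_weight s (Suc n)))"
    "summable (\<lambda>n. norm (of_nat (num_abelian_groups (Suc n)) * nat_weight s (Suc n)))"
    "(\<lambda>K. \<Sum>n. of_nat (positive_chain_count K (Suc n)) * nat_weight s (Suc n)) \<longlonglongrightarrow>
        (\<Sum>n. of_nat (num_abelian_groups (Suc n)) * nat_weight s (Suc n))" by auto
  qed
  have "(\<Sum>n. of_nat (positive_chain_count K (Suc n)) * nat_weight s (Suc n)) = (\<Prod>i<K. riemann_zeta (of_nat (1 + i) * s))" for K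
    using positive_chain_count_sums[OF s, of K] by (simp add: sums_iff)
  with T(3) have "(\<lambda>K. \<Prod>i<K. riemann_zeta (of_nat (1 + i) * s)) \<longlonglongrightarrow> (\<Sum>n. of_nat (num_abelian_groups (Suc n)) * nat_weight s (Suc n))"
    by simp
  moreover have "(\<lambda>K. \<Prod>i<K. riemann_zeta (of_nat (1 + i) * s)) \<longlonglongrightarrow> zeta_tail 1 s"
    by (rule zeta_tail_LIMSEQ) (use s in simp)
  ultimately have "(\<Sum>n. of_nat (num_abelian_groups (Suc n)) * nat_weight s (Suc n)) = zeta_tail 1 s"
    by (rule LIMSEQ_unique)
  thus ?thesis using summable_sums[OF summable_norm_cancel[OF T(2)]] by simp
qed

section \<open>Continuation of the Dirichlet series and its poles\<close>

lemma zeta_tail_abs_summable: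
  assumes m: "real m * Re s > 1"
  shows "summable (\<lambda>i. norm (riemann_zeta (of_nat (m + i) * s) - 1))"
proof -
  have s: "Re s > 0" using m by (rule pos_if_of_nat_mult_gt_one)
  obtain C where C: "\<And>i. norm (riemann_zeta (of_nat (m + i) * s) - 1) \<le> C * 2 powr (- (real m * Re s)) * (2 powr (- Re s)) ^ i"
    using zeta_tail_factor_bound[OF m] by (metis order_refl)
  have "2 powr (- Re s) < (1::real)" using s by (simp add: powr_less_one)
  hence "summable (\<lambda>i. C * 2 powr (- (real m * Re s)) * (2 powr (- Re s)) ^ i)"
    by (intro summable_mult summable_geometric) simp
  thus ?thesis by (rule summable_comparison_test'[of _ 0]) (use C in simp)
qed

text \<open>
  The continuation of the Dirichlet series to \<open>Re s > 1 / 7\<close>: the first six factors are taken out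
  of the product because their poles lie in this half-plane.
\<close>
definition abelian_zeta :: "complex \<Rightarrow> complex" where
  "abelian_zeta s = (\<Prod>k=1..6. riemann_zeta (of_nat k * s)) * zeta_tail 7 s"

lemma zeta_tail_1_eq_abelian_zeta:
  assumes "Re s > 1"
  shows "zeta_tail 1 s = abelian_zeta s"
proof -
  have "real m * Re s > 1" if "m > 0" for m
  proof -
    have "1 * Re s \<le> real m * Re s" using that assms by (intro mult_right_mono) auto
    thus ?thesis using assms by linarith
  qed
  hence r: "zeta_tail m s = riemann_zeta (of_nat m * s) * zeta_tail (Suc m) s" if "m > 0" for m
    using that by (intro zeta_tail_rec)
  have "zeta_tail 1 s = (\<Prod>k=1..n. riemann_zeta (of_nat k * s)) * zeta_tail (Suc n) s" for n
  proof (induction n)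
    case (Suc n)
    show ?case unfolding Suc r[of "Suc n", OF zero_less_Suc] by simp
  qed simp
  from this[of 6] show ?thesis by (simp add: abelian_zeta_def)
qed

lemma of_real_main_coeff:
  assumes k: "k \<in> {1..6}"
  shows "complex_of_real (main_coeff k) =
    (\<Prod>j\<in>{1..6} - {k}. riemann_zeta (of_nat j / of_nat k)) * zeta_tail 7 (1 / of_nat k)"
proof -
  define r where "r i = (if Suc i = k then 1 else Re (riemann_zeta (of_nat (Suc i) / of_nat k)))" for i
  have rc: "complex_of_real (r i) = (if Suc i = k then 1 else riemann_zeta (of_nat (Suc i) / of_nat k))" for i
    using riemann_zeta_real[of "real (Suc i) / real k"] by (simp add: r_def)
  have s: "real 7 * Re (1 / of_nat k) > 1" using k by (simp add: Re_divide_of_nat)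
  have r7: "complex_of_real (r (i + 6)) = riemann_zeta (of_nat (7 + i) * (1 / of_nat k))" for i
    using k by (simp add: rc add_ac)
  have "summable (\<lambda>i. norm (r (i + 6) - 1))"
  proof -
    have "norm (r (i + 6) - 1) = norm (riemann_zeta (of_nat (7 + i) * (1 / of_nat k)) - 1)" for i
      unfolding r7[symmetric] by (metis norm_of_real of_real_1 of_real_diff real_norm_def)
    thus ?thesis using zeta_tail_abs_summable[OF s] by simp
  qed
  hence "convergent_prod (\<lambda>i. r (i + 6))"
    by (intro abs_convergent_prod_imp_convergent_prod summable_imp_abs_convergent_prod)
  hence "convergent_prod r" by simp
  from convergent_prod_LIMSEQ[OF this] have "(\<lambda>n. \<Prod>i<Suc n. r i) \<longlonglongrightarrow> main_coeff k"
    unfolding main_coeff_def r_def lessThan_Suc_atMost .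
  hence "(\<lambda>n. \<Prod>i<n. r i) \<longlonglongrightarrow> main_coeff k" by (rule LIMSEQ_imp_Suc)
  hence "(\<lambda>n. \<Prod>i<n + 6. r i) \<longlonglongrightarrow> main_coeff k" by (rule LIMSEQ_ignore_initial_segment)
  hence "(\<lambda>n. complex_of_real (\<Prod>i<n + 6. r i)) \<longlonglongrightarrow> of_real (main_coeff k)" by (rule tendsto_of_real)
  moreover have "complex_of_real (\<Prod>i<n + 6. r i) =
     (\<Prod>j\<in>{1..6} - {k}. riemann_zeta (of_nat j / of_nat k)) * (\<Prod>i<n. riemann_zeta (of_nat (7 + i) * (1 / of_nat k)))" for n
  proof -
    have "(\<Prod>i<n + 6. r i) = (\<Prod>i<6. r i) * (\<Prod>i<n. r (i + 6))"
    proof (induction n)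
      case (Suc n)
      have "(\<Prod>i<Suc n + 6. r i) = (\<Prod>i<n + 6. r i) * r (n + 6)" by (simp only: add_Suc prod.lessThan_Suc)
      thus ?case unfolding Suc by (simp only: prod.lessThan_Suc mult.assoc)
    qed simp
    hence "complex_of_real (\<Prod>i<n + 6. r i) = (\<Prod>i<6. of_real (r i)) * (\<Prod>i<n. of_real (r (i + 6)))" by simp
    also have "(\<Prod>i<6. complex_of_real (r i)) = (\<Prod>j=1..6. if j = k then 1 else riemann_zeta (of_nat j / of_nat k))"
      unfolding rc by (rule prod.reindex_bij_witness[of _ "\<lambda>j. j - 1" Suc]) auto
    also have "\<dots> = (\<Prod>j\<in>{1..6} - {k}. riemann_zeta (of_nat j / of_nat k))"
      by (subst prod.remove[of _ k]) (use k in \<open>auto intro!: prod.cong\<close>)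
    finally show ?thesis by (simp only: r7)
  qed
  ultimately have "(\<lambda>n. (\<Prod>j\<in>{1..6} - {k}. riemann_zeta (of_nat j / of_nat k)) *
      (\<Prod>i<n. riemann_zeta (of_nat (7 + i) * (1 / of_nat k)))) \<longlonglongrightarrow> of_real (main_coeff k)" by (simp only:)
  moreover have "(\<lambda>n. (\<Prod>j\<in>{1..6} - {k}. riemann_zeta (of_nat j / of_nat k)) *
      (\<Prod>i<n. riemann_zeta (of_nat (7 + i) * (1 / of_nat k)))) \<longlonglongrightarrow>
      (\<Prod>j\<in>{1..6} - {k}. riemann_zeta (of_nat j / of_nat k)) * zeta_tail 7 (1 / of_nat k)"
    by (intro tendsto_intros zeta_tail_LIMSEQ s)
  ultimately show ?thesis by (rule LIMSEQ_unique)
qed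

lemma holomorphic_extend_finite:
  assumes "finite P" "open S" "h holomorphic_on S - P"
    "\<And>p. p \<in> P \<Longrightarrow> p \<in> S \<Longrightarrow> ((\<lambda>z. (z - p) * h z) \<longlongrightarrow> 0) (at p)"
  shows "\<exists>g. g holomorphic_on S \<and> (\<forall>z\<in>S - P. g z = h z)"
  using assms
proof (induction P arbitrary: h rule: finite_induct)
  case (insert p P)
  have op: "open (S - P)" using insert by (intro open_Diff finite_imp_closed)
  obtain h' where h': "h' holomorphic_on S - P" "\<forall>z\<in>S - P - {p}. h' z = h z"
  proof (cases "p \<in> S")
    case True
    have "h holomorphic_on (S - P) - {p}" by (rule holomorphic_on_subset[OF insert.prems(2)]) auto
    moreover have "p \<in> interior (S - P)" using True insert.hyps op by (simp add: interior_open)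
    ultimately show ?thesis
      using holomorphic_on_extend_lim[of h "S - P" p] insert.prems(3)[of p] True that by auto
  next
    case False
    thus ?thesis using insert.prems(2) by (intro that[of h]) auto
  qed
  have "((\<lambda>z. (z - q) * h' z) \<longlongrightarrow> 0) (at q)" if "q \<in> P" "q \<in> S" for q
  proof -
    have "\<forall>\<^sub>F z in at q. z \<in> (S - insert p P) - {q} \<union> {}"
    proof -
      have "open (S - (insert p P - {q}))" using insert by (intro open_Diff finite_imp_closed) auto
      moreover have "q \<in> S - (insert p P - {q})" using that by auto
      ultimately have "\<forall>\<^sub>F z in at q. z \<in> (S - (insert p P - {q})) - {q}" by (rule eventually_at_in_open)
      thus ?thesis by eventually_elim auto
    qed
    hence "\<forall>\<^sub>F z in at q. (z - q) * h z = (z - q) * h' z"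
      by eventually_elim (use h'(2) in auto)
    thus ?thesis using Lim_transform_eventually[OF insert.prems(3)[of q]] that by simp
  qed
  then obtain g where "g holomorphic_on S" "\<forall>z\<in>S - P. g z = h' z"
    using insert.IH[OF insert.prems(1) h'(1)] by blast
  thus ?case using h'(2) by (intro exI[of _ g]) auto
qed auto

lemma holomorphic_subtract_simple_poles:
  fixes L :: "complex \<Rightarrow> complex"
  assumes P: "finite P" and S: "open S" and f: "f holomorphic_on S - P"
    and lim: "\<And>p. p \<in> P \<Longrightarrow> ((\<lambda>z. (z - p) * f z) \<longlongrightarrow> L p) (at p)"
  shows "\<exists>g. g holomorphic_on S \<and> (\<forall>z\<in>S - P. g z = f z - (\<Sum>p\<in>P. L p / (z - p)))"
proof (rule holomorphic_extend_finite[OF P S])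
  show "(\<lambda>z. f z - (\<Sum>p\<in>P. L p / (z - p))) holomorphic_on S - P"
    by (intro holomorphic_intros f) auto
  fix p assume p: "p \<in> P"
  have "((\<lambda>z. (z - p) * f z - L p - (z - p) * (\<Sum>q\<in>P - {p}. L q / (z - q))) \<longlongrightarrow>
     L p - L p - (p - p) * (\<Sum>q\<in>P - {p}. L q / (p - q))) (at p)"
    using p by (intro tendsto_intros lim) auto
  moreover have "\<forall>\<^sub>F z in at p. (z - p) * f z - L p - (z - p) * (\<Sum>q\<in>P - {p}. L q / (z - q)) =
     (z - p) * (f z - (\<Sum>p\<in>P. L p / (z - p)))"
  proof -
    have "\<forall>\<^sub>F z in at p. z \<noteq> p" by (simp add: eventually_at_filter)
    thus ?thesis
    proof eventually_elim
      case (elim z)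
      have "(\<Sum>p\<in>P. L p / (z - p)) = L p / (z - p) + (\<Sum>q\<in>P - {p}. L q / (z - q))"
        using P p by (rule sum.remove)
      hence "(z - p) * (f z - (\<Sum>p\<in>P. L p / (z - p))) =
        (z - p) * f z - (z - p) * (L p / (z - p)) - (z - p) * (\<Sum>q\<in>P - {p}. L q / (z - q))"
        by (simp only: right_diff_distrib distrib_left diff_diff_eq)
      thus ?case using elim by simp
    qed
  qed
  ultimately show "((\<lambda>z. (z - p) * (f z - (\<Sum>p\<in>P. L p / (z - p)))) \<longlongrightarrow> 0) (at p)"
    using Lim_transform_eventually by force
qed

lemma isCont_riemann_zeta: "w \<noteq> 1 \<Longrightarrow> isCont riemann_zeta w"
  by (rule continuous_on_interior[OF holomorphic_on_imp_continuous_on[OF holomorphic_riemann_zeta]])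
     (simp add: interior_open open_Compl)

lemma isCont_zeta_tail: "m > 0 \<Longrightarrow> Re s > 1 / real m \<Longrightarrow> isCont (zeta_tail m) s"
  by (rule continuous_on_interior[OF holomorphic_on_imp_continuous_on[OF holomorphic_zeta_tail]])
     (simp_all add: interior_open open_halfspace_Re_gt)

text \<open>
  At \<open>1 / k\<close> only the factor \<open>\<zeta>(k s)\<close> has a pole. Its residue \<open>1 / k\<close> cancels against the division by
  \<open>s\<close>, and the other factors give \<open>main_coeff k\<close>.
\<close>
lemma abelian_zeta_pole:
  assumes k: "k \<in> {1..6}"
  shows "((\<lambda>s. (s - 1 / of_nat k) * (abelian_zeta s / s)) \<longlongrightarrow> of_real (main_coeff k)) (at (1 / of_nat k))"
proof -
  let ?p = "1 / of_nat k :: complex"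
  have k0: "of_nat k \<noteq> (0::complex)" using k by simp
  have j: "isCont (\<lambda>s. riemann_zeta (of_nat j * s)) ?p" if "j \<in> {1..6} - {k}" for j
  proof -
    have "of_nat j * ?p \<noteq> 1" using that k0 by (simp add: field_simps)
    hence "isCont riemann_zeta (of_nat j * ?p)" by (rule isCont_riemann_zeta)
    thus ?thesis by (intro isCont_o2[of _ "\<lambda>s. of_nat j * s" riemann_zeta] continuous_intros)
  qed
  have "filterlim (\<lambda>s. of_nat k * s) (at 1) (at ?p)"
    unfolding filterlim_at
  proof
    have "((\<lambda>s. of_nat k * s) \<longlongrightarrow> of_nat k * ?p) (at ?p)" by (intro tendsto_intros)
    thus "((\<lambda>s. of_nat k * s) \<longlongrightarrow> 1) (at ?p)" using k0 by simp
    show "\<forall>\<^sub>F s in at ?p. of_nat k * s \<in> UNIV \<and> of_nat k * s \<noteq> 1"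
      using k0 by (auto simp: eventually_at_filter field_simps)
  qed
  from filterlim_compose[OF riemann_zeta_pole this]
  have 1: "((\<lambda>s. (of_nat k * s - 1) * riemann_zeta (of_nat k * s)) \<longlongrightarrow> 1) (at ?p)" .
  have 2: "((\<lambda>s. 1 / (of_nat k * s)) \<longlongrightarrow> 1 / (of_nat k * ?p)) (at ?p)"
    using k0 by (intro tendsto_intros) auto
  have "((\<lambda>s. ((of_nat k * s - 1) * riemann_zeta (of_nat k * s)) * (1 / (of_nat k * s)) *
       (\<Prod>j\<in>{1..6} - {k}. riemann_zeta (of_nat j * s)) * zeta_tail 7 s) \<longlongrightarrow>
     1 * (1 / (of_nat k * ?p)) * (\<Prod>j\<in>{1..6} - {k}. riemann_zeta (of_nat j * ?p)) * zeta_tail 7 ?p) (at ?p)"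
  proof (intro tendsto_mult 1 2 tendsto_prod)
    show "((\<lambda>s. riemann_zeta (of_nat j * s)) \<longlongrightarrow> riemann_zeta (of_nat j * ?p)) (at ?p)" if "j \<in> {1..6} - {k}" for j
      using j[OF that] by (simp add: isCont_def)
    show "(zeta_tail 7 \<longlongrightarrow> zeta_tail 7 ?p) (at ?p)"
      using isCont_zeta_tail[of 7 ?p] k by (simp add: isCont_def Re_divide_of_nat)
  qed
  also have "1 * (1 / (of_nat k * ?p)) * (\<Prod>j\<in>{1..6} - {k}. riemann_zeta (of_nat j * ?p)) * zeta_tail 7 ?p = of_real (main_coeff k)"
    using k0 by (simp add: of_real_main_coeff[OF k])
  also have "(\<lambda>s. ((of_nat k * s - 1) * riemann_zeta (of_nat k * s)) * (1 / (of_nat k * s)) *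
       (\<Prod>j\<in>{1..6} - {k}. riemann_zeta (of_nat j * s)) * zeta_tail 7 s) = (\<lambda>s. (s - ?p) * (abelian_zeta s / s))"
  proof
    fix s
    have "abelian_zeta s = riemann_zeta (of_nat k * s) * (\<Prod>j\<in>{1..6} - {k}. riemann_zeta (of_nat j * s)) * zeta_tail 7 s"
      unfolding abelian_zeta_def by (subst prod.remove[OF _ k]) simp_all
    moreover have "(of_nat k * s - 1) * (1 / (of_nat k * s)) = (s - ?p) / s"
      using k0 by (cases "s = 0") (simp_all add: field_simps)
    moreover have "((of_nat k * s - 1) * riemann_zeta (of_nat k * s)) * (1 / (of_nat k * s)) *
       (\<Prod>j\<in>{1..6} - {k}. riemann_zeta (of_nat j * s)) * zeta_tail 7 s = ((of_nat k * s - 1) * (1 / (of_nat k * s))) *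
       (riemann_zeta (of_nat k * s) * (\<Prod>j\<in>{1..6} - {k}. riemann_zeta (of_nat j * s)) * zeta_tail 7 s)"
      by (simp only: mult_ac)
    ultimately have "((of_nat k * s - 1) * riemann_zeta (of_nat k * s)) * (1 / (of_nat k * s)) *
       (\<Prod>j\<in>{1..6} - {k}. riemann_zeta (of_nat j * s)) * zeta_tail 7 s = (s - ?p) / s * abelian_zeta s"
      by (simp only:)
    thus "((of_nat k * s - 1) * riemann_zeta (of_nat k * s)) * (1 / (of_nat k * s)) *
       (\<Prod>j\<in>{1..6} - {k}. riemann_zeta (of_nat j * s)) * zeta_tail 7 s = (s - ?p) * (abelian_zeta s / s)"
      by (simp only: times_divide_eq_left times_divide_eq_right)
  qed
  finally show ?thesis .
qed

definition abelian_poles :: "complex set" where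
  "abelian_poles = (\<lambda>k. 1 / of_nat k) ` {1..6}"

lemma holomorphic_abelian_zeta: "abelian_zeta holomorphic_on {s. Re s > 1 / 7} - abelian_poles"
proof -
  have "(\<lambda>s. riemann_zeta (of_nat k * s)) holomorphic_on {s. Re s > 1 / 7} - abelian_poles" if k: "k \<in> {1..6}" for k
  proof -
    have "of_nat k * s \<noteq> 1" if "s \<notin> abelian_poles" for s
    proof
      assume "of_nat k * s = 1"
      hence "s = 1 / of_nat k" using k by (auto simp: field_simps)
      thus False using that k by (auto simp: abelian_poles_def)
    qed
    hence "riemann_zeta holomorphic_on ((\<lambda>s. of_nat k * s) ` ({s. Re s > 1 / 7} - abelian_poles))"
      by (intro holomorphic_on_subset[OF holomorphic_riemann_zeta]) auto
    moreover have "(\<lambda>s. of_nat k * s) holomorphic_on {s. Re s > 1 / 7} - abelian_poles" by (intro holomorphic_intros)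
    ultimately show ?thesis
      using holomorphic_on_compose[of "\<lambda>s. of_nat k * s" "{s. Re s > 1 / 7} - abelian_poles" riemann_zeta]
      by (simp add: o_def)
  qed
  moreover have "zeta_tail 7 holomorphic_on {s. Re s > 1 / 7} - abelian_poles"
    by (rule holomorphic_on_subset[OF holomorphic_zeta_tail[of 7]]) auto
  ultimately show ?thesis
    unfolding abelian_zeta_def by (intro holomorphic_on_mult holomorphic_on_prod)
qed

text \<open>
  The main terms in the definition of \<open>Delta\<close> correspond to the poles of \<open>abelian_zeta s / s\<close>, so removing
  them leaves a holomorphic function.
\<close>
theorem abelian_zeta_subtract_poles:
  obtains G where "G holomorphic_on {s. Re s > 1 / 7}"
    "\<And>s. Re s > 1 / 7 \<Longrightarrow> s \<notin> abelian_poles \<Longrightarrow>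
       G s = abelian_zeta s / s - (\<Sum>k=1..6. of_real (main_coeff k) / (s - 1 / of_nat k))"
proof -
  define idx where "idx = inv_into {1..6::nat} (\<lambda>k. 1 / of_nat k :: complex)"
  have inj: "inj_on (\<lambda>k. 1 / of_nat k :: complex) {1..6}" by (auto simp: inj_on_def field_simps)
  have idx: "idx (1 / of_nat k) = k" if "k \<in> {1..6}" for k
    unfolding idx_def using inv_into_f_f[OF inj that] by simp
  have "\<exists>g. g holomorphic_on {s. Re s > 1 / 7} \<and> (\<forall>z\<in>{s. Re s > 1 / 7} - abelian_poles.
     g z = abelian_zeta z / z - (\<Sum>p\<in>abelian_poles. of_real (main_coeff (idx p)) / (z - p)))"
  proof (rule holomorphic_subtract_simple_poles)
    show "(\<lambda>s. abelian_zeta s / s) holomorphic_on {s. Re s > 1 / 7} - abelian_poles"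
      by (intro holomorphic_intros holomorphic_abelian_zeta) auto
    show "((\<lambda>z. (z - p) * (abelian_zeta z / z)) \<longlongrightarrow> of_real (main_coeff (idx p))) (at p)" if p: "p \<in> abelian_poles" for p
    proof -
      obtain k where k: "k \<in> {1..6}" "p = 1 / of_nat k" using p by (auto simp: abelian_poles_def)
      show ?thesis using abelian_zeta_pole[OF k(1)] idx[OF k(1)] k(2) by simp
    qed
  qed (simp_all only: abelian_poles_def finite_imageI finite_atLeastAtMost open_halfspace_Re_gt)
  moreover have "(\<Sum>p\<in>abelian_poles. of_real (main_coeff (idx p)) / (z - p)) =
     (\<Sum>k=1..6. of_real (main_coeff k) / (z - 1 / of_nat k))" for z
    unfolding abelian_poles_def sum.reindex[OF inj] by (intro sum.cong) (auto simp: idx)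
  ultimately show ?thesis using that by auto
qed

section \<open>The Mellin transform of the error term\<close>

lemma norm_of_real_powr: "x > 0 \<Longrightarrow> norm (of_real x powr z :: complex) = x powr Re z"
  by (simp add: norm_powr_real_powr)

lemma real_powr_atLeast_integral:
  fixes a \<sigma> :: real
  assumes a: "a > 0" and \<sigma>: "\<sigma> > 0"
  shows "set_integrable lborel {a..} (\<lambda>x. x powr (- \<sigma> - 1))"
    and "(LINT x:{a..}|lborel. x powr (- \<sigma> - 1)) = a powr (- \<sigma>) / \<sigma>"
proof -
  have "((\<lambda>x. x powr (- \<sigma> - 1)) has_integral - (a powr (- \<sigma> - 1 + 1)) / (- \<sigma> - 1 + 1)) {a..}"
    by (rule has_integral_powr_to_inf) (use a \<sigma> in auto)
  hence hi: "((\<lambda>x. x powr (- \<sigma> - 1)) has_integral a powr (- \<sigma>) / \<sigma>) {a..}" by simp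
  have nn: "(\<integral>\<^sup>+x. ennreal (indicator {a..} x * x powr (- \<sigma> - 1)) \<partial>lborel) = ennreal (a powr (- \<sigma>) / \<sigma>)"
    by (rule nn_integral_has_integral_lebesgue[OF _ hi]) auto
  have hb: "has_bochner_integral lborel (\<lambda>x. indicator {a..} x * x powr (- \<sigma> - 1)) (a powr (- \<sigma>) / \<sigma>)"
    by (rule has_bochner_integral_nn_integral[OF _ _ _ nn]) (use \<sigma> in auto)
  thus "set_integrable lborel {a..} (\<lambda>x. x powr (- \<sigma> - 1))"
    "(LINT x:{a..}|lborel. x powr (- \<sigma> - 1)) = a powr (- \<sigma>) / \<sigma>"
    by (simp_all add: set_integrable_def set_lebesgue_integral_def has_bochner_integral_iff)
qed

lemma complex_powr_atLeast_integral:
  fixes a :: real and s :: complex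
  assumes a: "a > 0" and s: "Re s > 0"
  shows "set_integrable lborel {a..} (\<lambda>x. of_real x powr (- s - 1) :: complex)"
    and "(LINT x:{a..}|lborel. of_real x powr (- s - 1)) = of_real a powr (- s) / s"
proof -
  show int: "set_integrable lborel {a..} (\<lambda>x. of_real x powr (- s - 1) :: complex)"
    unfolding set_integrable_def
  proof (rule Bochner_Integration.integrable_bound)
    show "integrable lborel (\<lambda>x. indicator {a..} x *\<^sub>R x powr (- Re s - 1))"
      using real_powr_atLeast_integral(1)[OF a s] by (simp add: set_integrable_def)
    show "(\<lambda>x. indicator {a..} x *\<^sub>R (of_real x powr (- s - 1) :: complex)) \<in> borel_measurable lborel" by measurable
    show "AE x in lborel. norm (indicator {a..} x *\<^sub>R (of_real x powr (- s - 1) :: complex)) \<le> norm (indicator {a..} x *\<^sub>R x powr (- Re s - 1))"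
      using a by (intro AE_I2) (auto simp: indicator_def norm_of_real_powr)
  qed
  define F where "F x = - (complex_of_real x powr (- s) / s)" for x
  have s0: "s \<noteq> 0" using s by auto
  have der: "(F has_vector_derivative (of_real x powr (- s - 1))) (at x)" if "x > 0" for x
  proof -
    have "((\<lambda>z. - (z powr (- s) / s)) has_field_derivative (- (- s * of_real x powr (- s - 1) / s))) (at (of_real x))"
      using that by (intro DERIV_minus DERIV_cdivide) (auto intro!: derivative_eq_intros)
    hence "((\<lambda>z. - (z powr (- s) / s)) has_field_derivative (of_real x powr (- s - 1))) (at (of_real x))" using s0 by simp
    thus ?thesis unfolding F_def by (rule has_vector_derivative_real_field)
  qed
  have contF: "isCont F x" if "x > 0" for x
    using der[OF that] has_vector_derivative_continuous by blast
  have "(LBINT x=ereal a..\<infinity>. of_real x powr (- s - 1)) = 0 - F a"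
  proof (rule interval_integral_FTC_integrable)
    show "ereal a < \<infinity>" by simp
    show "(F has_vector_derivative (of_real x powr (- s - 1))) (at x)" if "ereal a < ereal x" for x
      using that a by (intro der) simp
    show "isCont (\<lambda>x. complex_of_real x powr (- s - 1)) x" if "ereal a < ereal x" for x
      using that a by (intro isCont_powr_complex[where f = of_real and g = "\<lambda>_. - s - 1"] continuous_intros) auto
    show "set_integrable lborel (einterval (ereal a) \<infinity>) (\<lambda>x. complex_of_real x powr (- s - 1))"
      by (rule set_integrable_subset[OF int]) (auto simp: einterval_def)
    show "((F \<circ> real_of_ereal) \<longlongrightarrow> F a) (at_right (ereal a))"
      using contF[OF a] by (auto simp: ereal_tendsto_simps isCont_def intro: tendsto_mono[OF at_le[OF subset_UNIV]])
    have "((\<lambda>x. x powr (- Re s) / norm s) \<longlongrightarrow> 0 / norm s) at_top"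
      using s s0 by (intro tendsto_divide tendsto_neg_powr filterlim_ident tendsto_const) auto
    moreover have "\<forall>\<^sub>F x in at_top. x powr (- Re s) / norm s = norm (F x)"
      using eventually_gt_at_top[of 0] by eventually_elim (simp add: F_def norm_divide norm_of_real_powr)
    ultimately have "((\<lambda>x. norm (F x)) \<longlongrightarrow> 0) at_top" using Lim_transform_eventually by force
    hence "(F \<longlongrightarrow> 0) at_top" by (rule tendsto_norm_zero_cancel)
    thus "((F \<circ> real_of_ereal) \<longlongrightarrow> 0) (at_left \<infinity>)" by (simp add: ereal_tendsto_simps)
  qed
  also have "0 - F a = of_real a powr (- s) / s" by (simp add: F_def)
  also have "(LBINT x=ereal a..\<infinity>. complex_of_real x powr (- s - 1)) = (LINT x:{a<..}|lborel. of_real x powr (- s - 1))"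
    by (rule interval_integral_to_infinity_eq)
  also have "\<dots> = (LINT x:{a..}|lborel. of_real x powr (- s - 1))"
    unfolding set_lebesgue_integral_def
  proof (rule integral_cong_AE)
    show "AE x in lborel. indicator {a<..} x *\<^sub>R complex_of_real x powr (- s - 1) = indicator {a..} x *\<^sub>R complex_of_real x powr (- s - 1)"
      using AE_lborel_singleton[of a] by eventually_elim (auto simp: indicator_def)
  qed measurable
  finally show "(LINT x:{a..}|lborel. of_real x powr (- s - 1)) = of_real a powr (- s) / s" .
qed

definition abelian_summatory :: "real \<Rightarrow> real" where
  "abelian_summatory x = (\<Sum>n | 1 \<le> n \<and> real n \<le> x. real (num_abelian_groups n))"

lemma abelian_summatory_sums:
  "(\<lambda>n. real (num_abelian_groups (Suc n)) * indicator {real (Suc n)..} x) sums abelian_summatory x"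
proof -
  have "finite {n. real n \<le> x}"
    by (rule finite_subset[of _ "{..nat \<lceil>x\<rceil>}"]) (auto simp: le_nat_iff, linarith)
  hence fin: "finite {n. real (Suc n) \<le> x}"
    using finite_vimageI[of "{n. real n \<le> x}" Suc] by (simp add: vimage_def)
  have "(\<lambda>n. real (num_abelian_groups (Suc n)) * indicator {real (Suc n)..} x) sums
     (\<Sum>n | real (Suc n) \<le> x. real (num_abelian_groups (Suc n)) * indicator {real (Suc n)..} x)"
    by (rule sums_finite[OF fin]) auto
  also have "(\<Sum>n | real (Suc n) \<le> x. real (num_abelian_groups (Suc n)) * indicator {real (Suc n)..} x) = abelian_summatory x"
    unfolding abelian_summatory_def
    by (rule sum.reindex_bij_witness[of _ "\<lambda>n. n - 1" Suc]) auto
  finally show ?thesis .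
qed

lemma abelian_summatory_measurable [measurable]: "abelian_summatory \<in> borel_measurable borel"
proof -
  have "abelian_summatory = (\<lambda>x. \<Sum>n. real (num_abelian_groups (Suc n)) * indicator {real (Suc n)..} x)"
    using abelian_summatory_sums by (auto simp: sums_iff)
  also have "\<dots> \<in> borel_measurable borel" by measurable
  finally show ?thesis .
qed

text \<open>
  The half weight of the last term of the sum only matters at integers, hence not in integrals.
\<close>
lemma Delta_eq:
  assumes "x \<notin> \<nat>"
  shows "Delta x = abelian_summatory x - (\<Sum>k=1..6. main_coeff k * x powr (1 / real k))"
  using assms by (simp add: Delta_def starred_sum_def abelian_summatory_def)

lemma AE_not_nat: "AE x in lborel. x \<notin> (\<nat> :: real set)"
proof -
  have "countable (\<nat> :: real set)" by (simp add: Nats_def)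
  hence "(\<nat> :: real set) \<in> null_sets lborel" by (rule countable_imp_null_set_lborel)
  thus ?thesis by (rule AE_not_in)
qed

lemma Delta_measurable [measurable]: "Delta \<in> borel_measurable borel"
proof -
  have "(\<nat> :: real set) \<in> sets borel" by (rule sets.countable) (auto simp: Nats_def)
  hence [measurable]: "Measurable.pred borel (\<lambda>x::real. x \<in> \<nat>)" by (simp add: pred_def)
  have "Delta = (\<lambda>x. abelian_summatory x - (if x \<in> \<nat> then real (num_abelian_groups (nat \<lfloor>x\<rfloor>)) / 2 else 0)
     - (\<Sum>k=1..6. main_coeff k * x powr (1 / real k)))"
    by (simp add: Delta_def starred_sum_def abelian_summatory_def fun_eq_iff)
  also have "\<dots> \<in> borel_measurable borel" by measurable
  finally show ?thesis .
qed

text \<open>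
  The term \<open>n\<close> of the sum is the indicator function of \<open>x \<ge> n\<close>, with Mellin transform \<open>n powr (- s) / s\<close>.
\<close>
lemma summatory_mellin:
  assumes s: "Re s > 1"
  shows "set_integrable lborel {1..} (\<lambda>x. of_real (abelian_summatory x) * of_real x powr (- s - 1) :: complex)"
    and "(LINT x:{1..}|lborel. of_real (abelian_summatory x) * of_real x powr (- s - 1)) = abelian_zeta s / s"
proof -
  define a where "a n = real (num_abelian_groups (Suc n))" for n
  define f where "f n x = a n *\<^sub>R (indicator {real (Suc n)..} x *\<^sub>R (of_real x powr (- s - 1) :: complex))" for n x
  have intf: "integrable lborel (f n)" for n
    unfolding f_def
    by (rule integrable_scaleR_right)
       (use complex_powr_atLeast_integral(1)[of "real (Suc n)" s] s in \<open>simp add: set_integrable_def\<close>)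
  have If: "integral\<^sup>L lborel (f n) = a n * (of_real (real (Suc n)) powr (- s) / s)" for n
    unfolding f_def using complex_powr_atLeast_integral(2)[of "real (Suc n)" s] s
    by (simp add: set_lebesgue_integral_def scaleR_conv_of_real)
  have nf: "norm (f n x) = a n * (indicator {real (Suc n)..} x *\<^sub>R x powr (- Re s - 1))" for n x
    by (auto simp: f_def a_def indicator_def norm_of_real_powr)
  have Inf: "integral\<^sup>L lborel (\<lambda>x. norm (f n x)) = a n * real (Suc n) powr (- Re s) / Re s" for n
    unfolding nf using real_powr_atLeast_integral(2)[of "real (Suc n)" "Re s"] s
    by (simp add: set_lebesgue_integral_def)
  have sum1: "AE x in lborel. summable (\<lambda>n. norm (f n x))"
  proof (rule AE_I2)
    fix x :: real
    have "summable (\<lambda>n. a n * indicator {real (Suc n)..} x)"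
      using abelian_summatory_sums[of x] by (simp add: a_def sums_iff)
    from summable_mult2[OF this, of "x powr (- Re s - 1)"]
    show "summable (\<lambda>n. norm (f n x))" unfolding nf by (simp add: mult.assoc)
  qed
  have sum2: "summable (\<lambda>n. integral\<^sup>L lborel (\<lambda>x. norm (f n x)))"
    unfolding Inf a_def by (intro summable_divide num_abelian_groups_abs_summable s)
  have eq: "(\<Sum>n. f n x) = indicator {1..} x *\<^sub>R (of_real (abelian_summatory x) * of_real x powr (- s - 1))" for x
  proof -
    have "(\<lambda>n. (a n * indicator {real (Suc n)..} x) *\<^sub>R (of_real x powr (- s - 1) :: complex)) sums
      (abelian_summatory x *\<^sub>R of_real x powr (- s - 1))"
      using abelian_summatory_sums[of x] unfolding a_def by (intro sums_scaleR_left)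
    hence "(\<lambda>n. f n x) sums (abelian_summatory x *\<^sub>R of_real x powr (- s - 1))" by (simp add: f_def)
    moreover have "abelian_summatory x = 0" if "x < 1"
      using that by (auto simp: abelian_summatory_def intro!: sum.neutral)
    ultimately show ?thesis by (auto simp: sums_iff indicator_def scaleR_conv_of_real)
  qed
  show "set_integrable lborel {1..} (\<lambda>x. of_real (abelian_summatory x) * of_real x powr (- s - 1) :: complex)"
    unfolding set_integrable_def eq[symmetric] by (rule integrable_suminf[OF intf sum1 sum2])
  have "(LINT x:{1..}|lborel. of_real (abelian_summatory x) * of_real x powr (- s - 1)) = (\<Sum>n. integral\<^sup>L lborel (f n))"
    unfolding set_lebesgue_integral_def eq[symmetric] by (rule integral_suminf[OF intf sum1 sum2])
  also have "\<dots> = abelian_zeta s / s"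
  proof -
    have "(\<lambda>n. of_nat (num_abelian_groups (Suc n)) * nat_weight s (Suc n) / s) sums (abelian_zeta s / s)"
      using num_abelian_groups_sums[OF s] zeta_tail_1_eq_abelian_zeta[OF s] by (intro sums_divide) simp
    moreover have "of_nat (num_abelian_groups (Suc n)) * nat_weight s (Suc n) / s = integral\<^sup>L lborel (f n)" for n
      unfolding If by (simp add: a_def nat_weight_def powr_minus_divide)
    ultimately show ?thesis by (simp add: sums_iff)
  qed
  finally show "(LINT x:{1..}|lborel. of_real (abelian_summatory x) * of_real x powr (- s - 1)) = abelian_zeta s / s" .
qed

theorem Delta_mellin:
  assumes s: "Re s > 1"
  shows "set_integrable lborel {1..} (\<lambda>x. of_real (Delta x) * of_real x powr (- s - 1) :: complex)"
    and "(LINT x:{1..}|lborel. of_real (Delta x) * of_real x powr (- s - 1)) =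
      abelian_zeta s / s - (\<Sum>k=1..6. of_real (main_coeff k) / (s - 1 / of_nat k))"
proof -
  define p where "p k x = of_real (main_coeff k) * (of_real x powr (- (s - 1 / of_nat k) - 1) :: complex)" for k and x :: real
  have k1: "Re (s - 1 / of_nat k) > 0" if "k \<in> {1..6}" for k
  proof -
    have "1 / real k \<le> 1" using that by simp
    thus ?thesis using s by (simp add: Re_divide_of_nat)
  qed
  have pint: "set_integrable lborel {1..} (p k)" if "k \<in> {1..6}" for k
    unfolding p_def using complex_powr_atLeast_integral(1)[OF zero_less_one k1[OF that]] by (intro set_integrable_mult_right)
  have pI: "(LINT x:{1..}|lborel. p k x) = of_real (main_coeff k) / (s - 1 / of_nat k)" if "k \<in> {1..6}" for k
    unfolding p_def using complex_powr_atLeast_integral(2)[OF zero_less_one k1[OF that]] by simp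
  define D where "D x = of_real (abelian_summatory x) * of_real x powr (- s - 1) - (\<Sum>k=1..6. p k x)" for x
  have sint: "set_integrable lborel {1..} (\<lambda>x. \<Sum>k=1..6. p k x)"
    unfolding set_integrable_def scaleR_sum_right
    by (rule Bochner_Integration.integrable_sum) (use pint in \<open>simp add: set_integrable_def\<close>)
  have Dint: "set_integrable lborel {1..} D"
    unfolding D_def by (intro set_integral_diff(1) summatory_mellin s sint)
  have DI: "(LINT x:{1..}|lborel. D x) = abelian_zeta s / s - (\<Sum>k=1..6. of_real (main_coeff k) / (s - 1 / of_nat k))"
  proof -
    have "(LINT x:{1..}|lborel. D x) = (LINT x:{1..}|lborel. of_real (abelian_summatory x) * of_real x powr (- s - 1)) -
      (LINT x:{1..}|lborel. (\<Sum>k=1..6. p k x))"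
      unfolding D_def by (intro set_integral_diff(2) summatory_mellin s sint)
    also have "(LINT x:{1..}|lborel. (\<Sum>k=1..6. p k x)) = (\<Sum>k=1..6. LINT x:{1..}|lborel. p k x)"
      unfolding set_lebesgue_integral_def scaleR_sum_right
      by (rule Bochner_Integration.integral_sum) (use pint in \<open>simp add: set_integrable_def\<close>)
    finally show ?thesis using summatory_mellin(2)[OF s] by (simp add: pI)
  qed
  have ae: "AE x in lborel. indicator {1..} x *\<^sub>R D x = indicator {1..} x *\<^sub>R (of_real (Delta x) * of_real x powr (- s - 1))"
    using AE_not_nat
  proof eventually_elim
    case (elim x)
    show ?case
    proof (cases "x \<ge> 1")
      case True
      have "p k x = of_real (main_coeff k * x powr (1 / real k)) * of_real x powr (- s - 1)" if "k \<in> {1..6}" for k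
      proof -
        have "of_real x powr (- (s - 1 / of_nat k) - 1) = of_real x powr (1 / of_nat k + (- s - 1))"
          by (simp add: algebra_simps)
        also have "\<dots> = of_real x powr (1 / of_nat k) * of_real x powr (- s - 1)" by (rule powr_add)
        also have "of_real x powr (1 / of_nat k) = complex_of_real (x powr (1 / real k))"
          using powr_of_real[of x "1 / real k"] True by simp
        finally show ?thesis by (simp add: p_def)
      qed
      hence "(\<Sum>k=1..6. p k x) = of_real (\<Sum>k=1..6. main_coeff k * x powr (1 / real k)) * of_real x powr (- s - 1)"
        by (simp only: of_real_sum sum_distrib_right cong: sum.cong)
      hence "D x = of_real (Delta x) * of_real x powr (- s - 1)"
        unfolding D_def Delta_eq[OF elim] by (simp only: of_real_diff left_diff_distrib)
      thus ?thesis by (simp only:)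
    qed simp
  qed
  have m1: "(\<lambda>x. indicator {1..} x *\<^sub>R D x) \<in> borel_measurable lborel" using Dint by (simp add: set_integrable_def)
  have m2: "(\<lambda>x. indicator {1..} x *\<^sub>R (of_real (Delta x) * of_real x powr (- s - 1) :: complex)) \<in> borel_measurable lborel" by measurable
  show "set_integrable lborel {1..} (\<lambda>x. of_real (Delta x) * of_real x powr (- s - 1) :: complex)"
    using integrable_cong_AE[OF m1 m2 ae] Dint by (simp add: set_integrable_def)
  show "(LINT x:{1..}|lborel. of_real (Delta x) * of_real x powr (- s - 1)) =
      abelian_zeta s / s - (\<Sum>k=1..6. of_real (main_coeff k) / (s - 1 / of_nat k))"
    using integral_cong_AE[OF m1 m2 ae] DI by (simp add: set_lebesgue_integral_def)
qed

section \<open>Landau's theorem for Mellin integrals\<close>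

text \<open>
  Expanding \<open>x powr w = exp (w ln x)\<close> in powers of \<open>w\<close> expresses the Mellin transform near \<open>c\<close> by the
  logarithmic moments of \<open>g\<close>. Since these are nonnegative, convergence of their power series at one
  positive point already dominates the integral.
\<close>
lemma log_moment_series_complex:
  fixes g :: "real \<Rightarrow> real" and c R :: real
  assumes g [measurable]: "g \<in> borel_measurable borel" and g0: "\<forall>x\<ge>1. g x \<ge> 0"
    and mom: "\<And>n. set_integrable lborel {1..} (\<lambda>x. g x * x powr (- c - 1) * ln x ^ n)"
  defines "a \<equiv> \<lambda>n. (LINT x:{1..}|lborel. g x * x powr (- c - 1) * ln x ^ n) / fact n"
  assumes R: "summable (\<lambda>n. a n * R ^ n)" and w: "norm w \<le> R"
  shows "set_integrable lborel {1..} (\<lambda>x. of_real (g x) * of_real x powr (w - of_real c - 1) :: complex)"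
    and "(\<lambda>n. of_real (a n) * w ^ n) sums (LINT x:{1..}|lborel. of_real (g x) * of_real x powr (w - of_real c - 1))"
proof -
  define h where "h n x = indicator {1..} x *\<^sub>R (g x * x powr (- c - 1) * ln x ^ n)" for n x
  define f where "f n x = (w ^ n / fact n) * complex_of_real (h n x)" for n x
  have hint: "integrable lborel (h n)" for n using mom[of n] by (simp add: set_integrable_def h_def[abs_def])
  have h0: "h n x \<ge> 0" for n x using g0 by (auto simp: h_def indicator_def)
  have Ih: "integral\<^sup>L lborel (h n) = a n * fact n" for n
    by (simp add: a_def set_lebesgue_integral_def h_def[abs_def])
  have nf: "norm (f n x) = norm w ^ n / fact n * h n x" for n x
    using h0[of n x] by (simp add: f_def norm_mult norm_divide norm_power)
  have fint: "integrable lborel (f n)" for n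
    unfolding f_def by (intro integrable_mult_right integrable_of_real hint)
  have If: "integral\<^sup>L lborel (f n) = of_real (a n) * w ^ n" for n
    unfolding f_def by (simp add: Ih)
  have a0: "a n \<ge> 0" for n
  proof -
    have "integral\<^sup>L lborel (h n) \<ge> 0" by (intro Bochner_Integration.integral_nonneg h0)
    thus ?thesis using fact_gt_zero[of n, where ?'a = real] unfolding Ih by (simp add: zero_le_mult_iff not_le)
  qed
  have expsum: "(\<lambda>n. f n x) sums (indicator {1..} x *\<^sub>R (of_real (g x) * of_real x powr (w - of_real c - 1)))" for x
  proof (cases "x \<ge> 1")
    case True
    have "(\<lambda>n. (of_real (g x * x powr (- c - 1))) * ((w * of_real (ln x)) ^ n /\<^sub>R fact n)) sums
       (of_real (g x * x powr (- c - 1)) * exp (w * of_real (ln x)))"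
      by (intro sums_mult exp_converges)
    moreover have "(of_real (g x * x powr (- c - 1))) * ((w * of_real (ln x)) ^ n /\<^sub>R fact n) = f n x" for n
      using True by (simp add: f_def h_def power_mult_distrib scaleR_conv_of_real field_simps)
    moreover have "of_real (g x * x powr (- c - 1)) * exp (w * of_real (ln x)) = of_real (g x) * of_real x powr (w - of_real c - 1)"
    proof -
      have "complex_of_real x powr (w - of_real c - 1) = of_real x powr w * of_real x powr (of_real (- c - 1))"
        by (simp add: algebra_simps flip: powr_add)
      also have "complex_of_real x powr (of_real (- c - 1)) = of_real (x powr (- c - 1))"
        using True by (intro powr_of_real) auto
      also have "complex_of_real x powr w = exp (w * of_real (ln x))"
        using True by (simp add: powr_def Ln_of_real)
      finally show ?thesis by simp
    qed
    ultimately have "(\<lambda>n. f n x) sums (of_real (g x) * of_real x powr (w - of_real c - 1))" by (simp only:)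
    thus ?thesis using True by simp
  qed (simp add: f_def h_def)
  have sumn: "AE x in lborel. summable (\<lambda>n. norm (f n x))"
  proof (rule AE_I2)
    fix x :: real
    have "summable (\<lambda>n. (norm w * ln x) ^ n /\<^sub>R fact n)" by (rule summable_exp_generic)
    from summable_mult[OF this, of "indicator {1..} x * (g x * x powr (- c - 1))"]
    show "summable (\<lambda>n. norm (f n x))"
      unfolding nf by (simp add: h_def power_mult_distrib field_simps)
  qed
  have sumi: "summable (\<lambda>n. integral\<^sup>L lborel (\<lambda>x. norm (f n x)))"
  proof -
    have "summable (\<lambda>n. a n * norm w ^ n)"
      by (rule summable_comparison_test'[OF R, of 0])
         (use a0 w in \<open>auto simp: abs_mult intro!: mult_left_mono power_mono\<close>)
    moreover have "integral\<^sup>L lborel (\<lambda>x. norm (f n x)) = a n * norm w ^ n" for n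
      unfolding nf by (simp add: Ih)
    ultimately show ?thesis by simp
  qed
  have suminf: "(\<Sum>n. f n x) = indicator {1..} x *\<^sub>R (of_real (g x) * of_real x powr (w - of_real c - 1))" for x
    using expsum[of x] by (simp add: sums_iff)
  show "set_integrable lborel {1..} (\<lambda>x. of_real (g x) * of_real x powr (w - of_real c - 1) :: complex)"
    unfolding set_integrable_def suminf[symmetric] by (rule integrable_suminf[OF fint sumn sumi])
  show "(\<lambda>n. of_real (a n) * w ^ n) sums (LINT x:{1..}|lborel. of_real (g x) * of_real x powr (w - of_real c - 1))"
    unfolding set_lebesgue_integral_def suminf[symmetric] If[symmetric] by (rule sums_integral[OF fint sumn sumi])
qed

text \<open>
  By nonnegativity the partial sums are bounded by the integral over \<open>g x * x powr (\<rho> - c - 1)\<close>.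
\<close>
lemma log_moments_summable:
  fixes g :: "real \<Rightarrow> real" and c \<rho> :: real
  assumes g [measurable]: "g \<in> borel_measurable borel" and g0: "\<forall>x\<ge>1. g x \<ge> 0"
    and \<rho>: "\<rho> > 0" and int: "set_integrable lborel {1..} (\<lambda>x. g x * x powr (\<rho> - c - 1))"
  shows "set_integrable lborel {1..} (\<lambda>x. g x * x powr (- c - 1) * ln x ^ n)"
    and "summable (\<lambda>n. (LINT x:{1..}|lborel. g x * x powr (- c - 1) * ln x ^ n) / fact n * \<rho> ^ n)"
proof -
  define h where "h n x = indicator {1..} x *\<^sub>R (g x * x powr (- c - 1) * ln x ^ n)" for n x
  define k where "k x = indicator {1..} x *\<^sub>R (g x * x powr (\<rho> - c - 1))" for x
  have kint: "integrable lborel k" using int by (simp add: set_integrable_def k_def[abs_def])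
  have h0: "h n x \<ge> 0" for n x using g0 by (auto simp: h_def indicator_def)
  have partial: "(\<Sum>n<N. \<rho> ^ n / fact n * h n x) \<le> k x" for N x
  proof (cases "x \<ge> 1")
    case True
    have "(\<Sum>n<N. (\<rho> * ln x) ^ n /\<^sub>R fact n) \<le> exp (\<rho> * ln x)"
      unfolding exp_def by (intro sum_le_suminf summable_exp_generic) (use \<rho> True in auto)
    also have "exp (\<rho> * ln x) = x powr \<rho>" using True by (simp add: powr_def)
    finally have "g x * x powr (- c - 1) * (\<Sum>n<N. (\<rho> * ln x) ^ n /\<^sub>R fact n) \<le> g x * x powr (- c - 1) * x powr \<rho>"
      using g0[rule_format, OF True] by (intro mult_left_mono) auto
    also have "g x * x powr (- c - 1) * x powr \<rho> = k x"
      using True by (simp add: k_def mult.assoc algebra_simps flip: powr_add)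
    also have "g x * x powr (- c - 1) * (\<Sum>n<N. (\<rho> * ln x) ^ n /\<^sub>R fact n) = (\<Sum>n<N. \<rho> ^ n / fact n * h n x)"
      using True by (simp add: h_def sum_distrib_left power_mult_distrib field_simps)
    finally show ?thesis .
  qed (simp add: h_def k_def)
  have hint: "integrable lborel (h n)" for n
  proof (rule Bochner_Integration.integrable_bound)
    show "integrable lborel (\<lambda>x. fact n / \<rho> ^ n * k x)" by (intro integrable_mult_right kint)
    show "h n \<in> borel_measurable lborel" unfolding h_def by measurable
    show "AE x in lborel. norm (h n x) \<le> norm (fact n / \<rho> ^ n * k x)"
    proof (rule AE_I2)
      fix x
      have "\<rho> ^ n / fact n * h n x \<le> (\<Sum>j<Suc n. \<rho> ^ j / fact j * h j x)"
        using h0 \<rho> by (intro member_le_sum[of n _ "\<lambda>j. \<rho> ^ j / fact j * h j x"]) (auto intro!: mult_nonneg_nonneg divide_nonneg_pos)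
      also have "\<dots> \<le> k x" by (rule partial)
      finally have "h n x \<le> fact n / \<rho> ^ n * k x" using \<rho> by (simp add: field_simps)
      hence "norm (h n x) \<le> fact n / \<rho> ^ n * k x" using h0[of n x] by (simp only: real_norm_def abs_of_nonneg)
      thus "norm (h n x) \<le> norm (fact n / \<rho> ^ n * k x)" unfolding real_norm_def by (rule order.trans[OF _ abs_ge_self])
    qed
  qed
  show "set_integrable lborel {1..} (\<lambda>x. g x * x powr (- c - 1) * ln x ^ n)"
    using hint[of n] by (simp add: set_integrable_def h_def[abs_def])
  have Ih: "(LINT x:{1..}|lborel. g x * x powr (- c - 1) * ln x ^ n) = integral\<^sup>L lborel (h n)" for n
    by (simp add: set_lebesgue_integral_def h_def[abs_def])
  show "summable (\<lambda>n. (LINT x:{1..}|lborel. g x * x powr (- c - 1) * ln x ^ n) / fact n * \<rho> ^ n)"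
    unfolding Ih
  proof (rule summableI_nonneg_bounded)
    fix N
    have "(\<Sum>n<N. integral\<^sup>L lborel (h n) / fact n * \<rho> ^ n) = (\<integral>x. (\<Sum>n<N. \<rho> ^ n / fact n * h n x) \<partial>lborel)"
      using hint by (subst Bochner_Integration.integral_sum) (auto simp: field_simps)
    also have "\<dots> \<le> integral\<^sup>L lborel k"
      by (intro integral_mono kint partial Bochner_Integration.integrable_sum integrable_mult_right hint)
    finally show "(\<Sum>n<N. integral\<^sup>L lborel (h n) / fact n * \<rho> ^ n) \<le> integral\<^sup>L lborel k" .
  next
    fix n
    have "integral\<^sup>L lborel (h n) \<ge> 0" by (intro Bochner_Integration.integral_nonneg h0)
    thus "integral\<^sup>L lborel (h n) / fact n * \<rho> ^ n \<ge> 0" using \<rho> by simp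
  qed
qed

text \<open>
  Landau's theorem: the Mellin integral of a nonnegative function converges as far to the left as the
  function that it represents continues. The Taylor series of \<open>\<Phi>\<close> at a point \<open>c > \<sigma>1\<close> converges in the
  disc of radius \<open>c - \<sigma>0\<close>, and its coefficients are, up to sign, the logarithmic moments of \<open>g\<close> at \<open>c\<close>.
  Their nonnegativity turns convergence of the series into convergence of the integral.
\<close>
theorem landau_mellin:
  fixes g :: "real \<Rightarrow> real" and \<sigma>0 \<sigma>1 :: real and \<Phi> :: "complex \<Rightarrow> complex"
  assumes g [measurable]: "g \<in> borel_measurable borel" and g0: "\<forall>x\<ge>1. g x \<ge> 0"
    and \<sigma>: "\<sigma>0 < \<sigma>1"
    and int: "\<And>s. Re s > \<sigma>1 \<Longrightarrow> set_integrable lborel {1..} (\<lambda>x. of_real (g x) * of_real x powr (- s - 1) :: complex)"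
    and \<Phi>: "\<And>s. Re s > \<sigma>1 \<Longrightarrow> (LINT x:{1..}|lborel. of_real (g x) * of_real x powr (- s - 1)) = \<Phi> s"
    and hol: "\<Phi> holomorphic_on {s. Re s > \<sigma>0}"
    and s: "Re s > \<sigma>0"
  shows "set_integrable lborel {1..} (\<lambda>x. of_real (g x) * of_real x powr (- s - 1) :: complex)"
    and "(LINT x:{1..}|lborel. of_real (g x) * of_real x powr (- s - 1)) = \<Phi> s"
proof -
  \<comment> \<open>so far to the right that the disc of radius \<open>c - \<sigma>0\<close> around \<open>c\<close> contains \<open>s\<close>\<close>
  define c where "c = max (\<sigma>1 + 1) (Re s + (Im s)\<^sup>2 / (Re s - \<sigma>0) + 1)"
  have c1: "c > \<sigma>1" and c2: "c > Re s + (Im s)\<^sup>2 / (Re s - \<sigma>0)" by (auto simp: c_def)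
  define r where "r = c - \<sigma>0"
  have r: "r > 0" using c1 \<sigma> by (simp add: r_def)
  have near: "norm (of_real c - s) < r"
  proof -
    have d: "Re s - \<sigma>0 > 0" using s by simp
    have "(Im s)\<^sup>2 < (c - Re s) * (Re s - \<sigma>0)"
      using c2 d by (simp add: field_simps)
    moreover have "c - Re s > 0" using c2 divide_nonneg_pos[OF zero_le_power2 d, of "Im s"] by linarith
    hence "(c - Re s) * (Re s - \<sigma>0) \<ge> 0" using d by simp
    moreover have "r\<^sup>2 = (c - Re s)\<^sup>2 + 2 * ((c - Re s) * (Re s - \<sigma>0)) + (Re s - \<sigma>0)\<^sup>2"
      by (simp add: r_def power2_eq_square algebra_simps)
    ultimately have "(c - Re s)\<^sup>2 + (Im s)\<^sup>2 < r\<^sup>2" using zero_le_power2[of "Re s - \<sigma>0"] by linarith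
    hence "(norm (of_real c - s))\<^sup>2 < r\<^sup>2" by (simp add: cmod_power2)
    thus ?thesis using r by (simp add: power_less_imp_less_base)
  qed
  define \<rho> where "\<rho> = (c - \<sigma>1) / 2"
  have \<rho>: "\<rho> > 0" "c - \<rho> > \<sigma>1" using c1 by (auto simp: \<rho>_def field_simps)
  have intr: "set_integrable lborel {1..} (\<lambda>x. g x * x powr (\<rho> - c - 1))"
  proof -
    have "integrable lborel (\<lambda>x. norm (indicator {1..} x *\<^sub>R (of_real (g x) * of_real x powr (- of_real (c - \<rho>) - 1) :: complex)))"
      using int[of "of_real (c - \<rho>)"] \<rho> by (intro integrable_norm) (simp add: set_integrable_def)
    also have "(\<lambda>x. norm (indicator {1..} x *\<^sub>R (of_real (g x) * of_real x powr (- of_real (c - \<rho>) - 1) :: complex))) =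
        (\<lambda>x. indicator {1..} x *\<^sub>R (g x * x powr (\<rho> - c - 1)))"
      using g0 by (auto simp: indicator_def norm_mult norm_of_real_powr)
    finally show ?thesis by (simp add: set_integrable_def)
  qed
  define a where "a n = (LINT x:{1..}|lborel. g x * x powr (- c - 1) * ln x ^ n) / fact n" for n
  note mom = log_moments_summable(1)[OF g g0 \<rho>(1) intr]
  have suma: "summable (\<lambda>n. a n * \<rho> ^ n)"
    unfolding a_def by (rule log_moments_summable(2)[OF g g0 \<rho>(1) intr])
  note series = log_moment_series_complex[OF g g0 mom, folded a_def]
  define F where "F = Abs_fps (\<lambda>n. complex_of_real (a n))"
  define H where "H w = \<Phi> (of_real c - w)" for w
  have holH: "H holomorphic_on eball 0 (ereal r)"
  proof -
    have "\<Phi> holomorphic_on (\<lambda>w. of_real c - w) ` ball 0 r"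
    proof (rule holomorphic_on_subset[OF hol], safe)
      fix w :: complex assume "w \<in> ball 0 r"
      hence "Re w < r" using complex_Re_le_cmod[of w] by simp
      thus "\<sigma>0 < Re (of_real c - w)" by (simp add: r_def)
    qed
    moreover have "(\<lambda>w. of_real c - w) holomorphic_on ball 0 r" by (intro holomorphic_intros)
    ultimately have "(\<Phi> \<circ> (\<lambda>w. of_real c - w)) holomorphic_on ball 0 r" by (intro holomorphic_on_compose)
    thus ?thesis by (simp add: o_def H_def[abs_def])
  qed
  define G where "G = fps_expansion H 0"
  have Grad: "fps_conv_radius G \<ge> ereal r" unfolding G_def by (rule conv_radius_fps_expansion[OF holH])
  have Geval: "eval_fps G w = H w" if "norm w < r" for w
    unfolding G_def by (rule eval_fps_expansion'[OF holH, simplified]) (use that in simp)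
  have Frad: "fps_conv_radius F \<ge> ereal \<rho>"
  proof -
    have "summable (\<lambda>n. complex_of_real (a n) * of_real \<rho> ^ n)"
      using summable_of_real[OF suma, where 'a = complex] by simp
    from conv_radius_geI[OF this] \<rho> show ?thesis by (simp add: fps_conv_radius_def F_def)
  qed
  have "F = G"
  proof (rule eval_fps_eqD)
    show "fps_conv_radius F > 0" using Frad \<rho> by (simp add: less_le_trans[of 0 "ereal \<rho>"])
    show "fps_conv_radius G > 0" using Grad r by (simp add: less_le_trans[of 0 "ereal r"])
    have "\<forall>\<^sub>F z in nhds 0. z \<in> ball 0 (min \<rho> r)"
      using \<rho> r by (intro eventually_nhds_in_open) auto
    thus "\<forall>\<^sub>F z in nhds 0. eval_fps F z = eval_fps G z"
    proof eventually_elim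
      case (elim z)
      have "(\<lambda>n. of_real (a n) * z ^ n) sums (LINT x:{1..}|lborel. of_real (g x) * of_real x powr (z - of_real c - 1))"
        by (rule series(2)[OF suma]) (use elim in simp)
      moreover have "(LINT x:{1..}|lborel. of_real (g x) * of_real x powr (z - of_real c - 1)) = H z"
      proof -
        have "Re z \<le> \<rho>" using elim complex_Re_le_cmod[of z] by simp
        hence "Re (of_real c - z) > \<sigma>1" using \<rho> by simp
        from \<Phi>[OF this] show ?thesis by (simp add: H_def)
      qed
      ultimately show ?case using Geval[of z] elim by (simp add: eval_fps_def F_def sums_iff)
    qed
  qed
  define w where "w = of_real c - s"
  have w: "norm w < r" using near by (simp add: w_def)
  have sumw: "summable (\<lambda>n. a n * norm w ^ n)"
  proof -
    have "ereal (norm (complex_of_real (norm w))) < fps_conv_radius F"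
      unfolding \<open>F = G\<close> using w by (intro less_le_trans[OF _ Grad]) simp
    from summable_fps[OF this] have "summable (\<lambda>n. complex_of_real (a n * norm w ^ n))" by (simp add: F_def)
    thus ?thesis by (simp only: summable_of_real_iff)
  qed
  have ws: "w - of_real c - 1 = - s - 1" by (simp add: w_def)
  show "set_integrable lborel {1..} (\<lambda>x. of_real (g x) * of_real x powr (- s - 1) :: complex)"
    using series(1)[OF sumw order_refl] unfolding ws .
  have "(\<lambda>n. of_real (a n) * w ^ n) sums (LINT x:{1..}|lborel. of_real (g x) * of_real x powr (- s - 1))"
    using series(2)[OF sumw order_refl] unfolding ws .
  moreover have "eval_fps F w = \<Phi> s" unfolding \<open>F = G\<close> using Geval[OF w] by (simp add: H_def w_def)
  ultimately show "(LINT x:{1..}|lborel. of_real (g x) * of_real x powr (- s - 1)) = \<Phi> s"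
    by (simp add: eval_fps_def F_def sums_iff)
qed

section \<open>A mean square inequality for Mellin transforms\<close>

text \<open>
  In the variable \<open>ln y\<close> this is the Poisson kernel of a half-plane, of total mass \<open>pi\<close>.
\<close>
lemma cauchy_kernel_integral:
  fixes \<epsilon> L :: real
  assumes "\<epsilon> > 0"
  shows "set_integrable lborel {1..} (\<lambda>y. \<epsilon> / (y * (\<epsilon>\<^sup>2 + (L - ln y)\<^sup>2)))"
    and "(LINT y:{1..}|lborel. \<epsilon> / (y * (\<epsilon>\<^sup>2 + (L - ln y)\<^sup>2))) \<le> pi"
proof -
  have pos: "\<epsilon>\<^sup>2 + z\<^sup>2 > 0" for z :: real using assms by (simp add: add_pos_nonneg)
  have eq: "(\<integral>\<^sup>+y. ennreal (\<epsilon> / (y * (\<epsilon>\<^sup>2 + (L - ln y)\<^sup>2))) * indicator {1..} y \<partial>lborel) = ennreal (pi / 2 - arctan ((ln 1 - L) / \<epsilon>))"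
  proof (rule nn_integral_FTC_atLeast)
    show "(\<lambda>y. \<epsilon> / (y * (\<epsilon>\<^sup>2 + (L - ln y)\<^sup>2))) \<in> borel_measurable borel" by measurable
    show "((\<lambda>y. arctan ((ln y - L) / \<epsilon>)) has_real_derivative \<epsilon> / (y * (\<epsilon>\<^sup>2 + (L - ln y)\<^sup>2))) (at y)" if "1 \<le> y" for y
    proof -
      have "((\<lambda>y. arctan ((ln y - L) / \<epsilon>)) has_real_derivative (inverse (1 + ((ln y - L) / \<epsilon>)\<^sup>2) * (1 / y / \<epsilon>))) (at y)"
        using that assms by (auto intro!: derivative_eq_intros)
      moreover have "inverse (1 + ((ln y - L) / \<epsilon>)\<^sup>2) * (1 / y / \<epsilon>) = \<epsilon> / (y * (\<epsilon>\<^sup>2 + (L - ln y)\<^sup>2))"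
      proof -
        have "1 + ((ln y - L) / \<epsilon>)\<^sup>2 = (\<epsilon>\<^sup>2 + (L - ln y)\<^sup>2) / \<epsilon>\<^sup>2"
          using assms by (simp add: field_simps power2_commute)
        thus ?thesis using assms that pos[of "L - ln y"] by (simp add: power2_eq_square)
      qed
      ultimately show ?thesis by simp
    qed
    show "0 \<le> \<epsilon> / (y * (\<epsilon>\<^sup>2 + (L - ln y)\<^sup>2))" if "1 \<le> y" for y
      using assms that pos[of "L - ln y"] by simp
    have "filterlim (\<lambda>y. (ln y - L) / \<epsilon>) at_top at_top" using assms by real_asymp
    thus "((\<lambda>y. arctan ((ln y - L) / \<epsilon>)) \<longlongrightarrow> pi / 2) at_top"
      by (rule filterlim_compose[OF tendsto_arctan_at_top])
  qed
  have eq': "(\<integral>\<^sup>+y. ennreal (indicator {1..} y *\<^sub>R (\<epsilon> / (y * (\<epsilon>\<^sup>2 + (L - ln y)\<^sup>2)))) \<partial>lborel) = ennreal (pi / 2 - arctan ((ln 1 - L) / \<epsilon>))"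
    unfolding eq[symmetric] by (intro nn_integral_cong) (auto simp: indicator_def)
  have nonneg: "AE y in lborel. 0 \<le> indicator {1..} y *\<^sub>R (\<epsilon> / (y * (\<epsilon>\<^sup>2 + (L - ln y)\<^sup>2)))"
    using assms by (intro AE_I2) (auto simp: indicator_def)
  show int: "set_integrable lborel {1..} (\<lambda>y. \<epsilon> / (y * (\<epsilon>\<^sup>2 + (L - ln y)\<^sup>2)))"
    unfolding set_integrable_def
  proof (rule integrableI_nonneg[OF _ nonneg])
    show "(\<integral>\<^sup>+y. ennreal (indicator {1..} y *\<^sub>R (\<epsilon> / (y * (\<epsilon>\<^sup>2 + (L - ln y)\<^sup>2)))) \<partial>lborel) < \<infinity>"
      unfolding eq' by simp
  qed measurable
  have "ennreal (LINT y:{1..}|lborel. \<epsilon> / (y * (\<epsilon>\<^sup>2 + (L - ln y)\<^sup>2))) = ennreal (pi / 2 - arctan ((ln 1 - L) / \<epsilon>))"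
    unfolding set_lebesgue_integral_def eq'[symmetric]
    by (rule nn_integral_eq_integral[symmetric]) (use int nonneg in \<open>auto simp: set_integrable_def\<close>)
  also have "\<dots> \<le> ennreal pi" using arctan_lbound[of "(ln 1 - L) / \<epsilon>"] by (intro ennreal_leI) linarith
  finally show "(LINT y:{1..}|lborel. \<epsilon> / (y * (\<epsilon>\<^sup>2 + (L - ln y)\<^sup>2))) \<le> pi"
    using pi_ge_zero by (simp add: ennreal_le_iff)
qed

lemma exp_cos_integral:
  fixes \<epsilon> d :: real
  assumes "\<epsilon> > 0"
  shows "set_integrable lborel {0..} (\<lambda>t. exp (- (\<epsilon> * t)))"
    and "(LINT t:{0..}|lborel. exp (- (\<epsilon> * t)) * cos (t * d)) = \<epsilon> / (\<epsilon>\<^sup>2 + d\<^sup>2)"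
proof -
  have pos: "\<epsilon>\<^sup>2 + d\<^sup>2 > 0" using assms by (simp add: add_pos_nonneg)
  have "(\<integral>\<^sup>+t. ennreal (exp (- (\<epsilon> * t))) * indicator {0..} t \<partial>lborel) = ennreal (0 - - exp (- (\<epsilon> * 0)) / \<epsilon>)"
  proof (rule nn_integral_FTC_atLeast)
    show "((\<lambda>t. - exp (- (\<epsilon> * t)) / \<epsilon>) has_real_derivative exp (- (\<epsilon> * t))) (at t)" for t
      using assms by (auto intro!: derivative_eq_intros)
    show "((\<lambda>t. - exp (- (\<epsilon> * t)) / \<epsilon>) \<longlongrightarrow> 0) at_top" using assms by real_asymp
  qed auto
  also have "(\<integral>\<^sup>+t. ennreal (exp (- (\<epsilon> * t))) * indicator {0..} t \<partial>lborel) =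
      (\<integral>\<^sup>+t. ennreal (indicator {0..} t *\<^sub>R exp (- (\<epsilon> * t))) \<partial>lborel)"
    by (intro nn_integral_cong) (auto simp: indicator_def)
  finally show int: "set_integrable lborel {0..} (\<lambda>t. exp (- (\<epsilon> * t)))"
    unfolding set_integrable_def by (intro integrableI_nonneg) (auto simp: indicator_def)
  define F where "F t = exp (- (\<epsilon> * t)) * (d * sin (t * d) - \<epsilon> * cos (t * d)) / (\<epsilon>\<^sup>2 + d\<^sup>2)" for t
  have dF: "(F has_real_derivative exp (- (\<epsilon> * t)) * cos (t * d)) (at t)" for t
  proof -
    have "((\<lambda>t. exp (- (\<epsilon> * t)) * (d * sin (t * d) - \<epsilon> * cos (t * d))) has_real_derivative (exp (- (\<epsilon> * t)) * (- \<epsilon>) * (d * sin (t * d) - \<epsilon> * cos (t * d)) +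
        exp (- (\<epsilon> * t)) * (d * (cos (t * d) * d) + \<epsilon> * (sin (t * d) * d)))) (at t)"
      by (auto intro!: derivative_eq_intros simp: algebra_simps)
    from DERIV_cdivide[OF this, of "\<epsilon>\<^sup>2 + d\<^sup>2"] have "(F has_real_derivative (exp (- (\<epsilon> * t)) * (- \<epsilon>) * (d * sin (t * d) - \<epsilon> * cos (t * d)) +
        exp (- (\<epsilon> * t)) * (d * (cos (t * d) * d) + \<epsilon> * (sin (t * d) * d))) / (\<epsilon>\<^sup>2 + d\<^sup>2)) (at t)"
      by (simp only: F_def[abs_def])
    moreover have "exp (- (\<epsilon> * t)) * (- \<epsilon>) * (d * sin (t * d) - \<epsilon> * cos (t * d)) +
        exp (- (\<epsilon> * t)) * (d * (cos (t * d) * d) + \<epsilon> * (sin (t * d) * d)) = (exp (- (\<epsilon> * t)) * cos (t * d)) * (\<epsilon>\<^sup>2 + d\<^sup>2)"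
      by (simp add: algebra_simps power2_eq_square)
    ultimately show ?thesis using pos assms by simp
  qed
  have intc: "set_integrable lborel {0..} (\<lambda>t. exp (- (\<epsilon> * t)) * cos (t * d))"
    unfolding set_integrable_def
  proof (rule Bochner_Integration.integrable_bound[OF int[unfolded set_integrable_def]])
    show "AE t in lborel. norm (indicator {0..} t *\<^sub>R (exp (- (\<epsilon> * t)) * cos (t * d))) \<le> norm (indicator {0..} t *\<^sub>R exp (- (\<epsilon> * t)))"
      by (intro AE_I2) (auto simp: abs_mult indicator_def)
  qed measurable
  have "((\<lambda>b. LINT t:{0..b}|lborel. exp (- (\<epsilon> * t)) * cos (t * d)) \<longlongrightarrow> (LINT t:{0..}|lborel. exp (- (\<epsilon> * t)) * cos (t * d))) at_top"
    by (rule tendsto_set_lebesgue_integral_at_top[OF _ intc]) simp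
  moreover have "((\<lambda>b. LINT t:{0..b}|lborel. exp (- (\<epsilon> * t)) * cos (t * d)) \<longlongrightarrow> 0 - F 0) at_top"
  proof (rule Lim_transform_eventually)
    have "(F \<longlongrightarrow> 0) at_top"
    proof (rule Lim_null_comparison)
      have "norm (F t) \<le> exp (- (\<epsilon> * t)) * ((\<bar>d\<bar> + \<epsilon>) / (\<epsilon>\<^sup>2 + d\<^sup>2))" for t
      proof -
        have "\<bar>d * sin (t * d) - \<epsilon> * cos (t * d)\<bar> \<le> \<bar>d * sin (t * d)\<bar> + \<bar>\<epsilon> * cos (t * d)\<bar>" by (rule abs_triangle_ineq4)
        also have "\<dots> \<le> \<bar>d\<bar> * 1 + \<epsilon> * 1"
          using assms unfolding abs_mult by (intro add_mono mult_mono) auto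
        finally show ?thesis using pos by (simp add: F_def abs_mult divide_right_mono)
      qed
      thus "\<forall>\<^sub>F t in at_top. norm (F t) \<le> exp (- (\<epsilon> * t)) * ((\<bar>d\<bar> + \<epsilon>) / (\<epsilon>\<^sup>2 + d\<^sup>2))" by simp
      have "((\<lambda>t. exp (- (\<epsilon> * t))) \<longlongrightarrow> 0) at_top" using assms by real_asymp
      thus "((\<lambda>t. exp (- (\<epsilon> * t)) * ((\<bar>d\<bar> + \<epsilon>) / (\<epsilon>\<^sup>2 + d\<^sup>2))) \<longlongrightarrow> 0) at_top" by (rule tendsto_mult_left_zero)
    qed
    thus "((\<lambda>b. F b - F 0) \<longlongrightarrow> 0 - F 0) at_top" by (intro tendsto_intros)
    have "F b - F 0 = (LINT t:{0..b}|lborel. exp (- (\<epsilon> * t)) * cos (t * d))" if "b \<ge> 0" for b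
      unfolding set_lebesgue_integral_def
      by (subst integral_FTC_Icc_real[symmetric, OF that])
         (auto simp: mult.commute real_scaleR_def intro!: dF continuous_intros DERIV_subset[OF dF])
    thus "\<forall>\<^sub>F b in at_top. F b - F 0 = (LINT t:{0..b}|lborel. exp (- (\<epsilon> * t)) * cos (t * d))"
      by (rule eventually_mono[OF eventually_ge_at_top[of 0]])
  qed
  ultimately have "(LINT t:{0..}|lborel. exp (- (\<epsilon> * t)) * cos (t * d)) = 0 - F 0"
    by (rule tendsto_unique[rotated]) simp
  thus "(LINT t:{0..}|lborel. exp (- (\<epsilon> * t)) * cos (t * d)) = \<epsilon> / (\<epsilon>\<^sup>2 + d\<^sup>2)"
    by (simp add: F_def)
qed

lemma lborel_pair_product:
  fixes a :: "'a::euclidean_space \<Rightarrow> real" and b :: "'b::euclidean_space \<Rightarrow> real"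
  assumes "integrable lborel a" "integrable lborel b"
  shows "integrable (lborel \<Otimes>\<^sub>M lborel) (\<lambda>p. a (fst p) * b (snd p))"
    and "(\<integral>p. a (fst p) * b (snd p) \<partial>(lborel \<Otimes>\<^sub>M lborel)) = integral\<^sup>L lborel a * integral\<^sup>L lborel b"
proof -
  note [measurable] = borel_measurable_integrable[OF assms(1)] borel_measurable_integrable[OF assms(2)]
  show int: "integrable (lborel \<Otimes>\<^sub>M lborel) (\<lambda>p. a (fst p) * b (snd p))"
  proof (rule lborel_pair.Fubini_integrable)
    show "integrable lborel (\<lambda>x. \<integral>y. norm (a (fst (x, y)) * b (snd (x, y))) \<partial>lborel)"
      using assms(1) by (simp add: abs_mult)
    show "AE x in lborel. integrable lborel (\<lambda>y. a (fst (x, y)) * b (snd (x, y)))"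
      using assms(2) by simp
  qed measurable
  from lborel_pair.integral_fst'[OF this]
  show "(\<integral>p. a (fst p) * b (snd p) \<partial>(lborel \<Otimes>\<^sub>M lborel)) = integral\<^sup>L lborel a * integral\<^sup>L lborel b"
    by simp
qed

text \<open>
  One half of Plancherel's theorem for the Mellin transform. With \<open>\<epsilon> = 1 / T\<close>, integrating
  \<open>exp (- \<epsilon> t) |H t|\<^sup>2\<close> over \<open>t \<ge> 0\<close> gives the quadratic form
  \<open>\<integral>\<integral> k x * k y * \<epsilon> / (\<epsilon>\<^sup>2 + (ln x - ln y)\<^sup>2)\<close>. As the kernel has mass at most \<open>pi\<close> in each logarithmic
  variable, Schur's test bounds the form by \<open>pi\<close> times the integral of \<open>x * (k x)\<^sup>2\<close>. On \<open>[0, T]\<close> the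
  damping factor is at least \<open>1 / exp 1\<close>.
\<close>
theorem mellin_mean_square_le:
  fixes k :: "real \<Rightarrow> real" and T :: real
  assumes int1: "integrable lborel k" and int2: "integrable lborel (\<lambda>x. x * (k x)\<^sup>2)"
    and k0: "\<And>x. x < 1 \<Longrightarrow> k x = 0" and T: "T > 0"
  defines "H \<equiv> \<lambda>t. \<integral>x. of_real (k x) * exp (- \<i> * of_real (t * ln x)) \<partial>lborel"
  shows "set_integrable lborel {0..T} (\<lambda>t. (norm (H t))\<^sup>2)"
    and "(LINT t:{0..T}|lborel. (norm (H t))\<^sup>2) \<le> exp 1 * pi * (\<integral>x. x * (k x)\<^sup>2 \<partial>lborel)"
proof -
  note [measurable] = borel_measurable_integrable[OF int1]
  define \<epsilon> where "\<epsilon> = 1 / T"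
  have \<epsilon>: "\<epsilon> > 0" using T by (simp add: \<epsilon>_def)
  define N where "N = (lborel \<Otimes>\<^sub>M lborel :: (real \<times> real) measure)"
  have NL: "N = lborel" unfolding N_def by (rule lborel_prod)
  define d :: "real \<times> real \<Rightarrow> real" where "d p = ln (fst p) - ln (snd p)" for p
  define P where "P p = k (fst p) * k (snd p)" for p
  have [measurable]: "P \<in> borel_measurable N" unfolding P_def N_def by measurable
  have [measurable]: "d \<in> borel_measurable N" unfolding d_def N_def by measurable
  have Pint: "integrable N P" unfolding P_def N_def by (rule lborel_pair_product[OF int1 int1])
  have H2: "(norm (H t))\<^sup>2 = (\<integral>p. P p * cos (t * d p) \<partial>N)" for t
  proof -
    define a where "a x = k x * cos (t * ln x)" for x
    define b where "b x = k x * sin (t * ln x)" for x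
    have aint: "integrable lborel a"
      by (rule Bochner_Integration.integrable_bound[OF int1]) (auto simp: a_def[abs_def] abs_mult intro!: mult_left_le)
    have bint: "integrable lborel b"
      by (rule Bochner_Integration.integrable_bound[OF int1]) (auto simp: b_def[abs_def] abs_mult intro!: mult_left_le)
    have euler: "exp (- \<i> * of_real y) = of_real (cos y) - \<i> * of_real (sin y)" for y :: real
      by (simp add: exp_minus_Euler cos_of_real sin_of_real)
    have "H t = (\<integral>x. of_real (a x) - \<i> * of_real (b x) \<partial>lborel)"
      unfolding H_def a_def b_def
      unfolding euler by (intro Bochner_Integration.integral_cong refl) (simp add: algebra_simps)
    also have "\<dots> = (\<integral>x. complex_of_real (a x) \<partial>lborel) - (\<integral>x. \<i> * of_real (b x) \<partial>lborel)"
      using aint bint by (intro Bochner_Integration.integral_diff integrable_of_real integrable_mult_right)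
    also have "\<dots> = of_real (integral\<^sup>L lborel a) - \<i> * of_real (integral\<^sup>L lborel b)"
      by simp
    finally have "(norm (H t))\<^sup>2 = integral\<^sup>L lborel a * integral\<^sup>L lborel a + integral\<^sup>L lborel b * integral\<^sup>L lborel b"
      by (simp add: cmod_power2 flip: power2_eq_square)
    also have "\<dots> = (\<integral>p. a (fst p) * a (snd p) + b (fst p) * b (snd p) \<partial>N)"
      using lborel_pair_product[OF aint aint] lborel_pair_product[OF bint bint] unfolding N_def by simp
    also have "\<dots> = (\<integral>p. P p * cos (t * d p) \<partial>N)"
      by (intro Bochner_Integration.integral_cong refl) (simp add: P_def a_def b_def d_def right_diff_distrib cos_diff algebra_simps)
    finally show ?thesis .
  qed
  define e where "e t = indicator {0..} t * exp (- (\<epsilon> * t))" for t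
  have eint: "integrable lborel e" using exp_cos_integral(1)[OF \<epsilon>] by (simp add: set_integrable_def e_def[abs_def])
  note [measurable] = borel_measurable_integrable[OF eint]
  have Fint: "integrable (lborel \<Otimes>\<^sub>M N) (\<lambda>(t, p). e t * (P p * cos (t * d p)))"
    unfolding NL
  proof (rule Bochner_Integration.integrable_bound[OF lborel_pair_product(1)[OF eint Pint[unfolded NL]]])
    show "(\<lambda>(t, p). e t * (P p * cos (t * d p))) \<in> borel_measurable (lborel \<Otimes>\<^sub>M lborel)"
      unfolding NL[symmetric] by measurable
    show "AE x in lborel \<Otimes>\<^sub>M lborel. norm (case x of (t, p) \<Rightarrow> e t * (P p * cos (t * d p))) \<le> norm (e (fst x) * P (snd x))"
    proof (intro AE_I2)
      fix x
      have "\<bar>e (fst x) * P (snd x)\<bar> * \<bar>cos (fst x * d (snd x))\<bar> \<le> \<bar>e (fst x) * P (snd x)\<bar> * 1"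
        by (intro mult_left_mono abs_cos_le_one) auto
      thus "norm (case x of (t, p) \<Rightarrow> e t * (P p * cos (t * d p))) \<le> norm (e (fst x) * P (snd x))"
        by (simp add: split_beta abs_mult mult_ac)
    qed
  qed
  have eHint: "integrable lborel (\<lambda>t. e t * (norm (H t))\<^sup>2)"
  proof -
    have "integrable lborel (\<lambda>t. \<integral>p. e t * (P p * cos (t * d p)) \<partial>N)"
      using lborel_pair.integrable_fst[OF Fint[unfolded NL]] unfolding NL .
    thus ?thesis unfolding H2 by simp
  qed
  have "(\<integral>t. e t * (norm (H t))\<^sup>2 \<partial>lborel) = (\<integral>t. (\<integral>p. e t * (P p * cos (t * d p)) \<partial>N) \<partial>lborel)"
    unfolding H2 by simp
  also have "\<dots> = (\<integral>p. (\<integral>t. e t * (P p * cos (t * d p)) \<partial>lborel) \<partial>N)"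
    using lborel_pair.Fubini_integral[OF Fint[unfolded NL]] unfolding NL by simp
  also have "\<dots> = (\<integral>p. P p * (\<epsilon> / (\<epsilon>\<^sup>2 + (d p)\<^sup>2)) \<partial>N)"
  proof (intro Bochner_Integration.integral_cong refl)
    fix p
    have "(\<integral>t. e t * (P p * cos (t * d p)) \<partial>lborel) = P p * (LINT t:{0..}|lborel. exp (- (\<epsilon> * t)) * cos (t * d p))"
      unfolding set_lebesgue_integral_def
      by (subst integral_mult_right_zero[symmetric]) (intro Bochner_Integration.integral_cong refl, simp add: e_def)
    thus "(\<integral>t. e t * (P p * cos (t * d p)) \<partial>lborel) = P p * (\<epsilon> / (\<epsilon>\<^sup>2 + (d p)\<^sup>2))"
      by (simp add: exp_cos_integral(2)[OF \<epsilon>])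
  qed
  finally have mean: "(\<integral>t. e t * (norm (H t))\<^sup>2 \<partial>lborel) = (\<integral>p. P p * (\<epsilon> / (\<epsilon>\<^sup>2 + (d p)\<^sup>2)) \<partial>N)" .
  define A where "A p = (fst p * (k (fst p))\<^sup>2) * (indicator {1..} (snd p) *\<^sub>R (\<epsilon> / (snd p * (\<epsilon>\<^sup>2 + (ln (fst p) - ln (snd p))\<^sup>2))))" for p
  have [measurable]: "A \<in> borel_measurable N" unfolding A_def N_def by measurable
  have kk0: "x * (k x)\<^sup>2 \<ge> 0" for x using k0[of x] by (cases "x < 1") auto
  have A0: "A p \<ge> 0" for p
    unfolding A_def using \<epsilon> kk0[of "fst p"] by (auto simp: indicator_def intro!: mult_nonneg_nonneg divide_nonneg_nonneg)
  define c where "c x = (LINT y:{1..}|lborel. \<epsilon> / (y * (\<epsilon>\<^sup>2 + (ln x - ln y)\<^sup>2)))" for x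
  have c: "0 \<le> c x" "c x \<le> pi" for x
    using cauchy_kernel_integral(2)[OF \<epsilon>, of "ln x"] \<epsilon>
    by (auto simp: c_def set_lebesgue_integral_def indicator_def intro!: Bochner_Integration.integral_nonneg)
  have Ay: "(\<integral>y. A (x, y) \<partial>lborel) = x * (k x)\<^sup>2 * c x" for x
    unfolding A_def c_def set_lebesgue_integral_def fst_conv snd_conv by (rule integral_mult_right_zero)
  have cint: "integrable lborel (\<lambda>x. x * (k x)\<^sup>2 * c x)"
  proof (rule Bochner_Integration.integrable_bound[OF integrable_mult_left[OF int2, of pi]])
    have "(\<lambda>x. \<integral>y. A (x, y) \<partial>lborel) \<in> borel_measurable lborel"
      by (rule lborel.borel_measurable_lebesgue_integral) (simp add: N_def[symmetric])
    thus "(\<lambda>x. x * (k x)\<^sup>2 * c x) \<in> borel_measurable lborel" unfolding Ay .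
    show "AE x in lborel. norm (x * (k x)\<^sup>2 * c x) \<le> norm (x * (k x)\<^sup>2 * pi)"
    proof (intro AE_I2)
      fix x
      have "x * (k x)\<^sup>2 * c x \<le> x * (k x)\<^sup>2 * pi" "0 \<le> x * (k x)\<^sup>2 * c x"
        using c[of x] kk0[of x] by (auto intro!: mult_left_mono mult_nonneg_nonneg)
      thus "norm (x * (k x)\<^sup>2 * c x) \<le> norm (x * (k x)\<^sup>2 * pi)" unfolding real_norm_def by linarith
    qed
  qed
  have Aint: "integrable N A"
    unfolding N_def
  proof (rule lborel_pair.Fubini_integrable)
    show "A \<in> borel_measurable (lborel \<Otimes>\<^sub>M lborel)" unfolding N_def[symmetric] by measurable
    show "integrable lborel (\<lambda>x. \<integral>y. norm (A (x, y)) \<partial>lborel)"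
      using cint A0 by (simp add: Ay)
    show "AE x in lborel. integrable lborel (\<lambda>y. A (x, y))"
      unfolding A_def fst_conv snd_conv
      by (intro AE_I2 integrable_mult_right cauchy_kernel_integral(1)[OF \<epsilon>, unfolded set_integrable_def])
  qed
  have IA: "integral\<^sup>L N A \<le> pi * (\<integral>x. x * (k x)\<^sup>2 \<partial>lborel)"
  proof -
    have "integral\<^sup>L N A = (\<integral>x. x * (k x)\<^sup>2 * c x \<partial>lborel)"
      using lborel_pair.integral_fst'[OF Aint[unfolded N_def]] unfolding N_def by (simp add: Ay)
    also have "\<dots> \<le> (\<integral>x. x * (k x)\<^sup>2 * pi \<partial>lborel)"
      using c kk0 by (intro integral_mono cint integrable_mult_left int2 mult_left_mono)
    finally show ?thesis by (simp add: mult.commute)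
  qed
  define A' where "A' = (\<lambda>(x, y). A (y, x))"
  have A'int: "integrable N A'"
    using lborel_pair.integrable_product_swap[OF Aint[unfolded N_def]] unfolding N_def A'_def .
  have IA': "integral\<^sup>L N A' = integral\<^sup>L N A"
    using lborel_pair.integral_product_swap[of A] unfolding N_def A'_def
    by (metis Aint N_def borel_measurable_integrable)
  have schur: "P p * (\<epsilon> / (\<epsilon>\<^sup>2 + (d p)\<^sup>2)) \<le> (A p + A' p) / 2" for p
  proof (cases "fst p \<ge> 1 \<and> snd p \<ge> 1")
    case True
    define x where "x = fst p"
    define y where "y = snd p"
    have p: "p = (x, y)" by (simp add: x_def y_def)
    have xy: "x \<ge> 1" "y \<ge> 1" using True by (auto simp: x_def y_def)
    define \<kappa> where "\<kappa> = \<epsilon> / (\<epsilon>\<^sup>2 + (ln x - ln y)\<^sup>2)"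
    have \<kappa>: "\<kappa> \<ge> 0" using \<epsilon> by (simp add: \<kappa>_def)
    have \<kappa>': "\<epsilon> / (\<epsilon>\<^sup>2 + (ln y - ln x)\<^sup>2) = \<kappa>" by (simp add: \<kappa>_def power2_commute)
    \<comment> \<open>the weight \<open>1 / y\<close> is the density of \<open>ln y\<close>, in which the kernel has mass at most \<open>pi\<close>\<close>
    have "2 * (k x * k y) \<le> x * (k x)\<^sup>2 / y + y * (k y)\<^sup>2 / x"
    proof -
      have "0 \<le> (x * k x - y * k y)\<^sup>2 / (x * y)" using xy by simp
      also have "\<dots> = x * (k x)\<^sup>2 / y + y * (k y)\<^sup>2 / x - 2 * (k x * k y)"
        using xy by (simp add: power2_eq_square field_simps)
      finally show ?thesis by simp
    qed
    hence "2 * (k x * k y) * \<kappa> \<le> (x * (k x)\<^sup>2 / y + y * (k y)\<^sup>2 / x) * \<kappa>" by (rule mult_right_mono[OF _ \<kappa>])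
    moreover have "A p = x * (k x)\<^sup>2 / y * \<kappa>" using xy by (simp add: A_def p \<kappa>_def)
    moreover have "A' p = y * (k y)\<^sup>2 / x * \<kappa>"
      unfolding \<kappa>'[symmetric] using xy by (simp add: A_def A'_def p)
    moreover have "P p * (\<epsilon> / (\<epsilon>\<^sup>2 + (d p)\<^sup>2)) = k x * k y * \<kappa>" by (simp add: P_def d_def p \<kappa>_def)
    ultimately show ?thesis by (simp add: algebra_simps)
  next
    case False
    hence "P p = 0" using k0[of "fst p"] k0[of "snd p"] by (auto simp: P_def not_le)
    thus ?thesis using A0[of p] A0[of "(snd p, fst p)"] by (simp add: A'_def split_beta)
  qed
  have "(\<integral>p. P p * (\<epsilon> / (\<epsilon>\<^sup>2 + (d p)\<^sup>2)) \<partial>N) \<le> (\<integral>p. (A p + A' p) / 2 \<partial>N)"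
  proof (intro integral_mono schur)
    show "integrable N (\<lambda>p. P p * (\<epsilon> / (\<epsilon>\<^sup>2 + (d p)\<^sup>2)))"
    proof (rule Bochner_Integration.integrable_bound[OF integrable_mult_left[OF Pint, of "1 / \<epsilon>"]])
      show "AE p in N. norm (P p * (\<epsilon> / (\<epsilon>\<^sup>2 + (d p)\<^sup>2))) \<le> norm (P p * (1 / \<epsilon>))"
      proof (intro AE_I2)
        fix p
        have "\<epsilon> / (\<epsilon>\<^sup>2 + (d p)\<^sup>2) \<le> \<epsilon> / \<epsilon>\<^sup>2" using \<epsilon> by (intro divide_left_mono) (auto intro!: mult_pos_pos add_pos_nonneg)
        hence "\<epsilon> / (\<epsilon>\<^sup>2 + (d p)\<^sup>2) \<le> 1 / \<epsilon>" using \<epsilon> by (simp add: power2_eq_square)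
        moreover have "\<bar>\<epsilon> / (\<epsilon>\<^sup>2 + (d p)\<^sup>2)\<bar> = \<epsilon> / (\<epsilon>\<^sup>2 + (d p)\<^sup>2)" "\<bar>1 / \<epsilon>\<bar> = 1 / \<epsilon>" using \<epsilon> by simp_all
        ultimately show "norm (P p * (\<epsilon> / (\<epsilon>\<^sup>2 + (d p)\<^sup>2))) \<le> norm (P p * (1 / \<epsilon>))"
          unfolding real_norm_def abs_mult[of "P p"] by (simp only: mult_left_mono abs_ge_zero)
      qed
    qed measurable
    show "integrable N (\<lambda>p. (A p + A' p) / 2)" using Aint A'int by simp
  qed
  also have "\<dots> = integral\<^sup>L N A" using Aint A'int IA' by simp
  also note IA
  finally have main: "(\<integral>t. e t * (norm (H t))\<^sup>2 \<partial>lborel) \<le> pi * (\<integral>x. x * (k x)\<^sup>2 \<partial>lborel)" unfolding mean .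
  have eH: "(\<lambda>t. exp (\<epsilon> * t) * (e t * (norm (H t))\<^sup>2)) \<in> borel_measurable lborel"
    by (intro borel_measurable_times borel_measurable_integrable[OF eHint]) measurable
  have dom: "norm (indicator {0..T} t *\<^sub>R (norm (H t))\<^sup>2) \<le> exp 1 * (e t * (norm (H t))\<^sup>2)" for t
  proof (cases "t \<in> {0..T}")
    case True
    have "\<epsilon> * t \<le> 1" using True T by (simp add: \<epsilon>_def)
    hence "1 \<le> exp (1 + - (\<epsilon> * t))" by simp
    hence "1 \<le> exp 1 * e t" using True unfolding exp_add by (simp add: e_def)
    from mult_right_mono[OF this, of "(norm (H t))\<^sup>2"] show ?thesis using True by (simp add: mult.assoc)
  qed (simp add: e_def)
  have iH: "integrable lborel (\<lambda>t. indicator {0..T} t *\<^sub>R (norm (H t))\<^sup>2)"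
  proof (rule Bochner_Integration.integrable_bound[OF integrable_mult_right[OF eHint, of "exp 1"]])
    have "(\<lambda>t. indicator {0..T} t *\<^sub>R (norm (H t))\<^sup>2) = (\<lambda>t. indicator {0..T} t * (exp (\<epsilon> * t) * (e t * (norm (H t))\<^sup>2)))"
      by (auto simp: e_def indicator_def exp_minus)
    also have "\<dots> \<in> borel_measurable lborel" using eH by measurable
    finally show "(\<lambda>t. indicator {0..T} t *\<^sub>R (norm (H t))\<^sup>2) \<in> borel_measurable lborel" .
    show "AE t in lborel. norm (indicator {0..T} t *\<^sub>R (norm (H t))\<^sup>2) \<le> norm (exp 1 * (e t * (norm (H t))\<^sup>2))"
      by (intro AE_I2 order.trans[OF dom]) simp
  qed
  thus "set_integrable lborel {0..T} (\<lambda>t. (norm (H t))\<^sup>2)" by (simp add: set_integrable_def)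
  have "(LINT t:{0..T}|lborel. (norm (H t))\<^sup>2) \<le> (\<integral>t. exp 1 * (e t * (norm (H t))\<^sup>2) \<partial>lborel)"
    unfolding set_lebesgue_integral_def
    by (intro integral_mono iH integrable_mult_right eHint order.trans[OF abs_ge_self dom[unfolded real_norm_def]])
  also have "\<dots> = exp 1 * (\<integral>t. e t * (norm (H t))\<^sup>2 \<partial>lborel)" by simp
  also have "\<dots> \<le> exp 1 * (pi * (\<integral>x. x * (k x)\<^sup>2 \<partial>lborel))" by (intro mult_left_mono main) simp
  finally show "(LINT t:{0..T}|lborel. (norm (H t))\<^sup>2) \<le> exp 1 * pi * (\<integral>x. x * (k x)\<^sup>2 \<partial>lborel)" by (simp add: mult.assoc)
qed

section \<open>A lower bound for mean values on vertical lines\<close>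

text \<open>
  Cauchy's theorem for \<open>F K\<close> on the rectangle with corners \<open>\<sigma> + \<i> T\<close> and \<open>c + 2 \<i> T\<close>, in the form that
  a primitive of \<open>F K\<close> returns to its value around the boundary. The kernel
  \<open>K s = (- (s - c - \<i> T) (c + 2 \<i> T - s) / T\<^sup>2) ^ p\<close> has zeros of order \<open>p\<close> at the two corners on the line
  \<open>Re s = c\<close>. It is of size \<open>T powr (- p)\<close> on the horizontal sides, which cancels the growth of \<open>F\<close>; it is
  bounded on the left side; and it is real and nonnegative on the right side, where \<open>Re F \<ge> 1 / 2\<close> makes
  the integral at least a constant times \<open>T\<close>. So the left side must contribute as much.
\<close>
lemma mean_value_lower_bound:
  fixes F :: "complex \<Rightarrow> complex" and a \<sigma> c A :: real and p :: nat
  assumes hol: "F holomorphic_on {s. Re s > a \<and> Im s > 0}" and a: "a < \<sigma>" and c: "\<sigma> < c" and A: "A \<ge> 0"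
    and growth: "\<And>s. \<sigma> \<le> Re s \<Longrightarrow> Re s \<le> c \<Longrightarrow> Im s \<ge> 1 \<Longrightarrow> norm (F s) \<le> A * Im s ^ p"
    and right: "\<And>t. t \<ge> 1 \<Longrightarrow> Re (F (Complex c t)) \<ge> 1 / 2"
  obtains C T0 where "C > 0" "\<And>T. T \<ge> T0 \<Longrightarrow> C * T \<le> integral {T..2 * T} (\<lambda>t. norm (F (Complex \<sigma> t)))"
proof -
  define D where "D = c - \<sigma>"
  have D: "D > 0" using c by (simp add: D_def)
  define M where "M = 2 * (A * (4 * D) ^ p * D)"
  have M: "M \<ge> 0" using A D by (simp add: M_def)
  define S where "S = {s. Re s > a \<and> Im s > 0}"
  have S_eq: "S = {s. Re s > a} \<inter> {s. Im s > 0}" by (auto simp: S_def)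
  have oS: "open S" unfolding S_eq by (intro open_Int open_halfspace_Re_gt open_halfspace_Im_gt)
  have cS: "convex S" unfolding S_eq by (intro convex_Int convex_halfspace_Re_gt convex_halfspace_Im_gt)
  have bound: "T / 4 * (3 / 16) ^ p \<le> 4 ^ p * integral {T..2 * T} (\<lambda>t. norm (F (Complex \<sigma> t))) + M"
    if T: "T \<ge> 1" "T \<ge> D" for T
  proof -
    define K where "K s = (- (s - of_real c - \<i> * of_real T) * (of_real c + 2 * \<i> * of_real T - s) / of_real (T\<^sup>2)) ^ p" for s
    define f where "f s = F s * K s" for s
    have holf: "f holomorphic_on S"
      unfolding f_def K_def using hol T by (intro holomorphic_intros) (auto simp: S_def)
    obtain P where P: "\<And>s. s \<in> S \<Longrightarrow> (P has_field_derivative f s) (at s)"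
      using holomorphic_convex_primitive'[OF cS oS holf] by (metis at_within_open[OF _ oS])
    have vert: "((\<lambda>t. \<i> * f (Complex x t)) has_integral (P (Complex x (2 * T)) - P (Complex x T))) {T..2 * T}"
      if x: "x \<ge> \<sigma>" for x
    proof (rule fundamental_theorem_of_calculus)
      show "T \<le> 2 * T" using T by simp
      fix t assume t: "t \<in> {T..2 * T}"
      hence "Complex x t \<in> S" using T x a by (auto simp: S_def)
      have "(Complex x has_vector_derivative \<i>) (at t within {T..2 * T})"
        unfolding complex_eq has_vector_derivative_def Complex_eq
        by (auto intro!: derivative_eq_intros simp: scaleR_conv_of_real mult.commute)
      from field_vector_diff_chain_within[OF this has_field_derivative_at_within[OF P[OF \<open>Complex x t \<in> S\<close>]]]
      show "((\<lambda>t. P (Complex x t)) has_vector_derivative \<i> * f (Complex x t)) (at t within {T..2 * T})"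
        by (simp add: o_def)
    qed
    have contF: "continuous_on {T..2 * T} (\<lambda>t. F (Complex x t))" if "x \<ge> \<sigma>" for x
      using T that a unfolding Complex_eq
      by (intro continuous_on_compose2[OF holomorphic_on_imp_continuous_on[OF hol]] continuous_intros) auto
    have hor: "norm (P (Complex c y) - P (Complex \<sigma> y)) \<le> A * (4 * D) ^ p * D" if y: "y = T \<or> y = 2 * T" for y
    proof -
      define R where "R = closed_segment (Complex \<sigma> y) (Complex c y)"
      have R: "\<sigma> \<le> Re s \<and> Re s \<le> c \<and> Im s = y" if "s \<in> R" for s
        using that c by (simp add: R_def closed_segment_same_Im closed_segment_eq_real_ivl)
      have "norm (P (Complex c y) - P (Complex \<sigma> y)) \<le> A * (4 * D) ^ p * norm (Complex c y - Complex \<sigma> y)"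
      proof (rule field_differentiable_bound)
        show "convex R" by (simp add: R_def)
        show "Complex c y \<in> R" "Complex \<sigma> y \<in> R" by (auto simp: R_def)
        fix s assume s: "s \<in> R"
        have "s \<in> S" using R[OF s] y T a by (auto simp: S_def)
        show "(P has_field_derivative f s) (at s within R)" using P[OF \<open>s \<in> S\<close>] by (rule has_field_derivative_at_within)
        have F: "norm (F s) \<le> A * y ^ p" using growth[of s] R[OF s] y T by auto
        have y0: "y > 0" using y T by auto
        have e: "\<bar>Re s - c\<bar> \<le> D" using R[OF s] by (simp add: D_def)
        have n1: "norm (s - of_real c - \<i> * of_real T) \<le> D + \<bar>y - T\<bar>"
          using cmod_le[of "s - of_real c - \<i> * of_real T"] e R[OF s] by simp
        have n2: "norm (of_real c + 2 * \<i> * of_real T - s) \<le> D + \<bar>2 * T - y\<bar>"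
          using cmod_le[of "of_real c + 2 * \<i> * of_real T - s"] e R[OF s] by simp
        have n12: "norm (s - of_real c - \<i> * of_real T) * norm (of_real c + 2 * \<i> * of_real T - s) \<le> D * (2 * T)"
        proof -
          have "norm (s - of_real c - \<i> * of_real T) * norm (of_real c + 2 * \<i> * of_real T - s) \<le> (D + \<bar>y - T\<bar>) * (D + \<bar>2 * T - y\<bar>)"
            using n1 n2 D by (intro mult_mono) auto
          also have "\<dots> = D * (D + T)" using y T by auto
          also have "\<dots> \<le> D * (2 * T)" using D T by (intro mult_left_mono) auto
          finally show ?thesis .
        qed
        have "norm (K s) = (norm (s - of_real c - \<i> * of_real T) * norm (of_real c + 2 * \<i> * of_real T - s) / T\<^sup>2) ^ p"
          unfolding K_def norm_power norm_divide norm_mult norm_minus_cancel norm_of_real by simp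
        also have "\<dots> \<le> (D * (2 * T) / T\<^sup>2) ^ p"
          using n12 T by (intro power_mono divide_right_mono) auto
        also have "D * (2 * T) / T\<^sup>2 = 2 * D / T" using T by (simp add: power2_eq_square)
        finally have K: "norm (K s) \<le> (2 * D / T) ^ p" .
        have "norm (f s) \<le> (A * y ^ p) * (2 * D / T) ^ p"
          unfolding f_def norm_mult using F K A y0 by (intro mult_mono) auto
        also have "\<dots> = A * (y * (2 * D / T)) ^ p" by (simp only: power_mult_distrib mult.assoc)
        also have "\<dots> \<le> A * (4 * D) ^ p"
        proof (intro mult_left_mono power_mono A)
          have "y * (2 * D / T) \<le> 2 * T * (2 * D / T)" using y T D by (intro mult_right_mono) auto
          thus "y * (2 * D / T) \<le> 4 * D" using T by simp
        qed (use y0 D T in simp)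
        finally show "norm (f s) \<le> A * (4 * D) ^ p" .
      qed
      moreover have "norm (Complex c y - Complex \<sigma> y) = D" using D by (simp add: norm_complex_def D_def)
      ultimately show ?thesis by simp
    qed
    have left: "norm (P (Complex \<sigma> (2 * T)) - P (Complex \<sigma> T)) \<le> 4 ^ p * integral {T..2 * T} (\<lambda>t. norm (F (Complex \<sigma> t)))"
    proof -
      have "norm (P (Complex \<sigma> (2 * T)) - P (Complex \<sigma> T)) = norm (integral {T..2 * T} (\<lambda>t. \<i> * f (Complex \<sigma> t)))"
        by (simp only: integral_unique[OF vert[OF order_refl]])
      also have "\<dots> \<le> integral {T..2 * T} (\<lambda>t. 4 ^ p * norm (F (Complex \<sigma> t)))"
      proof (rule integral_norm_bound_integral)
        show "(\<lambda>t. \<i> * f (Complex \<sigma> t)) integrable_on {T..2 * T}" using vert[of \<sigma>] by (blast intro: has_integral_integrable)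
        show "(\<lambda>t. 4 ^ p * norm (F (Complex \<sigma> t))) integrable_on {T..2 * T}"
          by (intro integrable_continuous_real continuous_intros contF) simp
        fix t assume t: "t \<in> {T..2 * T}"
        define s where "s = Complex \<sigma> t"
        have n1: "norm (s - of_real c - \<i> * of_real T) \<le> 2 * T"
          using cmod_le[of "s - of_real c - \<i> * of_real T"] t T c by (simp add: s_def D_def)
        have n2: "norm (of_real c + 2 * \<i> * of_real T - s) \<le> 2 * T"
          using cmod_le[of "of_real c + 2 * \<i> * of_real T - s"] t T c by (simp add: s_def D_def)
        have "norm (K s) = (norm (s - of_real c - \<i> * of_real T) * norm (of_real c + 2 * \<i> * of_real T - s) / T\<^sup>2) ^ p"
          unfolding K_def norm_power norm_divide norm_mult norm_minus_cancel norm_of_real by simp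
        also have "\<dots> \<le> ((2 * T) * (2 * T) / T\<^sup>2) ^ p"
          using n1 n2 T by (intro power_mono divide_right_mono mult_mono) auto
        also have "(2 * T) * (2 * T) / T\<^sup>2 = 4" using T by (simp add: power2_eq_square)
        finally have "norm (F s) * norm (K s) \<le> norm (F s) * 4 ^ p" by (intro mult_left_mono) auto
        thus "norm (\<i> * f (Complex \<sigma> t)) \<le> 4 ^ p * norm (F (Complex \<sigma> t))"
          by (simp add: f_def norm_mult s_def mult.commute)
      qed
      finally show ?thesis by simp
    qed
    have rightedge: "T / 4 * (3 / 16) ^ p \<le> norm (P (Complex c (2 * T)) - P (Complex c T))"
    proof -
      define k where "k t = ((t - T) * (2 * T - t) / T\<^sup>2) ^ p" for t
      have Kc: "K (Complex c t) = of_real (k t)" for t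
      proof -
        have "Complex c t - of_real c - \<i> * of_real T = \<i> * of_real (t - T)"
          "of_real c + 2 * \<i> * of_real T - Complex c t = \<i> * of_real (2 * T - t)"
          by (simp_all add: complex_eq_iff)
        hence "K (Complex c t) = (- (\<i> * of_real (t - T)) * (\<i> * of_real (2 * T - t)) / of_real (T\<^sup>2)) ^ p"
          by (simp only: K_def)
        also have "- (\<i> * of_real (t - T)) * (\<i> * of_real (2 * T - t)) = complex_of_real ((t - T) * (2 * T - t))"
          by (simp add: complex_eq_iff)
        finally show ?thesis by (simp only: k_def of_real_power of_real_divide)
      qed
      have fc: "((\<lambda>t. f (Complex c t)) has_integral (P (Complex c (2 * T)) - P (Complex c T)) / \<i>) {T..2 * T}"
        using has_integral_divide[OF vert[of c], of \<i>] c by simp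
      have r: "((\<lambda>t. Re (f (Complex c t))) has_integral Re ((P (Complex c (2 * T)) - P (Complex c T)) / \<i>)) {T..2 * T}"
        using has_integral_Re[OF fc] .
      have rk: "Re (f (Complex c t)) \<ge> 1 / 2 * k t" if "T \<le> t" "t \<le> 2 * T" for t
      proof -
        have "k t \<ge> 0" using that T by (simp add: k_def)
        hence "1 / 2 * k t \<le> Re (F (Complex c t)) * k t" using right[of t] that T by (intro mult_right_mono) auto
        thus ?thesis by (simp add: f_def Kc)
      qed
      have sub: "(\<lambda>t. Re (f (Complex c t))) integrable_on {5 / 4 * T..7 / 4 * T}"
        using r by (rule integrable_subinterval_real[OF has_integral_integrable]) (use T in auto)
      have "((\<lambda>t. 1 / 2 * (3 / 16) ^ p) has_integral (T / 2) * (1 / 2 * (3 / 16) ^ p)) {5 / 4 * T..7 / 4 * T}"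
        using has_integral_const_real[of "1 / 2 * (3 / 16) ^ p :: real" "5 / 4 * T" "7 / 4 * T"] T by simp
      hence "(T / 2) * (1 / 2 * (3 / 16) ^ p) \<le> integral {5 / 4 * T..7 / 4 * T} (\<lambda>t. Re (f (Complex c t)))"
      proof (rule has_integral_le[OF _ integrable_integral[OF sub]])
        fix t assume t: "t \<in> {5 / 4 * T..7 / 4 * T}"
        have "0 \<le> (t - 5 / 4 * T) * (7 / 4 * T - t)" using t by (intro mult_nonneg_nonneg) auto
        hence "3 / 16 \<le> (t - T) * (2 * T - t) / T\<^sup>2"
          using T by (simp add: field_simps power2_eq_square)
        hence "(3 / 16) ^ p \<le> k t" unfolding k_def by (intro power_mono) auto
        moreover have "1 / 2 * k t \<le> Re (f (Complex c t))" using t T by (intro rk) auto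
        ultimately show "1 / 2 * (3 / 16) ^ p \<le> Re (f (Complex c t))" by linarith
      qed
      also have "\<dots> \<le> integral {T..2 * T} (\<lambda>t. Re (f (Complex c t)))"
      proof (rule integral_subset_le[OF _ sub has_integral_integrable[OF r]])
        show "{5 / 4 * T..7 / 4 * T} \<subseteq> {T..2 * T}" using T by auto
        show "\<forall>t \<in> {T..2 * T}. 0 \<le> Re (f (Complex c t))"
          using T by (intro ballI order.trans[OF _ rk]) (auto simp: k_def)
      qed
      also have "\<dots> = Re ((P (Complex c (2 * T)) - P (Complex c T)) / \<i>)" using r by (rule integral_unique)
      also have "\<dots> \<le> norm ((P (Complex c (2 * T)) - P (Complex c T)) / \<i>)" by (rule complex_Re_le_cmod)
      also have "\<dots> = norm (P (Complex c (2 * T)) - P (Complex c T))" by (simp add: norm_divide norm_mult)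
      finally show ?thesis by simp
    qed
    have "norm (P (Complex c (2 * T)) - P (Complex c T)) \<le> norm (P (Complex c (2 * T)) - P (Complex \<sigma> (2 * T)))
        + norm (P (Complex \<sigma> (2 * T)) - P (Complex \<sigma> T)) + norm (P (Complex c T) - P (Complex \<sigma> T))"
      by norm
    thus ?thesis using rightedge left hor[of T] hor[of "2 * T"] by (simp add: M_def)
  qed
  define q :: real where "q = (3 / 16) ^ p"
  have q: "q > 0" by (simp add: q_def)
  show ?thesis
  proof
    show "q / (8 * 4 ^ p) > 0" using q by simp
    fix T assume T: "T \<ge> max (max 1 D) (8 * M / q)"
    hence "8 * M \<le> T * q" using q by (simp add: field_simps)
    hence "T * q / 8 \<le> 4 ^ p * integral {T..2 * T} (\<lambda>t. norm (F (Complex \<sigma> t)))"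
      using bound[of T] T unfolding q_def[symmetric] by simp
    thus "q / (8 * 4 ^ p) * T \<le> integral {T..2 * T} (\<lambda>t. norm (F (Complex \<sigma> t)))"
      by (simp add: field_simps)
  qed
qed

text \<open>
  On the line \<open>Re w = \<sigma>\<close> the shifted arguments for \<open>k \<le> 3\<close> are \<open>1 - cnj (k w)\<close>, so the factors have the
  modulus of \<open>\<zeta>(1 - k w)\<close>. Shifting instead of reflecting keeps the arguments moving to the right with \<open>w\<close>,
  where the zeta function tends to \<open>1\<close>.
\<close>
definition reflected_abelian_zeta :: "real \<Rightarrow> complex \<Rightarrow> complex" where
  "reflected_abelian_zeta \<sigma> w =
     (\<Prod>k=1..6. riemann_zeta (of_real (if k \<le> 3 then 1 - 2 * real k * \<sigma> else 0) + of_nat k * w)) * zeta_tail 7 w"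

text \<open>
  To the right of \<open>\<sigma>\<close> all six arguments have real part at least \<open>1 / 2\<close>, where the zeta function grows at
  most quadratically; this gives the exponent \<open>12\<close>.
\<close>
lemma mean_value_reflected_abelian_zeta:
  assumes \<sigma>: "1 / 7 < \<sigma>" "\<sigma> \<le> 1 / 6"
  obtains C T0 where "C > 0"
    "\<And>T. T \<ge> T0 \<Longrightarrow> C * T \<le> integral {T..2 * T} (\<lambda>t. norm (reflected_abelian_zeta \<sigma> (Complex \<sigma> t)))"
proof -
  define sh where "sh k = (if k \<le> 3 then 1 - 2 * real k * \<sigma> else 0)" for k :: nat
  have sh0: "sh k \<ge> 0" "sh k \<le> 1" for k
  proof -
    have "real k * \<sigma> \<le> 3 * (1 / 6)" if "k \<le> 3" using that \<sigma> by (intro mult_mono) auto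
    thus "sh k \<ge> 0" "sh k \<le> 1" using \<sigma> by (auto simp: sh_def)
  qed
  have shift: "sh k + real k * x \<ge> 1 / 2" if k: "1 \<le> k" and x: "x \<ge> \<sigma>" for k x
  proof (cases "k \<le> 3")
    case True
    have "real k * \<sigma> \<le> 3 * (1 / 6)" using True \<sigma> by (intro mult_mono) auto
    moreover have "real k * x \<ge> real k * \<sigma>" using x by (intro mult_left_mono) auto
    ultimately show ?thesis using True by (simp add: sh_def)
  next
    case False
    have "4 * (1 / 7) \<le> real k * x" using False x \<sigma> by (intro mult_mono) auto
    thus ?thesis using False by (simp add: sh_def)
  qed
  note H_def = reflected_abelian_zeta_def[of \<sigma>, folded sh_def]
  define B where "B = (3 + (\<Sum>n. real (Suc n) powr - (5 / 2)))"
  have B: "B \<ge> 0" unfolding B_def by (intro add_nonneg_nonneg suminf_nonneg summable_Suc_powr) auto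
  obtain K where K: "K \<ge> 0" "\<And>s. Re s \<ge> \<sigma> \<Longrightarrow> norm (zeta_tail 7 s - 1) \<le> exp (K * 2 powr - (7 * Re s)) - 1"
    using norm_zeta_tail_minus_one_le[of 7 \<sigma>] \<sigma> by auto
  define E where "E = (\<Sum>n. real (Suc n) powr - 2)"
  have "((\<lambda>c. E * 2 powr (2 - c)) \<longlongrightarrow> 0) at_top" by real_asymp
  hence ev1: "\<forall>\<^sub>F c in at_top. E * 2 powr (2 - c) < 1 / 20" by (rule order_tendstoD) simp
  have "((\<lambda>c. exp (K * 2 powr - (7 * c)) - 1) \<longlongrightarrow> 0) at_top" by real_asymp
  hence ev2: "\<forall>\<^sub>F c in at_top. exp (K * 2 powr - (7 * c)) - 1 < 1 / 20" by (rule order_tendstoD) simp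
  \<comment> \<open>on the line \<open>Re s = c\<close> each of the seven factors is within \<open>1 / 20\<close> of \<open>1\<close>, and \<open>(21 / 20) ^ 7 - 1 \<le> 1 / 2\<close>\<close>
  obtain c where c: "c \<ge> 2" "E * 2 powr (2 - c) < 1 / 20" "exp (K * 2 powr - (7 * c)) - 1 < 1 / 20"
    using eventually_happens'[OF _ eventually_conj[OF eventually_ge_at_top[of 2] eventually_conj[OF ev1 ev2]]] by auto
  define R where "R = 1 + 6 * (c + 1)"
  have R: "R \<ge> 1" using c by (simp add: R_def)
  define Tl where "Tl = exp (K * 2 powr 0)"
  define A where "A = (B * R\<^sup>2) ^ 6 * Tl"
  show thesis
  proof (rule mean_value_lower_bound[of "reflected_abelian_zeta \<sigma>" "1 / 7" \<sigma> c A 12])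
    show "reflected_abelian_zeta \<sigma> holomorphic_on {s. 1 / 7 < Re s \<and> 0 < Im s}"
      unfolding H_def[abs_def]
    proof (intro holomorphic_intros)
      fix k :: nat assume k: "k \<in> {1..6}"
      have "(riemann_zeta \<circ> (\<lambda>w. of_real (sh k) + of_nat k * w)) holomorphic_on {s. 1 / 7 < Re s \<and> 0 < Im s}"
      proof (rule holomorphic_on_compose)
        show "riemann_zeta holomorphic_on (\<lambda>w. of_real (sh k) + of_nat k * w) ` {s. 1 / 7 < Re s \<and> 0 < Im s}"
          using k by (intro holomorphic_on_subset[OF holomorphic_riemann_zeta]) (auto simp: complex_eq_iff)
      qed (intro holomorphic_intros)
      thus "(\<lambda>w. riemann_zeta (of_real (sh k) + of_nat k * w)) holomorphic_on {s. 1 / 7 < Re s \<and> 0 < Im s}"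
        by (simp add: o_def)
    next
      show "zeta_tail 7 holomorphic_on {s. 1 / 7 < Re s \<and> 0 < Im s}"
        by (rule holomorphic_on_subset[OF holomorphic_zeta_tail]) auto
    qed
    show "A \<ge> 0" using B by (simp add: A_def Tl_def)
    show "norm (reflected_abelian_zeta \<sigma> s) \<le> A * Im s ^ 12" if s: "\<sigma> \<le> Re s" "Re s \<le> c" "1 \<le> Im s" for s
    proof -
      have ns: "norm s \<le> (c + 1) * Im s"
      proof -
        have "norm s \<le> \<bar>Re s\<bar> + \<bar>Im s\<bar>" by (rule cmod_le)
        also have "\<dots> \<le> c * 1 + Im s" using s \<sigma> by simp
        also have "\<dots> \<le> c * Im s + Im s" using s c by (intro add_mono mult_left_mono) auto
        finally show ?thesis by (simp add: algebra_simps)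
      qed
      have "norm (\<Prod>k=1..6. riemann_zeta (of_real (sh k) + of_nat k * s)) \<le> (\<Prod>k=1..(6::nat). B * (R * Im s)\<^sup>2)"
        unfolding prod_norm[symmetric]
      proof (intro prod_mono conjI norm_ge_zero)
        fix k :: nat assume k: "k \<in> {1..6}"
        have "1 * 1 \<le> real k * Im s" using k s by (intro mult_mono) auto
        hence im: "\<bar>Im (of_real (sh k) + of_nat k * s)\<bar> \<ge> 1" by simp
        have z: "norm (riemann_zeta (of_real (sh k) + of_nat k * s)) \<le> B * (norm (of_real (sh k) + of_nat k * s))\<^sup>2"
          unfolding B_def using k s im shift[of k "Re s"] by (intro norm_riemann_zeta_le) auto
        have n: "norm (of_real (sh k) + of_nat k * s) \<le> R * Im s"
        proof -
          have "norm (of_real (sh k) + of_nat k * s) \<le> \<bar>sh k\<bar> + real k * norm s"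
            by (rule order.trans[OF norm_triangle_ineq]) (simp add: norm_mult)
          also have "\<dots> \<le> 1 * Im s + 6 * ((c + 1) * Im s)"
            using sh0[of k] s ns k by (intro add_mono mult_mono) auto
          finally show ?thesis by (simp add: R_def algebra_simps)
        qed
        show "norm (riemann_zeta (of_real (sh k) + of_nat k * s)) \<le> B * (R * Im s)\<^sup>2"
          by (rule order.trans[OF z mult_left_mono[OF power_mono[OF n norm_ge_zero] B]])
      qed
      also have "\<dots> = (B * R\<^sup>2) ^ 6 * Im s ^ 12" by (simp add: power_mult_distrib flip: power_mult)
      finally have n1: "norm (\<Prod>k=1..6. riemann_zeta (of_real (sh k) + of_nat k * s)) \<le> (B * R\<^sup>2) ^ 6 * Im s ^ 12" .
      have "norm (zeta_tail 7 s) \<le> 1 + norm (zeta_tail 7 s - 1)"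
        using norm_triangle_ineq[of 1 "zeta_tail 7 s - 1"] by simp
      also have "\<dots> \<le> exp (K * 2 powr - (7 * Re s))" using K(2)[of s] s by simp
      also have "\<dots> \<le> Tl" unfolding Tl_def using K(1) s \<sigma> by (intro exp_mono mult_left_mono powr_mono) auto
      finally have n2: "norm (zeta_tail 7 s) \<le> Tl" .
      have "norm (reflected_abelian_zeta \<sigma> s) \<le> ((B * R\<^sup>2) ^ 6 * Im s ^ 12) * Tl"
        unfolding H_def norm_mult using n1 n2 B s by (intro mult_mono) auto
      thus ?thesis by (simp add: A_def mult_ac)
    qed
    show "Re (reflected_abelian_zeta \<sigma> (Complex c t)) \<ge> 1 / 2" if t: "t \<ge> 1" for t
    proof -
      define s where "s = Complex c t"
      define u where "u k = riemann_zeta (of_real (sh k) + of_nat k * s) - 1" for k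
      define v where "v = zeta_tail 7 s - 1"
      have u: "norm (u k) \<le> 1 / 20" if k: "k \<in> {1..6}" for k
      proof -
        have "1 * c \<le> real k * c" using k c by (intro mult_right_mono) auto
        hence re: "Re (of_real (sh k) + of_nat k * s) \<ge> c" using sh0[of k] by (simp add: s_def)
        have "norm (u k) \<le> E * 2 powr (2 - Re (of_real (sh k) + of_nat k * s))"
          unfolding u_def E_def using re c by (intro norm_riemann_zeta_minus_one_le) auto
        also have "\<dots> \<le> E * 2 powr (2 - c)"
          using re unfolding E_def by (intro mult_left_mono powr_mono suminf_nonneg summable_Suc_powr) auto
        finally show ?thesis using c by simp
      qed
      have v: "norm v \<le> 1 / 20" using K(2)[of s] c \<sigma> by (simp add: v_def s_def)
      have "reflected_abelian_zeta \<sigma> s = (\<Prod>k=1..6. 1 + u k) * (1 + v)" by (simp add: H_def u_def v_def)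
      also have "\<dots> = (\<Prod>k=1..7. 1 + (if k = 7 then v else u k))"
        by (simp add: eval_nat_numeral prod.atLeast_Suc_atMost_Suc_shift)
      finally have "norm (reflected_abelian_zeta \<sigma> s - 1) \<le> (\<Prod>k=1..7. 1 + norm (if k = 7 then v else u k)) - 1"
        by (simp only: norm_prod_minus1_le_prod_minus1)
      also have "(\<Prod>k=1..7. 1 + norm (if k = 7 then v else u k)) \<le> (\<Prod>k=1..(7::nat). 21 / 20)"
        using u v by (intro prod_mono) auto
      also have "\<dots> = (21 / 20) ^ 7" by simp
      also have "(21 / 20) ^ 7 - 1 \<le> (1 / 2 :: real)" by (simp add: power_divide)
      finally have "norm (reflected_abelian_zeta \<sigma> s - 1) \<le> 1 / 2" by simp
      thus ?thesis using abs_Re_le_cmod[of "reflected_abelian_zeta \<sigma> s - 1"] by (simp add: s_def)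
    qed
  qed (use \<sigma> c that in auto)
qed

section \<open>Consequences of a one-sided bound and a fourth moment bound\<close>

lemma Delta_bounded_on_compact:
  obtains B where "B \<ge> 0" "\<And>x. 1 \<le> x \<Longrightarrow> x \<le> X \<Longrightarrow> \<bar>Delta x\<bar> \<le> B"
proof -
  define f where "f n = real (num_abelian_groups n)" for n
  define S where "S = (\<Sum>n\<le>nat \<lfloor>X\<rfloor>. f n)"
  define B where "B = S + S + (\<Sum>k=1..6. \<bar>main_coeff k\<bar> * \<bar>X\<bar>)"
  have f0: "f n \<ge> 0" for n by (simp add: f_def)
  have S: "S \<ge> 0" by (simp add: S_def f0 sum_nonneg)
  show thesis
  proof
    show "B \<ge> 0" using S by (simp add: B_def sum_nonneg)
    fix x assume x: "1 \<le> x" "x \<le> X"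
    have le: "real n \<le> x \<Longrightarrow> n \<le> nat \<lfloor>X\<rfloor>" for n using x by (simp add: le_nat_iff le_floor_iff)
    have "(\<Sum>n | 1 \<le> n \<and> real n \<le> x. f n) \<le> S"
      unfolding S_def by (rule sum_mono2) (use le f0 in auto)
    moreover have "0 \<le> (\<Sum>n | 1 \<le> n \<and> real n \<le> x. f n)" by (simp add: f0 sum_nonneg)
    moreover have "f (nat \<lfloor>x\<rfloor>) \<le> S"
    proof -
      have "nat \<lfloor>x\<rfloor> \<in> {..nat \<lfloor>X\<rfloor>}" using x by (simp add: floor_mono nat_mono)
      thus ?thesis unfolding S_def using f0 by (intro member_le_sum) auto
    qed
    ultimately have s: "\<bar>starred_sum f x\<bar> \<le> S + S"
      using f0[of "nat \<lfloor>x\<rfloor>"] unfolding starred_sum_def by (auto simp: abs_le_iff)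
    have "\<bar>\<Sum>k=1..6. main_coeff k * x powr (1 / real k)\<bar> \<le> (\<Sum>k=1..6. \<bar>main_coeff k\<bar> * \<bar>X\<bar>)"
    proof (rule order.trans[OF sum_abs sum_mono])
      fix k :: nat assume k: "k \<in> {1..6}"
      have "x powr (1 / real k) \<le> x powr 1" using x k by (intro powr_mono) auto
      thus "\<bar>main_coeff k * x powr (1 / real k)\<bar> \<le> \<bar>main_coeff k\<bar> * \<bar>X\<bar>"
        using x by (simp add: abs_mult mult_left_mono)
    qed
    with s show "\<bar>Delta x\<bar> \<le> B" unfolding Delta_def B_def f_def by linarith
  qed
qed

text \<open>
  Landau's theorem is applied to \<open>x powr \<theta> - \<epsilon> * Delta x\<close>, made nonnegative on the compact range before
  \<open>X\<close> by adding a constant there. The transform of the added terms is the explicit function \<open>Q\<close>, holomorphic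
  on \<open>Re s > \<theta>\<close>.
\<close>
theorem one_sided_bound_imp_Delta_mellin_continues:
  fixes \<theta> \<epsilon> X :: real and G :: "complex \<Rightarrow> complex"
  assumes \<theta>: "1 / 7 < \<theta>" "\<theta> < 1" and \<epsilon>: "\<epsilon> = 1 \<or> \<epsilon> = - 1"
    and bound: "\<And>x. x \<ge> X \<Longrightarrow> \<epsilon> * Delta x \<le> x powr \<theta>"
    and hol: "G holomorphic_on {s. Re s > 1 / 7}"
    and G: "\<And>s. Re s > 1 / 7 \<Longrightarrow> s \<notin> abelian_poles \<Longrightarrow>
       G s = abelian_zeta s / s - (\<Sum>k=1..6. of_real (main_coeff k) / (s - 1 / of_nat k))"
    and s: "Re s > \<theta>"
  shows "set_integrable lborel {1..} (\<lambda>x. of_real (Delta x) * of_real x powr (- s - 1) :: complex)"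
    and "(LINT x:{1..}|lborel. of_real (Delta x) * of_real x powr (- s - 1)) = G s"
proof -
  define X0 where "X0 = max 1 X"
  have X0: "X0 \<ge> 1" "X0 > 0" "X0 \<ge> X" by (auto simp: X0_def)
  obtain B where B: "B \<ge> 0" "\<And>x. 1 \<le> x \<Longrightarrow> x \<le> X0 \<Longrightarrow> \<bar>Delta x\<bar> \<le> B"
    using Delta_bounded_on_compact by blast
  have \<epsilon>2: "\<epsilon> * \<epsilon> = 1" using \<epsilon> by auto
  define g where "g x = x powr \<theta> - \<epsilon> * Delta x + B * (1 - indicator {X0..} x)" for x
  define p where "p s x = (of_real x powr (- s - 1) :: complex)" for s and x :: real
  define q where "q s x = p (s - of_real \<theta>) x + of_real B * (p s x - indicator {X0..} x *\<^sub>R p s x)" for s and x :: real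
  define Q where "Q s = 1 / (s - of_real \<theta>) + of_real B * (1 / s - of_real X0 powr (- s) / s)" for s :: complex
  have pint: "set_integrable lborel {a..} (p s)" "(LINT x:{a..}|lborel. p s x) = of_real a powr (- s) / s"
    if "a > 0" "Re s > 0" for a s
    unfolding p_def using complex_powr_atLeast_integral[OF that] by auto
  have tail: "indicator {1..} x *\<^sub>R (indicator {X0..} x *\<^sub>R p s x) = indicator {X0..} x *\<^sub>R p s x" for s x
    using X0 by (auto simp: indicator_def)
  have tint: "set_integrable lborel {1..} (\<lambda>x. indicator {X0..} x *\<^sub>R p s x)"
    "(LINT x:{1..}|lborel. indicator {X0..} x *\<^sub>R p s x) = of_real X0 powr (- s) / s" if "Re s > 0" for s
    using pint[OF X0(2) that] unfolding set_integrable_def set_lebesgue_integral_def tail by auto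
  have qint: "set_integrable lborel {1..} (q s)" "(LINT x:{1..}|lborel. q s x) = Q s" if "Re s > \<theta>" for s
  proof -
    have s0: "Re s > 0" "Re (s - of_real \<theta>) > 0" using that \<theta> by auto
    note i1 = pint[OF zero_less_one s0(2)] and i2 = pint[OF zero_less_one s0(1)] and i3 = tint[OF s0(1)]
    have i23: "set_integrable lborel {1..} (\<lambda>x. of_real B * (p s x - indicator {X0..} x *\<^sub>R p s x))"
      by (intro set_integrable_mult_right set_integral_diff(1) i2 i3)
    show "set_integrable lborel {1..} (q s)" unfolding q_def[abs_def] by (intro set_integral_add(1) i1 i23)
    show "(LINT x:{1..}|lborel. q s x) = Q s"
      unfolding q_def Q_def set_integral_add(2)[OF i1(1) i23] set_integral_mult_right
        set_integral_diff(2)[OF i2(1) i3(1)] i1(2) i2(2) i3(2) by simp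
  qed
  have gq: "indicator {1..} x *\<^sub>R (of_real (g x) * p s x) = indicator {1..} x *\<^sub>R (q s x - of_real \<epsilon> * (of_real (Delta x) * p s x))" for x s
  proof (cases "x \<ge> 1")
    case True
    have "p (s - of_real \<theta>) x = of_real (x powr \<theta>) * p s x"
    proof -
      have "- (s - of_real \<theta>) - 1 = of_real \<theta> + (- s - 1)" by simp
      thus ?thesis using True unfolding p_def by (simp only: powr_add) (simp add: powr_of_real)
    qed
    moreover have "(of_real (indicator {X0..} x) :: complex) * p s x = indicator {X0..} x *\<^sub>R p s x"
      by (simp add: scaleR_conv_of_real)
    ultimately show ?thesis using True by (simp add: g_def q_def algebra_simps scaleR_conv_of_real)
  qed simp
  have g_meas: "g \<in> borel_measurable borel" unfolding g_def by measurable
  have g0: "\<forall>x\<ge>1. g x \<ge> 0"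
  proof (intro allI impI)
    fix x :: real assume x: "x \<ge> 1"
    show "g x \<ge> 0"
    proof (cases "x \<ge> X0")
      case True
      thus ?thesis using bound[of x] X0 by (simp add: g_def)
    next
      case False
      hence "\<bar>\<epsilon> * Delta x\<bar> \<le> B" using B(2)[of x] x \<epsilon> by auto
      moreover have "g x = x powr \<theta> - \<epsilon> * Delta x + B" using False by (simp add: g_def)
      ultimately show ?thesis using powr_ge_zero[of x \<theta>] by linarith
    qed
  qed
  have hyp: "set_integrable lborel {1..} (\<lambda>x. of_real (g x) * of_real x powr (- s - 1) :: complex) \<and>
    (LINT x:{1..}|lborel. of_real (g x) * of_real x powr (- s - 1)) = Q s - of_real \<epsilon> * G s" if s: "Re s > 1" for s
  proof -
    have np: "s \<notin> abelian_poles"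
    proof
      assume "s \<in> abelian_poles"
      then obtain k :: nat where k: "k \<in> {1..6}" "s = 1 / of_nat k" by (auto simp: abelian_poles_def)
      have "Re s = 1 / real k" unfolding k(2) by (simp add: Re_divide_of_nat)
      thus False using s k(1) by auto
    qed
    have D: "set_integrable lborel {1..} (\<lambda>x. of_real \<epsilon> * (of_real (Delta x) * p s x))"
      "(LINT x:{1..}|lborel. of_real \<epsilon> * (of_real (Delta x) * p s x)) = of_real \<epsilon> * G s"
      using Delta_mellin[OF s] G[OF _ np] s by (simp_all add: p_def)
    have q: "set_integrable lborel {1..} (q s)" "(LINT x:{1..}|lborel. q s x) = Q s" using qint[of s] s \<theta> by auto
    show ?thesis
      unfolding p_def[symmetric] set_integrable_def set_lebesgue_integral_def gq
      using set_integral_diff[OF q(1) D(1)] q(2) D(2) by (simp add: set_integrable_def set_lebesgue_integral_def)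
  qed
  have hol': "(\<lambda>s. Q s - of_real \<epsilon> * G s) holomorphic_on {s. Re s > \<theta>}"
    unfolding Q_def using \<theta> X0
    by (intro holomorphic_intros holomorphic_on_subset[OF hol]) auto
  note landau = landau_mellin[OF g_meas g0 \<theta>(2) conjunct1[OF hyp] conjunct2[OF hyp] hol' s]
  have Dq: "indicator {1..} x *\<^sub>R (of_real (Delta x) * p s x) = indicator {1..} x *\<^sub>R (of_real \<epsilon> * (q s x - of_real (g x) * p s x))" for x
  proof (cases "x \<ge> 1")
    case True
    have "of_real (g x) * p s x = q s x - of_real \<epsilon> * (of_real (Delta x) * p s x)" using gq[of x s] True by simp
    hence "of_real \<epsilon> * (q s x - of_real (g x) * p s x) = of_real (\<epsilon> * \<epsilon>) * (of_real (Delta x) * p s x)" by simp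
    thus ?thesis by (simp add: \<epsilon>2)
  qed simp
  have gi: "set_integrable lborel {1..} (\<lambda>x. of_real (g x) * p s x)" "(LINT x:{1..}|lborel. of_real (g x) * p s x) = Q s - of_real \<epsilon> * G s"
    using landau by (simp_all add: p_def)
  have di: "set_integrable lborel {1..} (\<lambda>x. of_real \<epsilon> * (q s x - of_real (g x) * p s x))"
    by (intro set_integrable_mult_right set_integral_diff(1) qint(1) s gi)
  thus "set_integrable lborel {1..} (\<lambda>x. of_real (Delta x) * of_real x powr (- s - 1) :: complex)"
    unfolding p_def[symmetric] set_integrable_def Dq .
  have "(LINT x:{1..}|lborel. of_real (Delta x) * p s x) = (LINT x:{1..}|lborel. of_real \<epsilon> * (q s x - of_real (g x) * p s x))"
    unfolding set_lebesgue_integral_def Dq ..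
  also have "\<dots> = of_real \<epsilon> * (Q s - (Q s - of_real \<epsilon> * G s))"
    by (simp only: set_integral_mult_right set_integral_diff(2)[OF qint(1)[OF s] gi(1)] qint(2)[OF s] gi(2))
  also have "\<dots> = of_real (\<epsilon> * \<epsilon>) * G s" by simp
  finally show "(LINT x:{1..}|lborel. of_real (Delta x) * of_real x powr (- s - 1)) = G s" unfolding p_def by (simp add: \<epsilon>2)
qed

lemma nn_integral_dyadic:
  fixes f :: "real \<Rightarrow> ennreal"
  assumes [measurable]: "f \<in> borel_measurable borel"
  shows "(\<integral>\<^sup>+x\<in>{1..}. f x \<partial>lborel) = (\<Sum>n. \<integral>\<^sup>+x\<in>{2 ^ n..<2 ^ Suc n}. f x \<partial>lborel)"
proof -
  have UN: "{1..} = (\<Union>n. {2 ^ n..<2 ^ Suc n :: real})"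
  proof (intro equalityI subsetI)
    fix x :: real assume x: "x \<in> {1..}"
    define m where "m = (LEAST n. x < 2 ^ n)"
    have "\<exists>n. x < 2 ^ n" using real_arch_pow[of 2 x] by simp
    hence m: "x < 2 ^ m" unfolding m_def by (rule LeastI_ex)
    have "m \<noteq> 0" using m x by (cases m) auto
    then obtain n where n: "m = Suc n" by (cases m) auto
    have "\<not> x < 2 ^ n" using not_less_Least[of n "\<lambda>n. x < 2 ^ n"] n unfolding m_def by simp
    thus "x \<in> (\<Union>n. {2 ^ n..<2 ^ Suc n})" using m n by (intro UN_I[of n]) auto
  next
    fix x :: real assume "x \<in> (\<Union>n. {2 ^ n..<2 ^ Suc n})"
    then obtain n where "2 ^ n \<le> x" by auto
    moreover have "(1 :: real) \<le> 2 ^ n" by simp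
    ultimately show "x \<in> {1..}" unfolding atLeast_iff by (rule order.trans[rotated])
  qed
  have "disjoint_family (\<lambda>n. {2 ^ n..<2 ^ Suc n :: real})"
    unfolding disjoint_family_on_def
  proof (intro ballI impI)
    have "{2 ^ m..<2 ^ Suc m :: real} \<inter> {2 ^ n..<2 ^ Suc n} = {}" if "m < n" for m n :: nat
    proof -
      have "(2 :: real) ^ Suc m \<le> 2 ^ n" using that by (intro power_increasing) auto
      thus ?thesis by force
    qed
    thus "{2 ^ m..<2 ^ Suc m :: real} \<inter> {2 ^ n..<2 ^ Suc n} = {}" if "m \<noteq> n" for m n :: nat
      using that by (metis Int_commute linorder_neqE_nat)
  qed
  thus ?thesis unfolding UN by (intro nn_integral_disjoint_family) auto
qed

lemma mean_fourth_bound_imp_integrable: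
  fixes b d T1 :: real
  assumes d: "d < b" and b: "b > 0"
    and bound: "\<And>T. T \<ge> T1 \<Longrightarrow> integral {T..2 * T} (\<lambda>x. Delta x ^ 4) \<le> T powr d"
  shows "set_integrable lborel {1..} (\<lambda>x. Delta x ^ 4 * x powr - b)"
proof -
  define f where "f x = Delta x ^ 4 * x powr - b" for x
  have fm [measurable]: "f \<in> borel_measurable borel" unfolding f_def by measurable
  have f0: "f x \<ge> 0" for x by (simp add: f_def)
  have four: "set_integrable lborel {T..2 * T} (\<lambda>x. Delta x ^ 4)" if T: "T \<ge> 1" for T
  proof -
    obtain B where B: "B \<ge> 0" "\<And>x. 1 \<le> x \<Longrightarrow> x \<le> 2 * T \<Longrightarrow> \<bar>Delta x\<bar> \<le> B" using Delta_bounded_on_compact[of "2 * T"] by blast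
    show ?thesis
      unfolding set_integrable_def
    proof (rule Bochner_Integration.integrable_bound)
      show "integrable lborel (\<lambda>x. indicator {T..2 * T} x *\<^sub>R B ^ 4)" by (intro integrable_scaleR_left integrable_real_indicator) (auto simp: emeasure_lborel_Icc_eq)
      show "(\<lambda>x. indicator {T..2 * T} x *\<^sub>R Delta x ^ 4) \<in> borel_measurable lborel" by measurable
      show "AE x in lborel. norm (indicator {T..2 * T} x *\<^sub>R Delta x ^ 4) \<le> norm (indicator {T..2 * T} x *\<^sub>R B ^ 4)"
      proof (rule AE_I2)
        fix x show "norm (indicator {T..2 * T} x *\<^sub>R Delta x ^ 4) \<le> norm (indicator {T..2 * T} x *\<^sub>R B ^ 4)"
          using B T power_mono[of "\<bar>Delta x\<bar>" B 4] by (auto simp: indicator_def power_abs)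
      qed
    qed
  qed
  define c where "c n = integral {2 ^ n..2 * 2 ^ n} (\<lambda>x. Delta x ^ 4) * (2 ^ n) powr - b" for n :: nat
  have c0: "c n \<ge> 0" for n unfolding c_def by (intro mult_nonneg_nonneg Henstock_Kurzweil_Integration.integral_nonneg
      set_borel_integral_eq_integral(1)[OF four]) auto
  have dy: "(\<integral>\<^sup>+x\<in>{2 ^ n..<2 ^ Suc n}. ennreal (f x) \<partial>lborel) \<le> ennreal (c n)" for n
  proof -
    have int: "set_integrable lborel {2 ^ n..2 * 2 ^ n} (\<lambda>x. Delta x ^ 4)" by (intro four) simp
    have "(\<integral>\<^sup>+x\<in>{2 ^ n..<2 ^ Suc n}. ennreal (f x) \<partial>lborel) \<le> (\<integral>\<^sup>+x. ennreal ((indicator {2 ^ n..2 * 2 ^ n} x *\<^sub>R Delta x ^ 4) * (2 ^ n) powr - b) \<partial>lborel)"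
    proof (intro nn_integral_mono)
      fix x :: real
      have "x powr - b \<le> (2 ^ n) powr - b" if "2 ^ n \<le> x" using that b by (intro powr_mono2') auto
      thus "ennreal (f x) * indicator {2 ^ n..<2 ^ Suc n} x \<le> ennreal ((indicator {2 ^ n..2 * 2 ^ n} x *\<^sub>R Delta x ^ 4) * (2 ^ n) powr - b)"
        by (auto simp: indicator_def f_def intro!: ennreal_leI mult_left_mono)
    qed
    also have "\<dots> = ennreal (\<integral>x. (indicator {2 ^ n..2 * 2 ^ n} x *\<^sub>R Delta x ^ 4) * (2 ^ n) powr - b \<partial>lborel)"
      using int by (intro nn_integral_eq_integral integrable_mult_left AE_I2) (auto simp: set_integrable_def)
    also have "(\<integral>x. (indicator {2 ^ n..2 * 2 ^ n} x *\<^sub>R Delta x ^ 4) * (2 ^ n) powr - b \<partial>lborel) = c n"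
      unfolding c_def set_borel_integral_eq_integral(2)[OF int, symmetric] set_lebesgue_integral_def by (rule integral_mult_left_zero)
    finally show ?thesis .
  qed
  obtain N where N: "T1 < 2 ^ N" using real_arch_pow[of 2 T1] by auto
  have "summable c"
  proof (rule summable_comparison_test'[where N = N])
    show "summable (\<lambda>n. (2 powr (d - b)) ^ n)" using d by (intro summable_geometric) (simp add: powr_less_one)
    fix n assume n: "n \<ge> N"
    have "(2 :: real) ^ N \<le> 2 ^ n" using n by (intro power_increasing) auto
    hence "T1 \<le> 2 ^ n" using N by linarith
    hence "c n \<le> (2 ^ n) powr d * (2 ^ n) powr - b" unfolding c_def by (intro mult_right_mono bound) auto
    also have "\<dots> = (2 ^ n) powr (d - b)" by (simp add: powr_diff powr_minus_divide)
    also have "\<dots> = (2 powr (d - b)) ^ n" by (simp add: powr_power powr_powr mult.commute flip: powr_realpow)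
    finally show "norm (c n) \<le> (2 powr (d - b)) ^ n" using c0[of n] by simp
  qed
  have "(\<integral>\<^sup>+x. ennreal (indicator {1..} x *\<^sub>R f x) \<partial>lborel) = (\<integral>\<^sup>+x\<in>{1..}. ennreal (f x) \<partial>lborel)"
    by (intro nn_integral_cong) (auto simp: indicator_def)
  also have "\<dots> = (\<Sum>n. \<integral>\<^sup>+x\<in>{2 ^ n..<2 ^ Suc n}. ennreal (f x) \<partial>lborel)" by (intro nn_integral_dyadic) measurable
  also have "\<dots> \<le> (\<Sum>n. ennreal (c n))" by (intro suminf_le dy) auto
  also have "\<dots> = ennreal (suminf c)" by (intro suminf_ennreal2 c0 \<open>summable c\<close>)
  also have "\<dots> < \<infinity>" by simp
  finally show ?thesis
    unfolding set_integrable_def f_def[symmetric]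
    by (intro integrableI_nonneg) (auto simp: f0 indicator_def)
qed

text \<open>
  For every \<open>l > 0\<close> one has \<open>y\<^sup>2 \<le> l * \<bar>y\<bar> + y ^ 4 / l\<^sup>2\<close>, by comparing \<open>\<bar>y\<bar>\<close> with \<open>l\<close>. The choice
  \<open>l = x powr (1 / 6 + 2 * \<delta> / 3)\<close> leaves room in both terms: the first is integrable by hypothesis, the
  second decays by \<open>x powr (- \<delta> / 6)\<close> faster than the fourth moments grow.
\<close>
lemma mean_square_finite:
  fixes \<delta> T1 :: real
  assumes \<delta>: "0 < \<delta>" "\<delta> < 1 / 42"
    and int: "set_integrable lborel {1..} (\<lambda>x. \<bar>Delta x\<bar> * x powr (- (1 / 6 - 5 * \<delta> / 6) - 1))"
    and bound: "\<And>T. T \<ge> T1 \<Longrightarrow> integral {T..2 * T} (\<lambda>x. Delta x ^ 4) \<le> T powr (5 / 3 + \<delta>)"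
  shows "set_integrable lborel {1..} (\<lambda>x. (Delta x)\<^sup>2 * x powr (- 2 * (1 / 6 - \<delta> / 12) - 1))"
proof -
  have int4: "set_integrable lborel {1..} (\<lambda>x. Delta x ^ 4 * x powr - (5 / 3 + 7 * \<delta> / 6))"
    by (rule mean_fourth_bound_imp_integrable[OF _ _ bound]) (use \<delta> in auto)
  have le: "(Delta x)\<^sup>2 * x powr (- 2 * (1 / 6 - \<delta> / 12) - 1) \<le>
    \<bar>Delta x\<bar> * x powr (- (1 / 6 - 5 * \<delta> / 6) - 1) + Delta x ^ 4 * x powr - (5 / 3 + 7 * \<delta> / 6)" if x: "x \<ge> 1" for x
  proof -
    define y where "y = \<bar>Delta x\<bar>"
    define l where "l = x powr (1 / 6 + 2 * \<delta> / 3)"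
    define w where "w = x powr (- 2 * (1 / 6 - \<delta> / 12) - 1)"
    have l: "l > 0" and w: "w \<ge> 0" and y: "y \<ge> 0" using x by (auto simp: l_def w_def y_def)
    have "y\<^sup>2 \<le> y * l + y ^ 4 / l\<^sup>2"
    proof (cases "y \<le> l")
      case True
      hence "y * y \<le> y * l" using y by (rule mult_left_mono)
      thus ?thesis by (simp add: power2_eq_square add_increasing2)
    next
      case False
      hence "l\<^sup>2 \<le> y\<^sup>2" using l by (intro power_mono) auto
      hence "y\<^sup>2 * l\<^sup>2 \<le> y\<^sup>2 * y\<^sup>2" by (intro mult_left_mono) auto
      hence "y\<^sup>2 \<le> y ^ 4 / l\<^sup>2" using l by (simp add: field_simps flip: power_add)
      thus ?thesis using y l by (simp add: add_increasing)
    qed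
    hence "y\<^sup>2 * w \<le> (y * l + y ^ 4 / l\<^sup>2) * w" by (rule mult_right_mono[OF _ w])
    also have "\<dots> = y * (l * w) + y ^ 4 * (w / l\<^sup>2)" by (simp add: algebra_simps)
    also have "l * w = x powr (- (1 / 6 - 5 * \<delta> / 6) - 1)" unfolding l_def w_def powr_add[symmetric] by (simp add: algebra_simps)
    also have "l\<^sup>2 = x powr (2 * (1 / 6 + 2 * \<delta> / 3))" using x by (simp add: l_def powr_power mult.commute)
    also have "w / \<dots> = x powr - (5 / 3 + 7 * \<delta> / 6)" unfolding w_def powr_diff[symmetric] by (simp add: algebra_simps)
    finally show ?thesis by (simp add: y_def w_def)
  qed
  show ?thesis
    unfolding set_integrable_def
  proof (rule Bochner_Integration.integrable_bound)
    show "integrable lborel (\<lambda>x. indicator {1..} x *\<^sub>R (\<bar>Delta x\<bar> * x powr (- (1 / 6 - 5 * \<delta> / 6) - 1) + Delta x ^ 4 * x powr - (5 / 3 + 7 * \<delta> / 6)))"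
      using set_integral_add(1)[OF int int4] by (simp only: set_integrable_def)
    show "(\<lambda>x. indicator {1..} x *\<^sub>R ((Delta x)\<^sup>2 * x powr (- 2 * (1 / 6 - \<delta> / 12) - 1))) \<in> borel_measurable lborel"
      by measurable
    show "AE x in lborel. norm (indicator {1..} x *\<^sub>R ((Delta x)\<^sup>2 * x powr (- 2 * (1 / 6 - \<delta> / 12) - 1))) \<le>
      norm (indicator {1..} x *\<^sub>R (\<bar>Delta x\<bar> * x powr (- (1 / 6 - 5 * \<delta> / 6) - 1) + Delta x ^ 4 * x powr - (5 / 3 + 7 * \<delta> / 6)))"
    proof (rule AE_I2)
      fix x :: real
      show "norm (indicator {1..} x *\<^sub>R ((Delta x)\<^sup>2 * x powr (- 2 * (1 / 6 - \<delta> / 12) - 1))) \<le>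
      norm (indicator {1..} x *\<^sub>R (\<bar>Delta x\<bar> * x powr (- (1 / 6 - 5 * \<delta> / 6) - 1) + Delta x ^ 4 * x powr - (5 / 3 + 7 * \<delta> / 6)))"
      proof (cases "x \<ge> 1")
        case True
        show ?thesis using True order.trans[OF le[OF True] abs_ge_self] by (simp add: abs_mult)
      qed simp
    qed
  qed
qed

section \<open>Growth of the continued transform\<close>

text \<open>
  The exponents \<open>1 / 2 - k * \<sigma>\<close> for \<open>k = 1, 2, 3\<close> add up to \<open>3 / 2 - 6 * \<sigma>\<close>; the factors with \<open>k \<ge> 4\<close> are
  common to both functions.
\<close>
lemma abelian_zeta_ge_reflected:
  assumes \<sigma>: "0 < \<sigma>" "\<sigma> \<le> 1 / 6"
  obtains c where "c > 0"
    "\<And>t. t \<ge> 1 \<Longrightarrow> norm (abelian_zeta (Complex \<sigma> t)) \<ge> c * t powr (3 / 2 - 6 * \<sigma>) * norm (reflected_abelian_zeta \<sigma> (Complex \<sigma> t))"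
proof -
  have "\<exists>c>0. \<forall>t\<ge>1. norm (riemann_zeta (of_nat k * Complex \<sigma> t)) \<ge>
      c * t powr (1 / 2 - real k * \<sigma>) * norm (riemann_zeta (of_real (1 - 2 * real k * \<sigma>) + of_nat k * Complex \<sigma> t))"
    if k: "1 \<le> k" "k \<le> 3" for k :: nat
  proof -
    have "real k * \<sigma> \<le> 3 * (1 / 6)" using k \<sigma> by (intro mult_mono) auto
    hence k\<sigma>: "real k * \<sigma> > 0" "real k * \<sigma> \<le> 1 / 2" using k \<sigma> by auto
    obtain c where c: "c > 0" "\<And>t. t \<ge> 1 \<Longrightarrow> norm (riemann_zeta (Complex (real k * \<sigma>) t)) \<ge>
        c * t powr (1 / 2 - real k * \<sigma>) * norm (riemann_zeta (Complex (1 - real k * \<sigma>) t))"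
      using norm_riemann_zeta_ge_reflected[OF k\<sigma>] by blast
    have "norm (riemann_zeta (of_nat k * Complex \<sigma> t)) \<ge>
      c * t powr (1 / 2 - real k * \<sigma>) * norm (riemann_zeta (of_real (1 - 2 * real k * \<sigma>) + of_nat k * Complex \<sigma> t))" if t: "t \<ge> 1" for t
    proof -
      have kt: "t \<le> real k * t" using k t by simp
      have e: "of_nat k * Complex \<sigma> t = Complex (real k * \<sigma>) (real k * t)"
        "of_real (1 - 2 * real k * \<sigma>) + Complex (real k * \<sigma>) (real k * t) = Complex (1 - real k * \<sigma>) (real k * t)"
        by (simp_all add: complex_eq_iff)
      have "c * t powr (1 / 2 - real k * \<sigma>) * norm (riemann_zeta (Complex (1 - real k * \<sigma>) (real k * t))) \<le>
          c * (real k * t) powr (1 / 2 - real k * \<sigma>) * norm (riemann_zeta (Complex (1 - real k * \<sigma>) (real k * t)))"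
        using c(1) kt k\<sigma> t by (intro mult_right_mono mult_left_mono powr_mono2) auto
      also have "\<dots> \<le> norm (riemann_zeta (Complex (real k * \<sigma>) (real k * t)))" by (intro c(2) order.trans[OF t kt])
      finally show ?thesis unfolding e .
    qed
    with c(1) show ?thesis by blast
  qed
  then obtain C where C: "\<And>k. 1 \<le> k \<Longrightarrow> k \<le> 3 \<Longrightarrow> C k > 0"
    "\<And>k t. 1 \<le> k \<Longrightarrow> k \<le> 3 \<Longrightarrow> 1 \<le> t \<Longrightarrow> norm (riemann_zeta (of_nat k * Complex \<sigma> t)) \<ge>
      C k * t powr (1 / 2 - real k * \<sigma>) * norm (riemann_zeta (of_real (1 - 2 * real k * \<sigma>) + of_nat k * Complex \<sigma> t))"
    by metis
  show thesis
  proof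
    show "C 1 * C 2 * C 3 > 0" using C(1) by simp
    fix t :: real assume t: "t \<ge> 1"
    define Z where "Z k = norm (riemann_zeta (of_nat k * Complex \<sigma> t))" for k :: nat
    define Y where "Y k = norm (riemann_zeta (of_real (1 - 2 * real k * \<sigma>) + of_nat k * Complex \<sigma> t))" for k :: nat
    define V where "V k = C k * t powr (1 / 2 - real k * \<sigma>) * Y k" for k
    have low: "V k \<le> Z k" "0 \<le> V k" if "1 \<le> k" "k \<le> 3" for k
      unfolding V_def using C(2)[OF that t] C(1)[OF that] by (simp_all add: Z_def Y_def)
    have "t powr (3 / 2 - 6 * \<sigma>) = t powr (1 / 2 - real 1 * \<sigma>) * t powr (1 / 2 - real 2 * \<sigma>) * t powr (1 / 2 - real 3 * \<sigma>)"
      unfolding powr_add[symmetric] by (intro arg_cong2[where f = "(powr)"] refl) simp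
    hence "C 1 * C 2 * C 3 * t powr (3 / 2 - 6 * \<sigma>) * (Y 1 * Y 2 * Y 3) =
      V 1 * V 2 * V 3"
      unfolding V_def by (simp only: mult_ac)
    also have "\<dots> \<le> Z 1 * Z 2 * Z 3"
      by (intro mult_mono mult_nonneg_nonneg low) (auto simp: Z_def)
    finally have main: "C 1 * C 2 * C 3 * t powr (3 / 2 - 6 * \<sigma>) * (Y 1 * Y 2 * Y 3) \<le> Z 1 * Z 2 * Z 3" .
    define W where "W = Z 4 * Z 5 * Z 6 * norm (zeta_tail 7 (Complex \<sigma> t))"
    have W: "W \<ge> 0" by (simp add: W_def Z_def)
    have six: "{1..6::nat} = {1, 2, 3, 4, 5, 6}" by auto
    have "norm (abelian_zeta (Complex \<sigma> t)) = (\<Prod>k=1..6. Z k) * norm (zeta_tail 7 (Complex \<sigma> t))"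
      by (simp add: abelian_zeta_def Z_def norm_mult prod_norm)
    also have "(\<Prod>k=1..6. Z k) = Z 1 * Z 2 * Z 3 * (Z 4 * Z 5 * Z 6)" unfolding six by simp
    finally have Zp: "norm (abelian_zeta (Complex \<sigma> t)) = (Z 1 * Z 2 * Z 3) * W" by (simp add: W_def mult_ac)
    have "norm (reflected_abelian_zeta \<sigma> (Complex \<sigma> t)) = (\<Prod>k=1..6. if k \<le> 3 then Y k else Z k) * norm (zeta_tail 7 (Complex \<sigma> t))"
      unfolding reflected_abelian_zeta_def norm_mult prod_norm[symmetric]
      by (intro arg_cong2[where f = "(*)"] prod.cong refl) (simp add: Y_def Z_def)
    also have "(\<Prod>k=1..6. if k \<le> 3 then Y k else Z k) = Y 1 * Y 2 * Y 3 * (Z 4 * Z 5 * Z 6)" unfolding six by simp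
    finally have Yp: "norm (reflected_abelian_zeta \<sigma> (Complex \<sigma> t)) = (Y 1 * Y 2 * Y 3) * W" by (simp add: W_def mult_ac)
    show "norm (abelian_zeta (Complex \<sigma> t)) \<ge> C 1 * C 2 * C 3 * t powr (3 / 2 - 6 * \<sigma>) * norm (reflected_abelian_zeta \<sigma> (Complex \<sigma> t))"
      unfolding Zp Yp using mult_right_mono[OF main W] by (simp only: mult.assoc)
  qed
qed

lemma Delta_mean_square_bound:
  fixes \<sigma> :: real and G :: "complex \<Rightarrow> complex"
  assumes int1: "set_integrable lborel {1..} (\<lambda>x. \<bar>Delta x\<bar> * x powr (- \<sigma> - 1))"
    and int2: "set_integrable lborel {1..} (\<lambda>x. (Delta x)\<^sup>2 * x powr (- 2 * \<sigma> - 1))"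
    and G: "\<And>t. (LINT x:{1..}|lborel. of_real (Delta x) * of_real x powr (- Complex \<sigma> t - 1)) = G (Complex \<sigma> t)"
  obtains M where "M \<ge> 0" "\<And>T. T > 0 \<Longrightarrow> set_integrable lborel {0..T} (\<lambda>t. (norm (G (Complex \<sigma> t)))\<^sup>2)"
    "\<And>T. T > 0 \<Longrightarrow> (LINT t:{0..T}|lborel. (norm (G (Complex \<sigma> t)))\<^sup>2) \<le> M"
proof -
  define k where "k x = indicator {1..} x * (Delta x * x powr (- \<sigma> - 1))" for x
  have km: "k \<in> borel_measurable lborel" unfolding k_def[abs_def] by measurable
  have k1: "integrable lborel k"
    by (rule Bochner_Integration.integrable_bound[OF int1[unfolded set_integrable_def] km])
       (auto simp: k_def indicator_def abs_mult)
  have kx: "x * (k x)\<^sup>2 = indicator {1..} x *\<^sub>R ((Delta x)\<^sup>2 * x powr (- 2 * \<sigma> - 1))" for x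
  proof (cases "x \<ge> 1")
    case True
    have "x * (x powr (- \<sigma> - 1))\<^sup>2 = x * x powr (2 * (- \<sigma> - 1))" using True by (simp add: powr_power mult.commute)
    also have "\<dots> = x powr (1 + 2 * (- \<sigma> - 1))" using True by (simp only: powr_mult_base)
    also have "1 + 2 * (- \<sigma> - 1) = - 2 * \<sigma> - 1" by simp
    finally show ?thesis using True by (simp add: k_def power_mult_distrib)
  qed (simp add: k_def)
  have k2: "integrable lborel (\<lambda>x. x * (k x)\<^sup>2)" using int2 unfolding kx set_integrable_def .
  have k0: "x < 1 \<Longrightarrow> k x = 0" for x by (simp add: k_def)
  have H: "(\<integral>x. of_real (k x) * exp (- \<i> * of_real (t * ln x)) \<partial>lborel) = G (Complex \<sigma> t)" for t
    unfolding G[symmetric] set_lebesgue_integral_def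
  proof (intro Bochner_Integration.integral_cong refl)
    fix x :: real
    show "of_real (k x) * exp (- \<i> * of_real (t * ln x)) = indicator {1..} x *\<^sub>R (of_real (Delta x) * of_real x powr (- Complex \<sigma> t - 1))"
    proof (cases "x \<ge> 1")
      case True
      have "- Complex \<sigma> t - 1 = of_real (- \<sigma> - 1) + - \<i> * of_real t" by (simp add: complex_eq_iff)
      hence "complex_of_real x powr (- Complex \<sigma> t - 1) = of_real x powr of_real (- \<sigma> - 1) * of_real x powr (- \<i> * of_real t)"
        by (simp only: powr_add)
      also have "complex_of_real x powr of_real (- \<sigma> - 1) = of_real (x powr (- \<sigma> - 1))" using True by (intro powr_of_real) auto
      also have "complex_of_real x powr (- \<i> * of_real t) = exp (- \<i> * of_real (t * ln x))"
        using True by (simp add: powr_def Ln_of_real mult.assoc)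
      finally show ?thesis using True by (simp add: k_def mult.assoc)
    qed (simp add: k_def)
  qed
  show thesis
  proof
    show "exp 1 * pi * (\<integral>x. x * (k x)\<^sup>2 \<partial>lborel) \<ge> 0"
      unfolding kx by (intro mult_nonneg_nonneg Bochner_Integration.integral_nonneg) (auto simp: indicator_def)
    fix T :: real assume T: "T > 0"
    show "set_integrable lborel {0..T} (\<lambda>t. (norm (G (Complex \<sigma> t)))\<^sup>2)"
      using mellin_mean_square_le(1)[OF k1 k2 k0 T] unfolding H .
    show "(LINT t:{0..T}|lborel. (norm (G (Complex \<sigma> t)))\<^sup>2) \<le> exp 1 * pi * (\<integral>x. x * (k x)\<^sup>2 \<partial>lborel)"
      using mellin_mean_square_le(2)[OF k1 k2 k0 T] unfolding H .
  qed
qed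

text \<open>
  Put \<open>e = 1 - 6 * \<sigma> > 0\<close>. Off the bounded contribution of the poles, the mean of \<open>|G (\<sigma> + \<i> t)|\<close> over
  \<open>[T, 2 T]\<close> is at least a constant times \<open>T powr (e - 1 / 2)\<close>, so by the Cauchy-Schwarz inequality the mean
  square is at least of order \<open>T powr (2 * e - 1)\<close>, and its integral over \<open>[T, 2 T]\<close> of order \<open>T powr (2 * e)\<close>.
\<close>
lemma continued_mellin_mean_square_unbounded:
  fixes \<sigma> M :: real and G :: "complex \<Rightarrow> complex"
  assumes \<sigma>: "1 / 7 < \<sigma>" "\<sigma> < 1 / 6"
    and hol: "G holomorphic_on {s. Re s > 1 / 7}"
    and G: "\<And>s. Re s > 1 / 7 \<Longrightarrow> s \<notin> abelian_poles \<Longrightarrow>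
       G s = abelian_zeta s / s - (\<Sum>k=1..6. of_real (main_coeff k) / (s - 1 / of_nat k))"
  obtains T where "T > 0" "M < integral {T..2 * T} (\<lambda>t. (norm (G (Complex \<sigma> t)))\<^sup>2)"
proof -
  define e where "e = 1 - 6 * \<sigma>"
  have e: "e > 0" "e < 1 / 7" using \<sigma> by (auto simp: e_def)
  obtain c where c: "c > 0" "\<And>t. t \<ge> 1 \<Longrightarrow> norm (abelian_zeta (Complex \<sigma> t)) \<ge>
      c * t powr (3 / 2 - 6 * \<sigma>) * norm (reflected_abelian_zeta \<sigma> (Complex \<sigma> t))"
    using abelian_zeta_ge_reflected[of \<sigma>] \<sigma> by auto
  obtain C T0 where C: "C > 0"
    "\<And>T. T \<ge> T0 \<Longrightarrow> C * T \<le> integral {T..2 * T} (\<lambda>t. norm (reflected_abelian_zeta \<sigma> (Complex \<sigma> t)))"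
    using mean_value_reflected_abelian_zeta[of \<sigma>] \<sigma> by (metis less_imp_le)
  define S where "S = (\<Sum>k=1..6. \<bar>main_coeff k\<bar>)"
  have S: "S \<ge> 0" by (simp add: S_def sum_nonneg)
  define R where "R t = norm (reflected_abelian_zeta \<sigma> (Complex \<sigma> t))" for t
  define g where "g t = norm (G (Complex \<sigma> t))" for t
  have pointwise: "c / 2 * t powr (e - 1 / 2) * R t \<le> g t + S / t" if t: "t \<ge> 1" for t
  proof -
    define s where "s = Complex \<sigma> t"
    have "s \<notin> abelian_poles" using t by (auto simp: abelian_poles_def s_def complex_eq_iff)
    hence "G s = abelian_zeta s / s - (\<Sum>k=1..6. of_real (main_coeff k) / (s - 1 / of_nat k))"
      using \<sigma> by (intro G) (auto simp: s_def)
    hence "abelian_zeta s / s = G s + (\<Sum>k=1..6. of_real (main_coeff k) / (s - 1 / of_nat k))" by simp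
    hence "norm (abelian_zeta s / s) \<le> norm (G s) + norm (\<Sum>k=1..6. of_real (main_coeff k) / (s - 1 / of_nat k))"
      by (simp only: norm_triangle_ineq)
    also have "norm (\<Sum>k=1..6. of_real (main_coeff k) / (s - 1 / of_nat k)) \<le> (\<Sum>k=1..6. \<bar>main_coeff k\<bar> / t)"
    proof (rule order.trans[OF norm_sum sum_mono])
      fix k :: nat assume "k \<in> {1..6}"
      have "t \<le> norm (s - 1 / of_nat k)" using abs_Im_le_cmod[of "s - 1 / of_nat k"] t by (simp add: s_def Im_divide_of_nat)
      thus "norm (of_real (main_coeff k) / (s - 1 / of_nat k)) \<le> \<bar>main_coeff k\<bar> / t"
        using t unfolding norm_divide norm_of_real by (intro divide_left_mono mult_pos_pos) auto
    qed
    also have "\<dots> = S / t" by (simp add: S_def sum_divide_distrib)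
    finally have up: "norm (abelian_zeta s / s) \<le> g t + S / t" by (simp add: g_def s_def)
    have ns: "0 < norm s" "norm s \<le> 2 * t"
      using cmod_le[of s] t \<sigma> by (auto simp: s_def complex_eq_iff)
    have "t powr (3 / 2 - 6 * \<sigma>) = t * t powr (e - 1 / 2)"
      using t by (simp add: e_def powr_mult_base)
    hence "c / 2 * t powr (e - 1 / 2) * R t = c * t powr (3 / 2 - 6 * \<sigma>) * R t / (2 * t)" using t by simp
    also have "\<dots> \<le> norm (abelian_zeta s) / (2 * t)" unfolding R_def s_def using t by (intro divide_right_mono c(2)) auto
    also have "\<dots> \<le> norm (abelian_zeta s) / norm s" using ns t by (intro divide_left_mono mult_pos_pos) auto
    also have "\<dots> = norm (abelian_zeta s / s)" by (simp add: norm_divide)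
    also note up
    finally show ?thesis .
  qed
  have contG: "continuous_on A g" for A
    unfolding g_def Complex_eq
    by (intro continuous_intros continuous_on_compose2[OF holomorphic_on_imp_continuous_on[OF hol]]) (use \<sigma> in auto)
  have bound: "c * C / 4 * T powr (e + 1 / 2) \<le> (sqrt T * integral {T..2 * T} (\<lambda>t. (g t)\<^sup>2) + sqrt T) / 2 + S" if T: "T \<ge> 1" "T \<ge> T0" for T
  proof -
    define w where "w = c / 2 * (2 * T) powr (e - 1 / 2)"
    have w: "w > 0" using c T by (simp add: w_def)
    have Rint: "R integrable_on {T..2 * T}"
    proof (rule ccontr)
      assume "\<not> R integrable_on {T..2 * T}"
      hence "integral {T..2 * T} R = 0" by (rule not_integrable_integral)
      moreover have "C * T > 0" using C T by simp
      ultimately show False using C(2)[OF T(2)] by (simp add: R_def[abs_def])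
    qed
    have g2: "(\<lambda>t. (g t)\<^sup>2) integrable_on {T..2 * T}" by (intro integrable_continuous_real continuous_intros contG)
    have "w * (C * T) \<le> w * integral {T..2 * T} R" using C(2)[OF T(2)] w by (intro mult_left_mono) (auto simp: R_def[abs_def])
    also have "\<dots> = integral {T..2 * T} (\<lambda>t. w * R t)" by simp
    also have "\<dots> \<le> integral {T..2 * T} (\<lambda>t. sqrt T / 2 * (g t)\<^sup>2 + (1 / (2 * sqrt T) + S / T))"
    proof (rule integral_le)
      show "(\<lambda>t. w * R t) integrable_on {T..2 * T}" by (intro integrable_on_mult_right Rint)
      show "(\<lambda>t. sqrt T / 2 * (g t)\<^sup>2 + (1 / (2 * sqrt T) + S / T)) integrable_on {T..2 * T}"
        by (intro integrable_continuous_real continuous_intros contG)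
      fix t assume t: "t \<in> {T..2 * T}"
      have "w \<le> c / 2 * t powr (e - 1 / 2)"
        unfolding w_def using t T c e by (intro mult_left_mono powr_mono2') auto
      hence "w * R t \<le> c / 2 * t powr (e - 1 / 2) * R t" by (intro mult_right_mono) (auto simp: R_def)
      also have "\<dots> \<le> g t + S / t" using t T by (intro pointwise) auto
      also have "S / t \<le> S / T" using t T S by (intro divide_left_mono) auto
      \<comment> \<open>the Cauchy-Schwarz inequality in linearised form, balanced for \<open>g t\<close> of size \<open>1 / sqrt T\<close>\<close>
      also have "g t \<le> sqrt T / 2 * (g t)\<^sup>2 + 1 / (2 * sqrt T)"
      proof -
        have "0 \<le> (sqrt T * g t - 1)\<^sup>2 / (2 * sqrt T)" using T by simp
        also have "\<dots> = sqrt T / 2 * (g t)\<^sup>2 + 1 / (2 * sqrt T) - g t"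
          using T by (simp add: power2_eq_square field_simps)
        finally show ?thesis by simp
      qed
      finally show "w * R t \<le> sqrt T / 2 * (g t)\<^sup>2 + (1 / (2 * sqrt T) + S / T)" by simp
    qed
    also have "\<dots> = sqrt T / 2 * integral {T..2 * T} (\<lambda>t. (g t)\<^sup>2) + T * (1 / (2 * sqrt T) + S / T)"
      using T by (subst Henstock_Kurzweil_Integration.integral_add) (auto intro!: integrable_on_mult_right g2)
    also have "T * (1 / (2 * sqrt T) + S / T) = sqrt T / 2 + S"
      using T by (simp add: distrib_left real_div_sqrt)
    finally have 1: "w * (C * T) \<le> sqrt T / 2 * integral {T..2 * T} (\<lambda>t. (g t)\<^sup>2) + (sqrt T / 2 + S)" .
    have "1 / 2 \<le> (2 :: real) powr (e - 1 / 2)" using powr_mono[of "- 1" "e - 1 / 2" "2 :: real"] e by (simp add: powr_minus_divide)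
    hence "c / 2 * (1 / 2 * T powr (e - 1 / 2)) * (C * T) \<le> w * (C * T)"
      unfolding w_def powr_mult using T c C by (intro mult_right_mono mult_left_mono) auto
    also have "c / 2 * (1 / 2 * T powr (e - 1 / 2)) * (C * T) = c * C / 4 * (T * T powr (e - 1 / 2))" by simp
    also have "T * T powr (e - 1 / 2) = T powr (e + 1 / 2)" using T by (simp add: powr_mult_base add.commute)
    finally show ?thesis using 1 by (simp add: field_simps)
  qed
  have "filterlim (\<lambda>T. c * C / 4 * T powr (e + 1 / 2) - ((sqrt T * M + sqrt T) / 2 + S)) at_top at_top"
    using c(1) C(1) e by real_asymp
  hence "\<forall>\<^sub>F T in at_top. c * C / 4 * T powr (e + 1 / 2) - ((sqrt T * M + sqrt T) / 2 + S) > 0"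
    unfolding filterlim_at_top_dense by blast
  then obtain T where T: "T \<ge> 1" "T \<ge> T0" "(sqrt T * M + sqrt T) / 2 + S < c * C / 4 * T powr (e + 1 / 2)"
    using eventually_happens'[OF _ eventually_conj[OF _ eventually_conj[OF eventually_ge_at_top[of 1] eventually_ge_at_top[of T0]]]]
    by (metis (no_types, lifting) diff_gt_0_iff_gt trivial_limit_at_top_linorder)
  have "sqrt T * M < sqrt T * integral {T..2 * T} (\<lambda>t. (g t)\<^sup>2)" using less_le_trans[OF T(3) bound[OF T(1,2)]] by simp
  hence "M < integral {T..2 * T} (\<lambda>t. (g t)\<^sup>2)" using T(1) by simp
  with T(1) that[of T] show thesis by (simp add: g_def)
qed

section \<open>The dichotomy\<close>

lemma not_is_Omega_imp_eventually_le:
  assumes "\<not> is_Omega f g" and g: "eventually (\<lambda>x. g x > 0) at_top"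
  shows "eventually (\<lambda>x. \<bar>f x\<bar> \<le> g x) at_top"
proof -
  have "Limsup at_top (\<lambda>x. ereal (\<bar>f x\<bar> / g x)) < 1"
    using assms(1) unfolding is_Omega_def not_less by (rule le_less_trans) simp
  hence "eventually (\<lambda>x. ereal (\<bar>f x\<bar> / g x) < 1) at_top" by (rule Limsup_lessD)
  with g show ?thesis by eventually_elim (simp add: one_ereal_def divide_simps)
qed

lemma not_is_Omega_pm_imp_one_sided:
  assumes "\<not> is_Omega_pm f g" and g: "eventually (\<lambda>x. g x > 0) at_top"
  obtains \<epsilon> :: real where "\<epsilon> = 1 \<or> \<epsilon> = - 1" "eventually (\<lambda>x. \<epsilon> * f x \<le> g x) at_top"
proof (cases "Limsup at_top (\<lambda>x. ereal (f x / g x)) > 0")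
  case False
  hence "Limsup at_top (\<lambda>x. ereal (f x / g x)) < 1" unfolding not_less by (rule le_less_trans) simp
  hence "eventually (\<lambda>x. ereal (f x / g x) < 1) at_top" by (rule Limsup_lessD)
  with g have "eventually (\<lambda>x. 1 * f x \<le> g x) at_top"
    by eventually_elim (simp add: one_ereal_def divide_simps)
  thus thesis using that by blast
next
  case True
  hence "0 \<le> Liminf at_top (\<lambda>x. ereal (f x / g x))" using assms(1) by (simp add: is_Omega_pm_def not_less)
  hence "- 1 < Liminf at_top (\<lambda>x. ereal (f x / g x))" by (rule less_le_trans[rotated]) simp
  hence "eventually (\<lambda>x. - 1 < ereal (f x / g x)) at_top" by (rule less_LiminfD)
  with g have "eventually (\<lambda>x. (- 1) * f x \<le> g x) at_top"
    by eventually_elim (simp add: one_ereal_def divide_simps)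
  thus thesis using that by blast
qed

theorem proposition2:
  fixes \<delta> :: real
  assumes "0 < \<delta>" and "\<delta> < 1 / 42"
  shows "is_Omega (\<lambda>T. integral {T..2 * T} (\<lambda>x. Delta x ^ 4)) (\<lambda>T. T powr (5 / 3 + \<delta>)) \<or>
         is_Omega_pm Delta (\<lambda>x. x powr (1 / 6 - \<delta>))"
proof (rule ccontr)
  assume contr: "\<not> ?thesis"
  have pos: "eventually (\<lambda>x :: real. x powr a > 0) at_top" for a
    by (rule eventually_mono[OF eventually_gt_at_top[of 0]]) simp
  have no\<Omega>: "\<not> is_Omega (\<lambda>T. integral {T..2 * T} (\<lambda>x. Delta x ^ 4)) (\<lambda>T. T powr (5 / 3 + \<delta>))"
    and no\<Omega>pm: "\<not> is_Omega_pm Delta (\<lambda>x. x powr (1 / 6 - \<delta>))" using contr by blast+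
  obtain T1 where T1: "\<And>T. T \<ge> T1 \<Longrightarrow> \<bar>integral {T..2 * T} (\<lambda>x. Delta x ^ 4)\<bar> \<le> T powr (5 / 3 + \<delta>)"
    using not_is_Omega_imp_eventually_le[OF no\<Omega> pos] unfolding eventually_at_top_linorder by blast
  obtain \<epsilon> where \<epsilon>: "\<epsilon> = 1 \<or> \<epsilon> = - 1" and "eventually (\<lambda>x. \<epsilon> * Delta x \<le> x powr (1 / 6 - \<delta>)) at_top"
    by (rule not_is_Omega_pm_imp_one_sided[OF no\<Omega>pm pos])
  then obtain X where X: "\<And>x. x \<ge> X \<Longrightarrow> \<epsilon> * Delta x \<le> x powr (1 / 6 - \<delta>)"
    unfolding eventually_at_top_linorder by blast
  obtain G where hol: "G holomorphic_on {s. Re s > 1 / 7}"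
    and G: "\<And>s. Re s > 1 / 7 \<Longrightarrow> s \<notin> abelian_poles \<Longrightarrow>
       G s = abelian_zeta s / s - (\<Sum>k=1..6. of_real (main_coeff k) / (s - 1 / of_nat k))"
    using abelian_zeta_subtract_poles by blast
  have \<theta>: "1 / 7 < 1 / 6 - \<delta>" "1 / 6 - \<delta> < 1" using assms by auto
  have continued: "set_integrable lborel {1..} (\<lambda>x. of_real (Delta x) * of_real x powr (- s - 1) :: complex)"
    "(LINT x:{1..}|lborel. of_real (Delta x) * of_real x powr (- s - 1)) = G s" if "Re s > 1 / 6 - \<delta>" for s
    by (rule one_sided_bound_imp_Delta_mellin_continues[OF \<theta> \<epsilon> _ hol _ that], erule X, erule (1) G)+
  have abs_int: "set_integrable lborel {1..} (\<lambda>x. \<bar>Delta x\<bar> * x powr (- a - 1))" if a: "a > 1 / 6 - \<delta>" for a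
  proof -
    have "integrable lborel (\<lambda>x. norm (indicator {1..} x *\<^sub>R (of_real (Delta x) * of_real x powr (- of_real a - 1) :: complex)))"
      using continued(1)[of "of_real a"] a by (intro integrable_norm) (simp add: set_integrable_def)
    also have "(\<lambda>x. norm (indicator {1..} x *\<^sub>R (of_real (Delta x) * of_real x powr (- of_real a - 1) :: complex))) =
        (\<lambda>x. indicator {1..} x *\<^sub>R (\<bar>Delta x\<bar> * x powr (- a - 1)))"
      by (auto simp: indicator_def norm_mult norm_of_real_powr)
    finally show ?thesis by (simp add: set_integrable_def)
  qed
  \<comment> \<open>below \<open>1 / 6\<close>, where the mean square of \<open>G\<close> diverges, but large enough for the weighted square of \<open>Delta\<close> to be integrable\<close>
  define \<sigma> where "\<sigma> = 1 / 6 - \<delta> / 12"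
  have \<sigma>: "1 / 7 < \<sigma>" "\<sigma> < 1 / 6" "1 / 6 - \<delta> < \<sigma>" using assms by (auto simp: \<sigma>_def)
  have "set_integrable lborel {1..} (\<lambda>x. (Delta x)\<^sup>2 * x powr (- 2 * \<sigma> - 1))"
    unfolding \<sigma>_def by (rule mean_square_finite[OF assms abs_int abs_le_D1[OF T1]]) (use assms in auto)
  moreover have "(LINT x:{1..}|lborel. of_real (Delta x) * of_real x powr (- Complex \<sigma> t - 1)) = G (Complex \<sigma> t)" for t
    using \<sigma> by (intro continued(2)) auto
  ultimately obtain M where M: "M \<ge> 0"
    "\<And>T. T > 0 \<Longrightarrow> set_integrable lborel {0..T} (\<lambda>t. (norm (G (Complex \<sigma> t)))\<^sup>2)"
    "\<And>T. T > 0 \<Longrightarrow> (LINT t:{0..T}|lborel. (norm (G (Complex \<sigma> t)))\<^sup>2) \<le> M"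
    using Delta_mean_square_bound[OF abs_int[OF \<sigma>(3)]] by blast
  obtain T where T: "T > 0" "M < integral {T..2 * T} (\<lambda>t. (norm (G (Complex \<sigma> t)))\<^sup>2)"
    using continued_mellin_mean_square_unbounded[OF \<sigma>(1,2) hol G] by blast
  have T2: "2 * T > 0" using T by simp
  note int = set_borel_integral_eq_integral[OF M(2)[OF T2]]
  have "integral {T..2 * T} (\<lambda>t. (norm (G (Complex \<sigma> t)))\<^sup>2) \<le> integral {0..2 * T} (\<lambda>t. (norm (G (Complex \<sigma> t)))\<^sup>2)"
    using T(1) by (intro integral_subset_le integrable_subinterval_real[OF int(1)] int(1)) auto
  also have "\<dots> \<le> M" using M(3)[OF T2] unfolding int(2) .
  finally show False using T(2) by simp
qed

end
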